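(* Let $G\colon\mathcal{P}(X)\to\mathbb{R}\cup\{+\infty\}$ be bounded below and lower semicontinuous with respect to weak convergence of measures. Let $\{P_n\}_{n\in\mathbb{N}}\subset\mathcal{P}(E_0)$ and $P\in\mathcal{P}(E_0)$ be such that $P_n\xrightarrow{\mathcal{J}}P$, and suppose that there exists a $G$-regularized Fréchet barycenter of $P$, i.e. $\mathrm{Bar}_G(P)\neq\emptyset$. Then there is $n_0\in\mathbb{N}$ such that $\mathrm{Bar}_G(P_n)\neq\emptyset$ for all $n\ge n_0$, and for any choice $\nu_n\in\mathrm{Bar}_G(P_n)$, $n\ge n_0$, the sequence $\{\nu_n\}_{n\ge n_0}$ is precompact in the topology $\tau_J$ and every partial limit (limit of a $\tau_J$-convergent subsequence) of it belongs to $\mathrm{Bar}_G(P)$. In particular, if $\mathrm{Bar}_G(P)=\{\nu^*\}$ is a singleton, then $\nu_n\xrightarrow{J}\nu^*$.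
   Context: Setting. $(X,\rho)$ is a Radon space: a separable metric space such that for every Borel probability measure $\mu$ on $X$ and every $\epsilon>0$ there is a compact set $D$ with $\mu(X\setminus D)<\epsilon$. $\mathcal{P}(X)$ is the set of Borel probability measures on $X$. The cost function $c\colon X\times X\to[0,\infty)$ is continuous and consistent: for any $x\in X$ and $\{x_n\}\subset X$, $c(x,x_n)\to0$ iff $c(x_n,x)\to0$ iff $x_n\to x$. Growth assumption: there are constants $A,B\ge0$ such that for all $x,y,z\in X$ the number $c(x,y)$ is at most each of $A+B(c(x,z)+c(y,z))$, $A+B(c(x,z)+c(z,y))$, $A+B(c(z,x)+c(y,z))$, $A+B(c(z,x)+c(z,y))$. Compactness assumption: for some (and therefore any) $x_0\in X$ and all $r\ge 0$ the set $\{y\in X: c(x_0,y)\le r\}$ is compact. Transportation cost: $J(\mu,\nu)=\inf_{\gamma\in\Pi(\mu,\nu)}\int c(x,y)\,d\gamma(x,y)\in[0,\infty]$, where $\Pi(\mu,\nu)$ is the set of Borel probability measures on $X\times X$ with first marginal $\mu$ and second marginal $\nu$. The balls $\{\nu: J(\mu,\nu)<r\}$, $\mu\in\mathcal{P}(X)$, $r>0$, form a basis of a topology $\tau_J$ on $\mathcal{P}(X)$; $\nu_n\xrightarrow{J}\nu^*$ denotes convergence in $\tau_J$, equivalently $J(\nu_n,\nu^* )\to0$ and $J(\nu^*,\nu_n)\to0$. $E_0=\{\nu\in\mathcal{P}(X): J(\delta_{x_0},\nu)<\infty\}$ (independent of $x_0\in X$), endowed with $\tau_J$, and $\mathcal{P}(E_0)$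 is the set of Borel probability measures on $(E_0,\tau_J)$. (On $E_0$ the Borel $\sigma$-algebras of $\tau_J$ and of the weak topology coincide.) For $P,P'\in\mathcal{P}(E_0)$, $\mathcal{J}(P,P')=\inf_F\int J(\mu,\nu)\,dF(\mu,\nu)$, the infimum being over Borel probability measures $F$ on $E_0\times E_0$ with marginals $P$ and $P'$. $P_n\xrightarrow{\mathcal{J}}P$ means $\mathcal{J}(P_n,P)\to0$ and $\mathcal{J}(P,P_n)\to0$. $G$-regularized Fréchet barycenter of $P$: a measure $\nu\in\mathcal{P}(X)$ at which the functional $\nu\mapsto\int J(\mu,\nu)\,dP(\mu)+G(\nu)$ attains its minimum over $\mathcal{P}(X)$, this minimum being finite. $\mathrm{Bar}_G(P)$ is the set of all of them (empty if the functional is identically $+\infty$). Precompact means having compact closure. *)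

theory Defs
  imports "HOL-Probability.Probability"
begin

text \<open>
  The space \<open>X\<close> is a type of class \<open>metric_space\<close> and \<open>second_countable_topology\<close>, that is, a
  separable metric space; the set of Borel probability measures on it is
  \<open>space (prob_algebra borel)\<close>.
\<close>

definition radon_space :: "'a::{metric_space,second_countable_topology} itself \<Rightarrow> bool" where
  "radon_space _ \<longleftrightarrow>
    (\<forall>\<mu>\<in>space (prob_algebra (borel :: 'a measure)). \<forall>\<epsilon>>0. \<exists>D. compact D \<and> measure \<mu> (UNIV - D) < \<epsilon>)"

definition consistent_cost :: "('a::metric_space \<Rightarrow> 'a \<Rightarrow> real) \<Rightarrow> bool" where
  "consistent_cost c \<longleftrightarrow> (\<forall>x xs.
     ((\<lambda>n. c x (xs n)) \<longlonglongrightarrow> 0 \<longleftrightarrow> (\<lambda>n. c (xs n) x) \<longlonglongrightarrow> 0) \<and>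
     ((\<lambda>n. c (xs n) x) \<longlonglongrightarrow> 0 \<longleftrightarrow> xs \<longlonglongrightarrow> x))"

definition growth_condition :: "('a \<Rightarrow> 'a \<Rightarrow> real) \<Rightarrow> bool" where
  "growth_condition c \<longleftrightarrow> (\<exists>A\<ge>0. \<exists>B\<ge>0. \<forall>x y z.
     c x y \<le> A + B * (c x z + c y z) \<and>
     c x y \<le> A + B * (c x z + c z y) \<and>
     c x y \<le> A + B * (c z x + c y z) \<and>
     c x y \<le> A + B * (c z x + c z y))"

definition compact_cost_balls :: "('a::metric_space \<Rightarrow> 'a \<Rightarrow> real) \<Rightarrow> bool" where
  "compact_cost_balls c \<longleftrightarrow> (\<exists>x0. \<forall>r\<ge>0. compact {y. c x0 y \<le> r})"

text \<open>
  The argument \<open>S\<close> carries the Borel \<open>\<sigma>\<close>-algebra of the product space: \<open>borel\<close> for measures on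
  \<open>X \<times> X\<close>, and the Borel algebra of the product topology one level up.
\<close>

definition couplings ::
    "('b \<times> 'b) measure \<Rightarrow> 'b measure \<Rightarrow> 'b measure \<Rightarrow> ('b \<times> 'b) measure set" where
  "couplings S \<mu> \<nu> = {\<gamma> \<in> space (prob_algebra S). distr \<gamma> \<mu> fst = \<mu> \<and> distr \<gamma> \<nu> snd = \<nu>}"

definition transport_cost ::
    "('a::{metric_space,second_countable_topology} \<Rightarrow> 'a \<Rightarrow> real) \<Rightarrow> 'a measure \<Rightarrow> 'a measure \<Rightarrow> ennreal" where
  "transport_cost c \<mu> \<nu> = (INF \<gamma>\<in>couplings borel \<mu> \<nu>. \<integral>\<^sup>+ (x, y). ennreal (c x y) \<partial>\<gamma>)"

text \<open>
  The balls form a basis of the topology under the standing assumptions on \<open>c\<close>; generating from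
  them as a subbasis yields a topology without having to prove this first.
\<close>

definition cost_topology ::
    "('a::{metric_space,second_countable_topology} \<Rightarrow> 'a \<Rightarrow> real) \<Rightarrow> 'a measure topology" where
  "cost_topology c = topology_generated_by
     {{\<nu> \<in> space (prob_algebra borel). transport_cost c \<mu> \<nu> < ennreal r} | \<mu> r.
        \<mu> \<in> space (prob_algebra borel) \<and> 0 < r}"

definition finite_cost_topology ::
    "('a::{metric_space,second_countable_topology} \<Rightarrow> 'a \<Rightarrow> real) \<Rightarrow> 'a \<Rightarrow> 'a measure topology" where
  "finite_cost_topology c x0 = subtopology (cost_topology c)
     {\<nu> \<in> space (prob_algebra borel). transport_cost c (return borel x0) \<nu> < \<infinity>}"

definition borel_of :: "'b topology \<Rightarrow> 'b measure" where
  "borel_of T = sigma (topspace T) {U. openin T U}"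

definition outer_cost ::
    "('a::{metric_space,second_countable_topology} \<Rightarrow> 'a \<Rightarrow> real) \<Rightarrow> 'a \<Rightarrow>
       'a measure measure \<Rightarrow> 'a measure measure \<Rightarrow> ennreal" where
  "outer_cost c x0 P P' =
     (INF F\<in>couplings
        (borel_of (prod_topology (finite_cost_topology c x0) (finite_cost_topology c x0))) P P'.
      \<integral>\<^sup>+ (\<mu>, \<nu>). transport_cost c \<mu> \<nu> \<partial>F)"

definition weakly_converges ::
    "(nat \<Rightarrow> 'a::{metric_space,second_countable_topology} measure) \<Rightarrow> 'a measure \<Rightarrow> bool" where
  "weakly_converges \<nu> \<nu>' \<longleftrightarrow> (\<forall>f::'a \<Rightarrow> real. continuous_on UNIV f \<and> bounded (range f) \<longrightarrow>
     (\<lambda>n. \<integral>x. f x \<partial>\<nu> n) \<longlonglongrightarrow> (\<integral>x. f x \<partial>\<nu>'))"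

text \<open>
  Sequential lower semicontinuity; the weak topology on the Borel probability measures of a
  separable metric space is metrizable, so sequences suffice.
\<close>

definition weakly_lsc ::
    "('a::{metric_space,second_countable_topology} measure \<Rightarrow> ereal) \<Rightarrow> bool" where
  "weakly_lsc G \<longleftrightarrow> (\<forall>\<nu> \<nu>'. (\<forall>n. \<nu> n \<in> space (prob_algebra borel)) \<and> \<nu>' \<in> space (prob_algebra borel) \<and>
     weakly_converges \<nu> \<nu>' \<longrightarrow> G \<nu>' \<le> liminf (\<lambda>n. G (\<nu> n)))"

definition frechet_functional ::
    "('a::{metric_space,second_countable_topology} \<Rightarrow> 'a \<Rightarrow> real) \<Rightarrow> ('a measure \<Rightarrow> ereal) \<Rightarrow>
       'a measure measure \<Rightarrow> 'a measure \<Rightarrow> ereal" where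
  "frechet_functional c G P \<nu> = enn2ereal (\<integral>\<^sup>+ \<mu>. transport_cost c \<mu> \<nu> \<partial>P) + G \<nu>"

definition barycenters ::
    "('a::{metric_space,second_countable_topology} \<Rightarrow> 'a \<Rightarrow> real) \<Rightarrow> ('a measure \<Rightarrow> ereal) \<Rightarrow>
       'a measure measure \<Rightarrow> 'a measure set" where
  "barycenters c G P = {\<nu> \<in> space (prob_algebra borel).
     \<bar>frechet_functional c G P \<nu>\<bar> \<noteq> \<infinity> \<and>
     (\<forall>\<nu>'\<in>space (prob_algebra borel). frechet_functional c G P \<nu> \<le> frechet_functional c G P \<nu>')}"

definition precompact_in :: "'b topology \<Rightarrow> 'b set \<Rightarrow> bool" where
  "precompact_in T S \<longleftrightarrow> compactin T (T closure_of S)"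

end

theory Submission
  imports Defs
begin

text \<open>
  Write \<open>moment \<nu>\<close> for \<open>\<integral> c x0 y d\<nu> = J (\<delta> x0) \<nu>\<close>. The sublevel sets of \<open>c x0\<close> are compact, so sequences with
  bounded moments have weakly convergent subsequences, \<open>J\<close> is lower semicontinuous along them, and
  convergence to a measure of finite moment in the cost topology is weak convergence together with
  convergence of the moments.

  At the outer level, the envelopes \<open>inf \<mu>. J \<mu> \<nu> + t * J \<mu> \<mu>'\<close> and \<open>sup \<mu>. J \<mu> \<nu> - t * J \<mu> \<mu>'\<close> are Borel in
  \<open>\<mu>'\<close>, approximate \<open>J \<mu>' \<nu>\<close> as \<open>t\<close> grows, and compare integrals against \<open>Pn n\<close> and \<open>P\<close> up to \<open>t\<close> times
  the outer cost. Hence \<open>\<integral> J \<mu> \<nu> dP \<le> liminf \<integral> J \<mu> (\<nu> n) d(Pn n)\<close> if \<open>\<nu> n\<close> converges weakly to \<open>\<nu>\<close>, with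
  equality in the limit if \<open>\<nu> n = \<nu>\<close> is constant. The direct method gives minimisers for \<open>Pn n\<close>, and
  weak limits of them minimise for \<open>P\<close>. Convergence of the minimal values, combined with the same
  lower bound for the cost \<open>A + B * (c x x0 + c x y) - c x0 y \<ge> 0\<close>, then yields convergence of the moments.
\<close>

section \<open>Weak convergence and compactness\<close>

text \<open>The growth condition replaces the triangle inequality only up to the constants
  \<open>A\<close> and \<open>B\<close>, so estimates by \<open>J\<close> alone do not close up in
  the limit. Upper bounds come instead from lower semicontinuity of a slack: if
  \<open>a n + m n\<close> converges and the nonnegative \<open>a n\<close> is lower semicontinuous,
  then \<open>m n\<close> is upper semicontinuous, provided the limits are finite
  (\<open>limsup_le_of_liminf_add\<close>). The slack is \<open>A + B * (g x + k x y) - g y\<close>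
  for moments, \<open>A + B * (g x + g y) - k x y\<close> for costs, the penalty for integrated
  costs, and \<open>moment_defect\<close> for moments of minimisers. The second obstacle is
  measurability: \<open>P\<close> lives on the Borel sets of a topology that is merely generated by
  balls of the nonsymmetric \<open>J\<close>, and neither metrizability nor joint measurability of
  \<open>J\<close> is available there. The envelopes are chosen because their strict sublevel or
  superlevel sets are visibly unions of such balls within \<open>E0\<close>.\<close>

abbreviation (input) borel_probs :: "'b::topological_space measure set" where
  "borel_probs \<equiv> space (prob_algebra borel)"

lemma borel_probsD:
  assumes "\<nu> \<in> borel_probs"
  shows "prob_space \<nu>" "sets \<nu> = sets borel" "space \<nu> = UNIV"
  using assms sets_eq_imp_space_eq[of \<nu> borel] by (auto simp: space_prob_algebra)

lemma borel_probsI: "prob_space \<nu> \<Longrightarrow> sets \<nu> = sets borel \<Longrightarrow> \<nu> \<in> borel_probs"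
  by (auto simp: space_prob_algebra)

lemma borel_measurable_borel_probs:
  assumes "\<nu> \<in> borel_probs" "f \<in> borel_measurable borel"
  shows "f \<in> borel_measurable \<nu>"
  using assms borel_probsD(2)[OF assms(1)] by (simp cong: measurable_cong_sets)

lemma continuous_measurable_borel_probs:
  fixes f :: "'b::topological_space \<Rightarrow> 'c::topological_space"
  assumes "\<nu> \<in> borel_probs" "continuous_on UNIV f"
  shows "f \<in> borel_measurable \<nu>"
  by (rule borel_measurable_borel_probs[OF assms(1) borel_measurable_continuous_onI[OF assms(2)]])

lemma integrable_borel_probs:
  fixes f :: "'b::topological_space \<Rightarrow> real"
  assumes "\<nu> \<in> borel_probs" "f \<in> borel_measurable borel" "\<And>x. \<bar>f x\<bar> \<le> B"
  shows "integrable \<nu> f"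
proof -
  interpret prob_space \<nu> using borel_probsD(1)[OF assms(1)] .
  show ?thesis
    using assms by (intro integrable_const_bound[where B=B] AE_I2) (auto simp: borel_measurable_borel_probs[OF assms(1)])
qed

section \<open>Countable families of Lipschitz functions that determine a measure\<close>

definition test_fun :: "'b::metric_space set \<Rightarrow> nat \<Rightarrow> 'b \<Rightarrow> real" where
  "test_fun U k x = min 1 (real k * infdist x (- U))"

lemma test_fun_bounds: "0 \<le> test_fun U k x" "test_fun U k x \<le> 1"
  by (auto simp: test_fun_def infdist_nonneg)

lemma test_fun_lipschitz: "\<bar>test_fun U k x - test_fun U k y\<bar> \<le> real k * dist x y"
proof -
  have "\<bar>infdist x (- U) - infdist y (- U)\<bar> \<le> dist x y"
    using infdist_triangle_abs[of x "- U" y] by simp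
  then have "\<bar>real k * infdist x (- U) - real k * infdist y (- U)\<bar> \<le> real k * dist x y"
    by (simp add: right_diff_distrib[symmetric] abs_mult mult_left_mono)
  then show ?thesis unfolding test_fun_def by linarith
qed

lemma continuous_on_test_fun: "continuous_on S (test_fun U k)"
  unfolding test_fun_def by (intro continuous_intros)

text \<open>\<open>infdist\<close> to the empty set is 0, so for \<open>U = UNIV\<close> the
  functions vanish identically; this is why that case is excluded.\<close>

lemma test_fun_tendsto_indicator:
  assumes "open U" "- U \<noteq> {}"
  shows "(\<lambda>k. test_fun U k x) \<longlonglongrightarrow> indicator U x"
proof (cases "x \<in> U")
  case True
  have "infdist x (- U) > 0"
    using assms True by (simp add: infdist_pos_not_in_closed closed_Compl)
  then have "filterlim (\<lambda>k. infdist x (- U) * real k) at_top sequentially"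
    by (intro filterlim_tendsto_pos_mult_at_top[OF tendsto_const] filterlim_real_sequentially)
  then have "\<forall>\<^sub>F k in sequentially. 1 \<le> infdist x (- U) * real k"
    by (simp add: filterlim_at_top)
  then have "\<forall>\<^sub>F k in sequentially. test_fun U k x = 1"
    by eventually_elim (simp add: test_fun_def mult.commute)
  then show ?thesis using True by (simp add: tendsto_eventually)
next
  case False
  then show ?thesis by (simp add: test_fun_def)
qed

text \<open>Only identification of measures is asked for; convergence follows from compactness in
  \<open>weakly_convergesI_test_function\<close>. The Lipschitz bound serves
  \<open>transport_cost_usc\<close>, where integrals are compared along pairs of points that are
  close with high probability.\<close>

definition determining_family :: "(nat \<Rightarrow> 'b::{metric_space,second_countable_topology} \<Rightarrow> real) \<Rightarrow> bool" where
  "determining_family f \<longleftrightarrow>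
     (\<forall>i x. 0 \<le> f i x \<and> f i x \<le> 1) \<and> (\<forall>i. \<exists>L\<ge>0. \<forall>x y. \<bar>f i x - f i y\<bar> \<le> L * dist x y) \<and>
     (\<forall>\<mu>\<in>borel_probs. \<forall>\<nu>\<in>borel_probs. (\<forall>i. (\<integral>x. f i x \<partial>\<mu>) = (\<integral>x. f i x \<partial>\<nu>)) \<longrightarrow> \<mu> = \<nu>)"

text \<open>The integrals of \<open>test_fun U k\<close> converge to the mass of \<open>U\<close> as
  \<open>k\<close> grows, and the masses on a generating \<pi>-system determine the measure. One
  index enumerates all pairs of a basic set and a \<open>k\<close>.\<close>

lemma ex_determining_family:
  "\<exists>f :: nat \<Rightarrow> 'b::{metric_space,second_countable_topology} \<Rightarrow> real. determining_family f"
proof -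
  obtain B0 :: "'b set set" where B0: "countable B0" "topological_basis B0"
    using ex_countable_basis by blast
  \<comment> \<open>Finite intersections turn the base into a \<pi>-system; the empty intersection
    contributes \<open>UNIV\<close>, the exhausting set in the uniqueness theorem.\<close>
  define B where "B = Inter ` {F. finite F \<and> F \<subseteq> B0}"
  have cB: "countable B" unfolding B_def
    using B0(1) by (intro countable_image countable_Collect_finite_subset)
  have UB: "UNIV \<in> B" unfolding B_def by (rule image_eqI[of _ _ "{}"]) auto
  have oB: "open U" if "U \<in> B" for U
    using that topological_basis_open[OF B0(2)] unfolding B_def by auto
  have IB: "Int_stable B"
  proof (rule Int_stableI)
    fix a b assume "a \<in> B" "b \<in> B"
    then obtain F F' where "finite F" "F \<subseteq> B0" "a = \<Inter>F" "finite F'" "F' \<subseteq> B0" "b = \<Inter>F'"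
      unfolding B_def by auto
    then show "a \<inter> b \<in> B" unfolding B_def by (intro image_eqI[of _ _ "F \<union> F'"]) auto
  qed
  have sub: "B0 \<subseteq> B" unfolding B_def
  proof
    fix b assume "b \<in> B0"
    then show "b \<in> Inter ` {F. finite F \<and> F \<subseteq> B0}" by (intro image_eqI[of _ _ "{b}"]) auto
  qed
  have "topological_basis B"
    using B0(2) sub oB unfolding topological_basis_def by (meson subset_trans)
  then have bB: "sets borel = sigma_sets UNIV B"
    using borel_eq_countable_basis[OF cB] by (metis sets_measure_of top_greatest Pow_UNIV)
  define f :: "nat \<Rightarrow> 'b \<Rightarrow> real" where
    "f n = test_fun (from_nat_into B (fst (prod_decode n))) (snd (prod_decode n))" for n
  have det: "\<mu> = \<nu>" if m: "\<mu> \<in> borel_probs" and n: "\<nu> \<in> borel_probs"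
      and eq: "\<forall>i. (\<integral>x. f i x \<partial>\<mu>) = (\<integral>x. f i x \<partial>\<nu>)" for \<mu> \<nu>
  proof -
    interpret M: prob_space \<mu> using borel_probsD[OF m] by simp
    interpret N: prob_space \<nu> using borel_probsD[OF n] by simp
    have lim: "(\<lambda>k. \<integral>x. test_fun U k x \<partial>\<rho>) \<longlonglongrightarrow> measure \<rho> U"
      if r: "\<rho> \<in> borel_probs" and U: "open U" "- U \<noteq> {}" for U \<rho>
    proof -
      interpret R: prob_space \<rho> using borel_probsD[OF r] by simp
      have "(\<lambda>k. \<integral>x. test_fun U k x \<partial>\<rho>) \<longlonglongrightarrow> (\<integral>x. indicator U x \<partial>\<rho>)"
      proof (rule integral_dominated_convergence[where w="\<lambda>_. 1"])
        show "(\<lambda>x. indicat_real U x) \<in> borel_measurable \<rho>"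
          using U by (simp add: borel_measurable_borel_probs[OF r])
        show "AE x in \<rho>. (\<lambda>i. test_fun U i x) \<longlonglongrightarrow> indicator U x"
          using test_fun_tendsto_indicator[OF U] by auto
        show "AE x in \<rho>. norm (test_fun U i x) \<le> 1" for i
          using test_fun_bounds[of U i] by simp
      qed (use r U borel_probsD[OF r] in \<open>auto intro: continuous_measurable_borel_probs continuous_on_test_fun\<close>)
      then show ?thesis using borel_probsD[OF r] by simp
    qed
    have "emeasure \<mu> U = emeasure \<nu> U" if UB': "U \<in> B" for U
    proof (cases "U = UNIV")
      case True
      then show ?thesis using M.emeasure_space_1 N.emeasure_space_1 borel_probsD[OF m] borel_probsD[OF n]
        by simp
    next
      case False
      obtain j where j: "U = from_nat_into B j"
        using from_nat_into_surj[OF cB UB'] by auto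
      have "(\<integral>x. test_fun U k x \<partial>\<mu>) = (\<integral>x. test_fun U k x \<partial>\<nu>)" for k
        using eq[rule_format, of "prod_encode (j, k)"] by (simp add: f_def j)
      then have "measure \<mu> U = measure \<nu> U"
        using lim[OF m oB[OF UB']] lim[OF n oB[OF UB']] False by (auto intro: LIMSEQ_unique)
      then show ?thesis by (simp add: M.emeasure_eq_measure N.emeasure_eq_measure)
    qed
    then show "\<mu> = \<nu>"
      using borel_probsD[OF m] borel_probsD[OF n] bB UB M.emeasure_space_1 
      by (intro measure_eqI_generator_eq[OF IB, of UNIV _ _ "\<lambda>_. UNIV"]) auto
  qed
  have lip: "\<exists>L\<ge>0. \<forall>x y. \<bar>f i x - f i y\<bar> \<le> L * dist x y" for i
    unfolding f_def using test_fun_lipschitz by (intro exI[of _ "real (snd (prod_decode i))"]) auto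
  have bnd: "0 \<le> f i x \<and> f i x \<le> 1" for i x
    by (simp add: f_def test_fun_bounds)
  have "\<forall>\<mu>\<in>borel_probs. \<forall>\<nu>\<in>borel_probs. (\<forall>i. (\<integral>x. f i x \<partial>\<mu>) = (\<integral>x. f i x \<partial>\<nu>)) \<longrightarrow> \<mu> = \<nu>"
    by (intro ballI impI det)
  then have "determining_family f"
    unfolding determining_family_def by (intro conjI[OF _ conjI] allI bnd lip)
  then show ?thesis by (intro exI[of _ f])
qed

text \<open>Fixed by choice once for every type, because the family is needed both on points, for
  \<open>coords\<close>, and on pairs of points, for plans.\<close>

definition test_function :: "nat \<Rightarrow> 'b::{metric_space,second_countable_topology} \<Rightarrow> real" where
  "test_function = (SOME f. determining_family f)"

lemma determining_family_test_function:
  "determining_family (test_function :: nat \<Rightarrow> 'b::{metric_space,second_countable_topology} \<Rightarrow> real)"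
  unfolding test_function_def by (rule someI_ex[OF ex_determining_family])

lemma
  fixes x :: "'b::{metric_space,second_countable_topology}"
  shows test_function_nonneg: "0 \<le> test_function i x" and test_function_le_1: "test_function i x \<le> 1"
  using determining_family_test_function[where 'b='b, unfolded determining_family_def, THEN conjunct1]
  by simp_all

lemma abs_test_function_le_1: "\<bar>test_function i x\<bar> \<le> 1"
  using test_function_nonneg[of i x] test_function_le_1[of i x] by simp

lemma test_function_lipschitz:
  "\<exists>L\<ge>0. \<forall>x y :: 'b::{metric_space,second_countable_topology}.
     \<bar>test_function i x - test_function i y\<bar> \<le> L * dist x y"
  using determining_family_test_function[where 'b='b, unfolded determining_family_def, THEN conjunct2, THEN conjunct1]
  by simp

lemma test_functions_determine:
  fixes \<mu> \<nu> :: "'b::{metric_space,second_countable_topology} measure"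
  assumes "\<mu> \<in> borel_probs" "\<nu> \<in> borel_probs"
    and "\<And>i. (\<integral>x. test_function i x \<partial>\<mu>) = (\<integral>x. test_function i x \<partial>\<nu>)"
  shows "\<mu> = \<nu>"
  using determining_family_test_function[where 'b='b, unfolded determining_family_def, THEN conjunct2,
      THEN conjunct2, rule_format, OF assms] .

lemma continuous_on_test_function:
  fixes S :: "'b::{metric_space,second_countable_topology} set"
  shows "continuous_on S (test_function i)"
proof -
  obtain L where "L \<ge> 0" "\<forall>x y :: 'b. \<bar>test_function i x - test_function i y\<bar> \<le> L * dist x y"
    using test_function_lipschitz by blast
  then have "L-lipschitz_on S (test_function i)"
    by (simp add: lipschitz_on_def dist_real_def)
  then show ?thesis by (rule lipschitz_on_continuous_on)
qed

lemma bounded_range_test_function: "bounded (range (test_function i))"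
  unfolding bounded_iff by (intro exI[of _ 1]) (auto simp: abs_test_function_le_1)

section \<open>Basic properties of weak limits\<close>

lemma weakly_converges_unique:
  assumes "weakly_converges \<nu> \<mu>" "weakly_converges \<nu> \<mu>'" "\<mu> \<in> borel_probs" "\<mu>' \<in> borel_probs"
  shows "\<mu> = \<mu>'"
proof (rule test_functions_determine)
  fix i
  show "(\<integral>x. test_function i x \<partial>\<mu>) = (\<integral>x. test_function i x \<partial>\<mu>')"
    using assms(1,2)[unfolded weakly_converges_def, THEN spec, of "test_function i", THEN mp,
        OF conjI[OF continuous_on_test_function bounded_range_test_function]]
    by (rule LIMSEQ_unique)
qed fact+

lemma weakly_converges_subseq:
  assumes "weakly_converges \<nu> \<mu>" "strict_mono s"
  shows "weakly_converges (\<nu> \<circ> s) \<mu>"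
proof -
  have "(\<lambda>n. \<integral>x. f x \<partial>\<nu> (s n)) \<longlonglongrightarrow> (\<integral>x. f x \<partial>\<mu>)"
    if "(\<lambda>n. \<integral>x. f x \<partial>\<nu> n) \<longlonglongrightarrow> (\<integral>x. f x \<partial>\<mu>)" for f :: "'a \<Rightarrow> real"
    using LIMSEQ_subseq_LIMSEQ[OF that assms(2)] by (simp add: o_def)
  then show ?thesis using assms(1) by (simp add: weakly_converges_def o_def)
qed

lemma weakly_converges_const: "weakly_converges (\<lambda>_. \<nu>) \<nu>"
  by (simp add: weakly_converges_def)

lemma nn_integral_min_SUP:
  fixes f :: "'b \<Rightarrow> real"
  assumes "f \<in> borel_measurable M" "\<And>x. 0 \<le> f x"
  shows "(\<integral>\<^sup>+x. f x \<partial>M) = (SUP k. \<integral>\<^sup>+x. min (f x) (real k) \<partial>M)"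
proof -
  have "(SUP k. ennreal (min (f x) (real k))) = ennreal (f x)" for x
  proof (rule antisym)
    obtain k where "f x \<le> real k" using real_arch_simple by blast
    then show "ennreal (f x) \<le> (SUP k. ennreal (min (f x) (real k)))"
      by (intro SUP_upper2[of k]) auto
  qed (auto intro!: SUP_least ennreal_leI)
  then have "(\<integral>\<^sup>+x. f x \<partial>M) = (\<integral>\<^sup>+x. (SUP k. ennreal (min (f x) (real k))) \<partial>M)" by simp
  also have "\<dots> = (SUP k. \<integral>\<^sup>+x. min (f x) (real k) \<partial>M)"
    using assms by (intro nn_integral_monotone_convergence_SUP) (auto simp: incseq_def le_fun_def intro!: ennreal_leI)
  finally show ?thesis .
qed

text \<open>\<open>f\<close> may be unbounded: each truncation at \<open>k\<close> is an admissible
  test function, and its integrals increase to that of \<open>f\<close>.\<close>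

lemma weakly_converges_nn_integral_liminf:
  fixes f :: "'b::{metric_space,second_countable_topology} \<Rightarrow> real"
  assumes w: "weakly_converges \<nu> \<mu>" and n: "\<And>n. \<nu> n \<in> borel_probs" and m: "\<mu> \<in> borel_probs"
    and f: "continuous_on UNIV f" "\<And>x. 0 \<le> f x"
  shows "(\<integral>\<^sup>+x. f x \<partial>\<mu>) \<le> liminf (\<lambda>n. \<integral>\<^sup>+x. f x \<partial>\<nu> n)"
proof -
  have "(\<integral>\<^sup>+x. min (f x) (real k) \<partial>\<mu>) \<le> liminf (\<lambda>n. \<integral>\<^sup>+x. f x \<partial>\<nu> n)" for k
  proof -
    let ?h = "\<lambda>x. min (f x) (real k)"
    have c: "continuous_on UNIV ?h" using f(1) by (intro continuous_intros)
    have b: "\<bar>?h x\<bar> \<le> real k" for x using f(2)[of x] by simp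
    have "bounded (range ?h)" using b by (auto simp: bounded_iff)
    with c w have "(\<lambda>n. \<integral>x. ?h x \<partial>\<nu> n) \<longlonglongrightarrow> (\<integral>x. ?h x \<partial>\<mu>)"
      unfolding weakly_converges_def by blast
    then have L: "(\<lambda>n. ennreal (\<integral>x. ?h x \<partial>\<nu> n)) \<longlonglongrightarrow> ennreal (\<integral>x. ?h x \<partial>\<mu>)"
      by (intro tendsto_ennrealI)
    have eq: "(\<integral>\<^sup>+x. ?h x \<partial>\<rho>) = ennreal (\<integral>x. ?h x \<partial>\<rho>)" if "\<rho> \<in> borel_probs" for \<rho>
      using f(2) c by (intro nn_integral_eq_integral integrable_borel_probs[OF that _ b])
        (auto intro: borel_measurable_continuous_onI)
    have "(\<integral>\<^sup>+x. ?h x \<partial>\<mu>) = liminf (\<lambda>n. \<integral>\<^sup>+x. ?h x \<partial>\<nu> n)"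
      using lim_imp_Liminf[OF _ L] by (simp add: eq n m)
    also have "\<dots> \<le> liminf (\<lambda>n. \<integral>\<^sup>+x. f x \<partial>\<nu> n)"
      by (intro Liminf_mono always_eventually allI nn_integral_mono ennreal_leI) auto
    finally show ?thesis .
  qed
  then show ?thesis
    using f(1) by (subst nn_integral_min_SUP) (auto intro!: SUP_least f(2) continuous_measurable_borel_probs m)
qed

lemma tendsto_dist_close:
  fixes x u :: "'i \<Rightarrow> 'b::metric_space"
  assumes "((\<lambda>n. dist (x n) (u n)) \<longlongrightarrow> 0) F" "(u \<longlongrightarrow> y) F"
  shows "(x \<longlongrightarrow> y) F"
proof -
  have "((\<lambda>n. dist (x n) (u n) + dist (u n) y) \<longlongrightarrow> 0 + 0) F"
    by (rule tendsto_add[OF assms(1) tendsto_dist_iff[THEN iffD1, OF assms(2)]])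
  then have L: "((\<lambda>n. dist (x n) (u n) + dist (u n) y) \<longlongrightarrow> 0) F" by simp
  have "((\<lambda>n. dist (x n) y) \<longlongrightarrow> 0) F"
    by (rule tendsto_sandwich[OF _ _ tendsto_const L]) (simp_all add: dist_triangle)
  then show ?thesis by (rule tendsto_dist_iff[THEN iffD2])
qed

text \<open>
  Compactness is imported from the real line: the code \<open>\<phi>\<close> is only measurable, but its inverse is
  continuous and extends to the closure of the range, so weak limits given by Helly's theorem on
  the line can be pulled back.
\<close>

lemma ex_code_injection:
  fixes g :: "'b::{metric_space,second_countable_topology} \<Rightarrow> real"
  assumes g: "continuous_on UNIV g" "\<And>x. 0 \<le> g x"
  obtains \<phi> :: "'b \<Rightarrow> real" and B :: "nat \<Rightarrow> 'b set" where
    "\<phi> \<in> borel_measurable borel" "\<And>x. 0 \<le> \<phi> x" "\<And>x. \<phi> x \<le> 2 * g x + 1"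
    "\<And>x y i. \<bar>\<phi> x - \<phi> y\<bar> < 2 / 3 * (1 / 4) ^ Suc i \<Longrightarrow>
       \<lfloor>g x\<rfloor> = \<lfloor>g y\<rfloor> \<and> (\<forall>j\<le>i. x \<in> B j \<longleftrightarrow> y \<in> B j)"
    "\<And>x e. 0 < e \<Longrightarrow> \<exists>j. open (B j) \<and> x \<in> B j \<and> B j \<subseteq> ball x e"
proof -
  obtain B0 :: "'b set set" where B0: "countable B0" "topological_basis B0"
    using ex_countable_basis by blast
  define B where "B = from_nat_into B0"
  obtain b0 where "b0 \<in> B0"
    by (rule topological_basisE[OF B0(2) open_UNIV UNIV_I])
  then have B0ne: "B0 \<noteq> {}" by blast
  have oB: "open (B i)" for i
    unfolding B_def by (rule topological_basis_open[OF B0(2) from_nat_into[OF B0ne]])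
  have base: "\<exists>j. open (B j) \<and> x \<in> B j \<and> B j \<subseteq> ball x e" if e: "0 < e" for x :: 'b and e
  proof -
    obtain b where "b \<in> B0" "x \<in> b" "b \<subseteq> ball x e"
      by (rule topological_basisE[OF B0(2) open_ball[of x e] centre_in_ball[THEN iffD2, OF e]])
    moreover from this(1) obtain j where "B j = b"
      using from_nat_into_surj[OF B0(1)] unfolding B_def by blast
    ultimately show ?thesis using oB by blast
  qed
  \<comment> \<open>In base 4 the digits after place \<open>j\<close> contribute at most a third of
    the unit \<open>(1 / 4) ^ Suc j\<close> of that place, so a first difference at \<open>j\<close>
    leaves the codes at least two thirds of that unit apart. This is the origin of the constant
    \<open>2 / 3\<close>.\<close>
  define t where "t x i = (1 / 4 :: real) ^ Suc i * indicator (B i) x" for x i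
  have geo: "(\<lambda>i. (1 / 4 :: real) ^ Suc i) sums (1 / 3)"
    using sums_mult[OF geometric_sums[of "1/4::real"], of "1/4"] by simp
  have t_bd: "0 \<le> t x i" "t x i \<le> (1 / 4) ^ Suc i" for x i
    by (auto simp: t_def indicator_def)
  have t_sum: "summable (t x)" for x
    by (rule summable_comparison_test'[OF sums_summable[OF geo], of 0])
       (use t_bd in \<open>simp add: abs_le_iff del: power_Suc\<close>)
  define code where "code x = (\<Sum>i. t x i)" for x
  have code0: "0 \<le> code x" for x
    unfolding code_def by (intro suminf_nonneg t_sum t_bd)
  have code1: "code x \<le> 1 / 3" for x
    unfolding code_def sums_unique[OF geo] by (rule suminf_le[OF t_bd(2) t_sum sums_summable[OF geo]])
  \<comment> \<open>\<open>code\<close> lies in \<open>[0, 1 / 3]\<close>, so different floors put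
    the values at least \<open>2 - 1 / 3\<close> apart. The floor of \<open>g\<close> is built in so
    that points with close codes share a compact sublevel set, and the linear bound by
    \<open>g\<close> keeps the image laws tight.\<close>
  define \<phi> where "\<phi> x = 2 * real_of_int \<lfloor>g x\<rfloor> + code x" for x
  have gm[measurable]: "g \<in> borel_measurable borel" using g(1) by (rule borel_measurable_continuous_onI)
  have [measurable]: "B i \<in> sets borel" for i using oB by simp
  have m: "\<phi> \<in> borel_measurable borel"
    unfolding \<phi>_def code_def t_def by measurable
  have p0: "0 \<le> \<phi> x" for x
    using g(2)[of x] code0[of x] by (simp add: \<phi>_def)
  have p1: "\<phi> x \<le> 2 * g x + 1" for x
    using code1[of x] of_int_floor_le[of "g x"] unfolding \<phi>_def by linarith
  have sep: "\<lfloor>g x\<rfloor> = \<lfloor>g y\<rfloor> \<and> (\<forall>j\<le>i. x \<in> B j \<longleftrightarrow> y \<in> B j)"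
    if d: "\<bar>\<phi> x - \<phi> y\<bar> < 2 / 3 * (1 / 4) ^ Suc i" for x y i
  proof
    have "(1 / 4 :: real) ^ Suc i \<le> 1" by (rule power_le_one) auto
    with d have d1: "\<bar>\<phi> x - \<phi> y\<bar> < 2 / 3" by simp
    show fl: "\<lfloor>g x\<rfloor> = \<lfloor>g y\<rfloor>"
    proof (rule ccontr)
      assume "\<lfloor>g x\<rfloor> \<noteq> \<lfloor>g y\<rfloor>"
      then have "1 \<le> \<bar>\<lfloor>g x\<rfloor> - \<lfloor>g y\<rfloor>\<bar>" by simp
      then have "1 \<le> \<bar>real_of_int \<lfloor>g x\<rfloor> - real_of_int \<lfloor>g y\<rfloor>\<bar>"
        by linarith
      then show False using d1 code0[of x] code1[of x] code0[of y] code1[of y] unfolding \<phi>_def by linarith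
    qed
    show "\<forall>j\<le>i. x \<in> B j \<longleftrightarrow> y \<in> B j"
    proof (rule ccontr)
      assume "\<not> ?thesis"
      then obtain j0 where j0: "j0 \<le> i" "(x \<in> B j0) \<noteq> (y \<in> B j0)" by blast
      \<comment> \<open>The first digit that differs outweighs all later ones together.\<close>
      define j where "j = (LEAST j. (x \<in> B j) \<noteq> (y \<in> B j))"
      have j: "(x \<in> B j) \<noteq> (y \<in> B j)" "j \<le> i"
        unfolding j_def using LeastI[of "\<lambda>j. (x \<in> B j) \<noteq> (y \<in> B j)", OF j0(2)]
          Least_le[of "\<lambda>j. (x \<in> B j) \<noteq> (y \<in> B j)", OF j0(2)] j0(1) by auto
      have less: "t x l = t y l" if "l < j" for l
        using not_less_Least[of l "\<lambda>j. (x \<in> B j) \<noteq> (y \<in> B j)"] that unfolding j_def t_def indicator_def by auto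
      have dif: "\<bar>t x j - t y j\<bar> = (1 / 4) ^ Suc j"
        using j(1) by (auto simp: t_def indicator_def)
      have ts: "summable (\<lambda>l. t x l - t y l)" by (intro summable_diff t_sum)
      have "code x - code y = (\<Sum>l. t x l - t y l)"
        unfolding code_def by (rule suminf_diff[OF t_sum t_sum])
      also have "\<dots> = (\<Sum>l. t x (l + Suc j) - t y (l + Suc j)) + (\<Sum>l<Suc j. t x l - t y l)"
        by (rule suminf_split_initial_segment[OF ts])
      also have "(\<Sum>l<Suc j. t x l - t y l) = t x j - t y j"
        using less by simp
      finally have eq: "code x - code y = (\<Sum>l. t x (l + Suc j) - t y (l + Suc j)) + (t x j - t y j)" .
      have sg: "summable (\<lambda>l. (1 / 4 :: real) ^ Suc j * (1 / 4) ^ Suc l)"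
        by (intro summable_mult sums_summable[OF geo])
      have tl: "\<bar>t x (l + Suc j) - t y (l + Suc j)\<bar> \<le> (1 / 4) ^ Suc j * (1 / 4) ^ Suc l" for l
      proof -
        have "(1 / 4 :: real) ^ Suc (l + Suc j) = (1 / 4) ^ Suc j * (1 / 4) ^ Suc l"
          by (simp add: power_add)
        then show ?thesis using t_bd[of x "l + Suc j"] t_bd[of y "l + Suc j"] by linarith
      qed
      have sn: "summable (\<lambda>l. \<bar>t x (l + Suc j) - t y (l + Suc j)\<bar>)"
        by (rule summable_comparison_test'[OF sg, of 0]) (use tl in auto)
      have "\<bar>\<Sum>l. t x (l + Suc j) - t y (l + Suc j)\<bar> \<le> (\<Sum>l. \<bar>t x (l + Suc j) - t y (l + Suc j)\<bar>)"
        by (rule summable_rabs[OF sn])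
      also have "\<dots> \<le> (\<Sum>l. (1 / 4 :: real) ^ Suc j * (1 / 4) ^ Suc l)"
        by (rule suminf_le[OF tl sn sg])
      also have "\<dots> = (1 / 4) ^ Suc j * (1 / 3)"
        by (rule sums_unique[symmetric, OF sums_mult[OF geo]])
      finally have "2 / 3 * (1 / 4) ^ Suc j \<le> \<bar>code x - code y\<bar>" using eq dif by linarith
      also have "\<dots> = \<bar>\<phi> x - \<phi> y\<bar>" by (simp add: \<phi>_def fl)
      finally have "2 / 3 * (1 / 4) ^ Suc j \<le> \<bar>\<phi> x - \<phi> y\<bar>" .
      moreover have "(1 / 4 :: real) ^ Suc i \<le> (1 / 4) ^ Suc j"
        using j(2) by (intro power_decreasing) auto
      ultimately show False using d by linarith
    qed
  qed
  show thesis by (rule that[OF m p0 p1 sep base])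
qed

text \<open>If the codes of \<open>x n\<close> are Cauchy, then eventually the floors of
  \<open>g\<close> agree, so the points stay in a compact sublevel set, and for every
  \<open>j\<close> eventually all or none of them lie in \<open>B j\<close>. Hence a cluster point
  is the limit, and \<open>\<psi>\<close> makes sense at every limit of codes, not only at
  codes.\<close>

lemma ex_code_retraction:
  fixes g :: "'b::{metric_space,second_countable_topology} \<Rightarrow> real"
  assumes g: "continuous_on UNIV g" "\<And>x. 0 \<le> g x" and cpt: "\<And>r. compact {x. g x \<le> r}"
  obtains \<phi> :: "'b \<Rightarrow> real" and \<psi> Y where
    "\<phi> \<in> borel_measurable borel" "\<And>x. 0 \<le> \<phi> x" "\<And>x. \<phi> x \<le> 2 * g x + 1"
    "closed Y" "range \<phi> \<subseteq> Y" "continuous_on Y \<psi>" "\<And>x. \<psi> (\<phi> x) = x"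
proof (rule ex_code_injection[OF g])
  fix \<phi> :: "'b \<Rightarrow> real" and B :: "nat \<Rightarrow> 'b set"
  assume m: "\<phi> \<in> borel_measurable borel" and p0: "\<And>x. 0 \<le> \<phi> x" and p1: "\<And>x. \<phi> x \<le> 2 * g x + 1"
    and sep: "\<And>x y i. \<bar>\<phi> x - \<phi> y\<bar> < 2 / 3 * (1 / 4) ^ Suc i \<Longrightarrow>
       \<lfloor>g x\<rfloor> = \<lfloor>g y\<rfloor> \<and> (\<forall>j\<le>i. x \<in> B j \<longleftrightarrow> y \<in> B j)"
    and base: "\<And>x e. 0 < e \<Longrightarrow> \<exists>j. open (B j) \<and> x \<in> B j \<and> B j \<subseteq> ball x e"
  have pos: "0 < 2 / 3 * (1 / 4 :: real) ^ Suc i" for i by simp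
  have ex: "\<exists>l. x \<longlonglongrightarrow> l" if "(\<lambda>n. \<phi> (x n)) \<longlonglongrightarrow> y" for x y
  proof -
    have C: "Cauchy (\<lambda>n. \<phi> (x n))" using that by (rule LIMSEQ_imp_Cauchy)
    then obtain N where N: "\<And>m n. m \<ge> N \<Longrightarrow> n \<ge> N \<Longrightarrow> \<bar>\<phi> (x m) - \<phi> (x n)\<bar> < 2 / 3 * (1 / 4) ^ Suc 0"
      using pos[of 0] unfolding Cauchy_def dist_real_def by metis
    have "x (n + N) \<in> {z. g z \<le> of_int \<lfloor>g (x N)\<rfloor> + 1}" for n
      using sep[OF N[of "n + N" N]] by (simp, linarith)
    then obtain l r where r: "strict_mono (r :: nat \<Rightarrow> nat)" "((\<lambda>n. x (n + N)) \<circ> r) \<longlonglongrightarrow> l"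
      using cpt[unfolded compact_def, rule_format, of "\<lambda>n. x (n + N)"] by blast
    have "x \<longlonglongrightarrow> l"
    proof (rule tendstoI)
      fix e :: real assume "0 < e"
      then obtain j where j: "open (B j)" "l \<in> B j" "B j \<subseteq> ball l e" using base by blast
      obtain N' where N': "\<And>m n. m \<ge> N' \<Longrightarrow> n \<ge> N' \<Longrightarrow> \<bar>\<phi> (x m) - \<phi> (x n)\<bar> < 2 / 3 * (1 / 4) ^ Suc j"
        using C pos[of j] unfolding Cauchy_def dist_real_def by metis
      have "\<forall>\<^sub>F n in sequentially. x (r n + N) \<in> B j"
        using topological_tendstoD[OF r(2) j(1,2)] by (simp add: o_def)
      then obtain N1 where N1: "\<And>n. n \<ge> N1 \<Longrightarrow> x (r n + N) \<in> B j" unfolding eventually_sequentially by blast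
      have r': "r (max N1 N') + N \<ge> N'" using seq_suble[OF r(1), of "max N1 N'"] by simp
      have "dist (x n) l < e" if "n \<ge> N'" for n
      proof -
        have "x (r (max N1 N') + N) \<in> B j" by (rule N1) simp
        then have "x n \<in> B j" using sep[OF N'[OF that r']] by simp
        then show ?thesis using j(3) by (auto simp: dist_commute)
      qed
      then show "\<forall>\<^sub>F n in sequentially. dist (x n) l < e" by (auto simp: eventually_sequentially)
    qed
    then show ?thesis ..
  qed
  \<comment> \<open>The limit depends on \<open>y\<close> alone: codes with a common limit are
    eventually close, so both sequences enter the same basic neighbourhoods.\<close>
  have uniq: "x' \<longlonglongrightarrow> l" if x: "(\<lambda>n. \<phi> (x n)) \<longlonglongrightarrow> y" "x \<longlonglongrightarrow> l" and x': "(\<lambda>n. \<phi> (x' n)) \<longlonglongrightarrow> y" for x x' y l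
  proof (rule tendstoI)
    fix e :: real assume "0 < e"
    then obtain j where j: "open (B j)" "l \<in> B j" "B j \<subseteq> ball l e" using base by blast
    have "\<forall>\<^sub>F n in sequentially. x n \<in> B j" by (rule topological_tendstoD[OF x(2) j(1,2)])
    moreover have "(\<lambda>n. \<phi> (x n) - \<phi> (x' n)) \<longlonglongrightarrow> 0" using tendsto_diff[OF x(1) x'] by simp
    then have "\<forall>\<^sub>F n in sequentially. \<bar>\<phi> (x n) - \<phi> (x' n)\<bar> < 2 / 3 * (1 / 4) ^ Suc j"
      using tendstoD[OF _ pos[of j]] by (fastforce simp: dist_real_def)
    ultimately show "\<forall>\<^sub>F n in sequentially. dist (x' n) l < e"
    proof eventually_elim
      case (elim n)
      then have "x' n \<in> B j" using sep[OF elim(2)] by simp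
      then show ?case using j(3) by (auto simp: dist_commute)
    qed
  qed
  define Y where "Y = closure (range \<phi>)"
  define \<psi> where "\<psi> y = (SOME l. \<exists>x. (\<lambda>n. \<phi> (x n)) \<longlonglongrightarrow> y \<and> x \<longlonglongrightarrow> l)" for y
  have psi: "x \<longlonglongrightarrow> \<psi> y" if "(\<lambda>n. \<phi> (x n)) \<longlonglongrightarrow> y" for x y
  proof -
    from ex[OF that] obtain l where "x \<longlonglongrightarrow> l" ..
    with that have "\<exists>l. \<exists>x. (\<lambda>n. \<phi> (x n)) \<longlonglongrightarrow> y \<and> x \<longlonglongrightarrow> l" by (intro exI conjI)
    from someI_ex[OF this] obtain x' where "(\<lambda>n. \<phi> (x' n)) \<longlonglongrightarrow> y" "x' \<longlonglongrightarrow> \<psi> y"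
      unfolding \<psi>_def by (elim exE conjE)
    then show ?thesis by (rule uniq[OF _ _ that])
  qed
  have inv: "\<psi> (\<phi> x) = x" for x
  proof -
    have "(\<lambda>_. x) \<longlonglongrightarrow> \<psi> (\<phi> x)" by (rule psi) simp
    then show ?thesis by (simp add: LIMSEQ_const_iff)
  qed
  have cont: "continuous_on Y \<psi>"
    unfolding continuous_on_sequentially
  proof safe
    fix u y assume u: "\<forall>n. u n \<in> Y" and y: "y \<in> Y" and lim: "u \<longlonglongrightarrow> y"
    \<comment> \<open>Points of the closure are replaced by genuine codes: \<open>x n\<close> is
      chosen with its code near \<open>u n\<close> and itself near \<open>\<psi> (u n)\<close>, so
      that \<open>psi\<close> applies to the codes and the limit transfers back.\<close>
    have "\<exists>x. dist (\<phi> x) (u n) < inverse (real (Suc n)) \<and> dist x (\<psi> (u n)) < inverse (real (Suc n))" for n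
    proof -
      have "u n \<in> closure (range \<phi>)" using u by (simp add: Y_def)
      then obtain v where v: "\<forall>k. v k \<in> range \<phi>" "v \<longlonglongrightarrow> u n"
        unfolding closure_sequential by (elim exE conjE)
      from v(1) have "\<forall>k. \<exists>x. v k = \<phi> x" by (simp add: image_iff)
      then obtain x where "\<forall>k. v k = \<phi> (x k)" unfolding choice_iff ..
      then have "v = (\<lambda>k. \<phi> (x k))" by (intro ext) simp
      with v(2) have L: "(\<lambda>k. \<phi> (x k)) \<longlonglongrightarrow> u n" by simp
      have p: "0 < inverse (real (Suc n))" by simp
      have "\<forall>\<^sub>F k in sequentially. dist (\<phi> (x k)) (u n) < inverse (real (Suc n)) \<and> dist (x k) (\<psi> (u n)) < inverse (real (Suc n))"
        using tendstoD[OF L p] tendstoD[OF psi[OF L] p] by eventually_elim simp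
      then show ?thesis using eventually_happens[of _ sequentially] by fastforce
    qed
    then obtain x where x: "\<And>n. dist (\<phi> (x n)) (u n) < inverse (real (Suc n))"
      "\<And>n. dist (x n) (\<psi> (u n)) < inverse (real (Suc n))" by metis
    have "(\<lambda>n. dist (\<phi> (x n)) (u n)) \<longlonglongrightarrow> 0"
      using x(1) by (intro tendsto_sandwich[OF _ _ tendsto_const LIMSEQ_inverse_real_of_nat])
        (auto intro!: always_eventually less_imp_le)
    then have "(\<lambda>n. \<phi> (x n)) \<longlonglongrightarrow> y" using lim by (rule tendsto_dist_close)
    then have xl: "x \<longlonglongrightarrow> \<psi> y" by (rule psi)
    have "(\<lambda>n. dist (\<psi> (u n)) (x n)) \<longlonglongrightarrow> 0"
      using x(2)[unfolded dist_commute[of "x _"]] by (intro tendsto_sandwich[OF _ _ tendsto_const LIMSEQ_inverse_real_of_nat])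
        (auto intro!: always_eventually less_imp_le)
    then show "(\<psi> \<circ> u) \<longlonglongrightarrow> \<psi> y" using xl unfolding o_def by (rule tendsto_dist_close)
  qed
  show thesis
    by (rule that[OF m p0 p1 _ _ cont inv]) (auto simp: Y_def closure_subset[THEN subsetD])
qed

text \<open>Markov's inequality for \<open>g\<close> makes the laws of the codes tight. A limit law
  on the line can be pulled back by \<open>\<psi>\<close> because it is carried by the closed set
  \<open>Y\<close>.\<close>

theorem weakly_convergent_subsequence:
  fixes \<nu> :: "nat \<Rightarrow> 'b::{metric_space,second_countable_topology} measure"
  assumes g: "continuous_on UNIV g" "\<And>x. 0 \<le> g x" and cpt: "\<And>r. compact {x. g x \<le> r}"
    and \<nu>: "\<And>n. \<nu> n \<in> borel_probs" and bd: "\<And>n. (\<integral>\<^sup>+x. ennreal (g x) \<partial>\<nu> n) \<le> ennreal M"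
  shows "\<exists>r \<mu>. strict_mono (r :: nat \<Rightarrow> nat) \<and> \<mu> \<in> borel_probs \<and> weakly_converges (\<nu> \<circ> r) \<mu>"
proof (rule ex_code_retraction[OF g cpt])
  fix \<phi> :: "'b \<Rightarrow> real" and \<psi> and Y
  assume m: "\<phi> \<in> borel_measurable borel" and p0: "\<And>x. 0 \<le> \<phi> x" and p1: "\<And>x. \<phi> x \<le> 2 * g x + 1"
    and Y: "closed Y" "range \<phi> \<subseteq> Y" and cont: "continuous_on Y \<psi>" and inv: "\<And>x. \<psi> (\<phi> x) = x"
  \<comment> \<open>\<open>M\<close> may be negative, in which case \<open>ennreal M\<close> is
    0.\<close>
  define W where "W = max M 0"
  have W: "0 \<le> W" by (simp add: W_def)
  have bdW: "(\<integral>\<^sup>+x. ennreal (g x) \<partial>\<nu> n) \<le> ennreal W" for n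
    using bd[of n] by (rule order_trans) (simp add: W_def ennreal_leI)
  have gm: "g \<in> borel_measurable borel" using g(1) by (rule borel_measurable_continuous_onI)
  have m': "\<phi> \<in> borel_measurable (\<nu> n)" for n by (rule borel_measurable_borel_probs[OF \<nu> m])
  define D where "D n = distr (\<nu> n) borel \<phi>" for n
  have rd: "real_distribution (D n)" for n
    unfolding D_def using borel_probsD(1)[OF \<nu>] m'
    by (intro prob_space.real_distribution_distr)
  have "tight D"
    unfolding tight_def
  proof (intro conjI allI impI rd)
    fix e :: real assume e: "0 < e"
    \<comment> \<open>Markov's bound becomes \<open>W / R\<close>, which is below \<open>e\<close>;
      adding 1 keeps \<open>R\<close> positive when \<open>W\<close> is 0.\<close>
    define R where "R = (W + 1) / e"
    have R: "0 < R" using e W by (simp add: R_def)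
    have "1 - e < measure (D n) {-1<..2 * R + 1}" for n
    proof -
      interpret N: prob_space "\<nu> n" using borel_probsD(1)[OF \<nu>] .
      have S: "{x. R \<le> g x} \<in> sets (\<nu> n)" using borel_probsD(2)[OF \<nu>] gm by simp
      have "emeasure (\<nu> n) {x. R \<le> g x} = emeasure (\<nu> n) {x\<in>space (\<nu> n). 1 \<le> ennreal (1 / R) * ennreal (g x)}"
        using R g(2) by (intro arg_cong2[where f=emeasure])
          (auto simp: borel_probsD(3)[OF \<nu>] ennreal_mult'[symmetric] ennreal_le_iff2 field_simps simp flip: ennreal_1)
      also have "\<dots> \<le> ennreal (1 / R) * (\<integral>\<^sup>+x. ennreal (g x) * indicator (space (\<nu> n)) x \<partial>\<nu> n)"
        using borel_measurable_borel_probs[OF \<nu> gm]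
        by (intro nn_integral_Markov_inequality) auto
      also have "\<dots> \<le> ennreal (1 / R) * ennreal (W)"
        using bdW[of n] borel_probsD(3)[OF \<nu>] by (intro mult_left_mono) simp_all
      also have "\<dots> = ennreal (W / R)" using R W by (simp add: ennreal_mult'[symmetric])
      finally have "N.prob {x. R \<le> g x} \<le> W / R"
        using R W by (simp add: N.emeasure_eq_measure)
      also have "\<dots> < e" using e W by (simp add: R_def field_simps)
      finally have a: "N.prob {x. R \<le> g x} < e" .
      have "1 - N.prob {x. R \<le> g x} = N.prob (space (\<nu> n) - {x. R \<le> g x})"
        using N.prob_compl[OF S] by simp
      also have "\<dots> \<le> N.prob (\<phi> -` {-1<..2 * R + 1} \<inter> space (\<nu> n))"
      proof (rule N.finite_measure_mono)
        show "space (\<nu> n) - {x. R \<le> g x} \<subseteq> \<phi> -` {-1<..2 * R + 1} \<inter> space (\<nu> n)"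
        proof (rule subsetI)
          fix x assume "x \<in> space (\<nu> n) - {x. R \<le> g x}"
          then show "x \<in> \<phi> -` {-1<..2 * R + 1} \<inter> space (\<nu> n)"
            using p0[of x] p1[of x] by simp
        qed
        show "\<phi> -` {-1<..2 * R + 1} \<inter> space (\<nu> n) \<in> N.events" using m' by (rule measurable_sets) simp
      qed
      also have "\<dots> = measure (D n) {-1<..2 * R + 1}"
        unfolding D_def using m' by (simp add: measure_distr)
      finally show ?thesis using a by simp
    qed
    then show "\<exists>a b. a < b \<and> (\<forall>n. 1 - e < measure (D n) {a<..b})"
      using R by (intro exI[of _ "-1"] exI[of _ "2 * R + 1"]) auto
  qed
  from tight_imp_convergent_subsubsequence[OF this strict_mono_id] obtain r L where
    r: "strict_mono r" and L: "real_distribution L" and wc: "weak_conv_m (D \<circ> id \<circ> r) L" by blast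
  interpret L: real_distribution L by fact
  have Lm: "F \<in> borel_measurable L" if "continuous_on UNIV F" for F :: "real \<Rightarrow> real"
    using borel_measurable_continuous_onI[OF that] by (simp cong: measurable_cong_sets)
  have conv: "(\<lambda>n. \<integral>x. F (\<phi> x) \<partial>\<nu> (r n)) \<longlonglongrightarrow> (\<integral>y. F y \<partial>L)"
    if F: "continuous_on UNIV F" "\<And>y. \<bar>F y\<bar> \<le> C" for F :: "real \<Rightarrow> real" and C
  proof -
    have "(\<lambda>n. \<integral>y. F y \<partial>(D \<circ> id \<circ> r) n) \<longlonglongrightarrow> (\<integral>y. F y \<partial>L)"
      using F rd by (intro weak_conv_imp_integral_bdd_continuous_conv[OF _ L wc, of F C])
        (auto simp: continuous_on_eq_continuous_at)
    moreover have "(\<integral>y. F y \<partial>D n) = (\<integral>x. F (\<phi> x) \<partial>\<nu> n)" for n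
      unfolding D_def using F(1) m' by (intro integral_distr) (auto intro: borel_measurable_continuous_onI)
    ultimately show ?thesis by simp
  qed
  have YL: "AE y in L. y \<in> Y"
  proof -
    \<comment> \<open>A bounded continuous function that vanishes exactly on \<open>Y\<close>. Its
      integrals under the image laws are all 0, hence so is the one under \<open>L\<close>.\<close>
    let ?F = "\<lambda>y. min 1 (infdist y Y)"
    have F: "continuous_on UNIV ?F" by (intro continuous_intros)
    have bF: "\<bar>?F y\<bar> \<le> 1" for y using infdist_nonneg[of y Y] by simp
    have "?F (\<phi> x) = 0" for x using Y(2) by (auto simp: image_subset_iff)
    then have "(\<lambda>_. 0) \<longlonglongrightarrow> (\<integral>y. ?F y \<partial>L)" using conv[OF F bF] by simp
    then have "(\<integral>y. ?F y \<partial>L) = 0" by (simp add: LIMSEQ_const_iff)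
    moreover have "integrable L ?F"
      using bF Lm[OF F] by (intro L.integrable_const_bound[where B=1]) auto
    ultimately have "AE y in L. ?F y = 0"
      using infdist_nonneg[of _ Y] by (subst (asm) integral_nonneg_eq_0_iff_AE) auto
    then show ?thesis
    proof eventually_elim
      case (elim y)
      then have "infdist y Y = 0" using infdist_nonneg[of y Y] by (simp add: min_def split: if_splits)
      then show ?case using in_closed_iff_infdist_zero[OF Y(1)] Y(2) by auto
    qed
  qed
  \<comment> \<open>Off \<open>Y\<close>, which is an \<open>L\<close>-null set, a constant value
    keeps \<open>h\<close> measurable.\<close>
  define h where "h y = (if y \<in> Y then \<psi> y else undefined)" for y
  have h: "h \<in> borel \<rightarrow>\<^sub>M borel"
    using borel_measurable_continuous_on_restrict[OF cont] Y(1)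
    unfolding h_def by (subst measurable_restrict_space_iff[symmetric]) auto
  have h': "h \<in> L \<rightarrow>\<^sub>M borel" using h by simp
  define \<mu> where "\<mu> = distr L borel h"
  have \<mu>: "\<mu> \<in> borel_probs"
    unfolding \<mu>_def using h' by (intro borel_probsI L.prob_space_distr) auto
  have "weakly_converges (\<nu> \<circ> r) \<mu>"
    unfolding weakly_converges_def
  proof (intro allI impI)
    fix f :: "'b \<Rightarrow> real" assume f: "continuous_on UNIV f \<and> bounded (range f)"
    then obtain C where C: "\<And>x. \<bar>f x\<bar> \<le> C" by (auto simp: bounded_iff)
    have C0: "0 \<le> C" using C[of undefined] by linarith
    have "continuous_on Y (\<lambda>y. f (\<psi> y))"
      by (rule continuous_on_compose2[OF conjunct1[OF f] cont]) simp
    \<comment> \<open>The composition of \<open>f\<close> and \<open>\<psi>\<close> is continuous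
      only on \<open>Y\<close>; weak convergence on the line tests its bounded continuous
      extension.\<close>
    then obtain F where F: "continuous_on UNIV F" "\<And>y. y \<in> Y \<Longrightarrow> F y = f (\<psi> y)" "\<And>y. y \<in> UNIV \<Longrightarrow> norm (F y) \<le> C"
      by (rule Tietze[of Y _ UNIV C]) (use Y(1) C C0 in auto)
    have "(\<lambda>n. \<integral>x. F (\<phi> x) \<partial>\<nu> (r n)) \<longlonglongrightarrow> (\<integral>y. F y \<partial>L)"
      using F by (intro conv) auto
    moreover have "F (\<phi> x) = f x" for x using F(2)[of "\<phi> x"] Y(2) inv by auto
    moreover have "(\<integral>y. F y \<partial>L) = (\<integral>y. f (h y) \<partial>L)"
    proof (rule integral_cong_AE)
      show "F \<in> borel_measurable L" by (rule Lm[OF F(1)])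
      show "(\<lambda>y. f (h y)) \<in> borel_measurable L"
        by (rule measurable_compose[OF h' borel_measurable_continuous_onI[OF conjunct1[OF f]]])
      show "AE y in L. F y = f (h y)" using YL by eventually_elim (simp add: F h_def)
    qed
    moreover have "(\<integral>y. f (h y) \<partial>L) = (\<integral>x. f x \<partial>\<mu>)"
      unfolding \<mu>_def using f h' by (intro integral_distr[symmetric]) (auto intro: borel_measurable_continuous_onI)
    ultimately show "(\<lambda>n. \<integral>x. f x \<partial>(\<nu> \<circ> r) n) \<longlonglongrightarrow> (\<integral>x. f x \<partial>\<mu>)" by simp
  qed
  with r \<mu> show ?thesis by (intro exI conjI)
qed

text \<open>By the moment bound every subsequence has a weakly convergent further subsequence, and
  the test functions leave \<open>\<mu>\<close> as its only possible limit.\<close>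

lemma weakly_convergesI_test_function:
  fixes \<nu> :: "nat \<Rightarrow> 'b::{metric_space,second_countable_topology} measure"
  assumes g: "continuous_on UNIV g" "\<And>x. 0 \<le> g x" and cpt: "\<And>r. compact {x. g x \<le> r}"
    and \<nu>: "\<And>n. \<nu> n \<in> borel_probs" and bd: "\<And>n. (\<integral>\<^sup>+x. ennreal (g x) \<partial>\<nu> n) \<le> ennreal M"
    and \<mu>: "\<mu> \<in> borel_probs"
    and lim: "\<And>i. (\<lambda>n. \<integral>x. test_function i x \<partial>\<nu> n) \<longlonglongrightarrow> (\<integral>x. test_function i x \<partial>\<mu>)"
  shows "weakly_converges \<nu> \<mu>"
  unfolding weakly_converges_def
proof (intro allI impI tendstoI)
  fix f :: "'b \<Rightarrow> real" and e :: real
  assume f: "continuous_on UNIV f \<and> bounded (range f)" and e: "0 < e"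
  show "\<forall>\<^sub>F n in sequentially. dist (\<integral>x. f x \<partial>\<nu> n) (\<integral>x. f x \<partial>\<mu>) < e"
  proof (rule ccontr)
    assume "\<not> ?thesis"
    then obtain s where s: "strict_mono (s :: nat \<Rightarrow> nat)"
      and bad: "\<And>n. \<not> dist (\<integral>x. f x \<partial>\<nu> (s n)) (\<integral>x. f x \<partial>\<mu>) < e"
      using not_eventually_sequentiallyD by blast
    obtain r \<mu>' where r: "strict_mono (r :: nat \<Rightarrow> nat)" and \<mu>': "\<mu>' \<in> borel_probs"
      and w: "weakly_converges ((\<nu> \<circ> s) \<circ> r) \<mu>'"
      using weakly_convergent_subsequence[OF g cpt, of "\<nu> \<circ> s" M] \<nu> bd by (auto simp: o_def)
    have "\<mu> = \<mu>'"
    proof (rule test_functions_determine[OF \<mu> \<mu>'])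
      fix i
      have "(\<lambda>n. \<integral>x. test_function i x \<partial>((\<nu> \<circ> s) \<circ> r) n) \<longlonglongrightarrow> (\<integral>x. test_function i x \<partial>\<mu>')"
        using w[unfolded weakly_converges_def, THEN spec, of "test_function i", THEN mp,
          OF conjI[OF continuous_on_test_function bounded_range_test_function]] .
      moreover have "(\<lambda>n. \<integral>x. test_function i x \<partial>((\<nu> \<circ> s) \<circ> r) n) \<longlonglongrightarrow> (\<integral>x. test_function i x \<partial>\<mu>)"
        using LIMSEQ_subseq_LIMSEQ[OF lim strict_mono_o[OF s r], of i] by (simp add: o_def)
      ultimately show "(\<integral>x. test_function i x \<partial>\<mu>) = (\<integral>x. test_function i x \<partial>\<mu>')"
        by (rule LIMSEQ_unique[rotated])
    qed
    with w f have "(\<lambda>n. \<integral>x. f x \<partial>((\<nu> \<circ> s) \<circ> r) n) \<longlonglongrightarrow> (\<integral>x. f x \<partial>\<mu>)"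
      unfolding weakly_converges_def by simp
    from tendstoD[OF this e] obtain n where "dist (\<integral>x. f x \<partial>\<nu> (s (r n))) (\<integral>x. f x \<partial>\<mu>) < e"
      unfolding eventually_sequentially by auto
    with bad show False by blast
  qed
qed

section \<open>Couplings and transport costs\<close>

text \<open>This stands for subtracting the lower limit of \<open>a\<close> from the limit of
  \<open>c\<close>. Subtraction on \<open>ennreal\<close> truncates at 0 and fails at infinity, so
  the statement is additive and the finite \<open>A0\<close> is cancelled inside the proof.\<close>

lemma limsup_le_of_liminf_add:
  fixes a m c :: "nat \<Rightarrow> ennreal"
  assumes le: "\<And>n. a n + m n \<le> c n" and c: "c \<longlonglongrightarrow> A0 + M0" and a: "A0 \<le> liminf a"
    and fin: "A0 < \<infinity>" "M0 < \<infinity>"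
  shows "limsup m \<le> M0"
  unfolding Limsup_le_iff
proof (intro allI impI)
  fix y assume y: "M0 < y"
  obtain ar where ar: "A0 = ennreal ar" "0 \<le> ar" using fin(1) by (cases A0) auto
  obtain mr where mr: "M0 = ennreal mr" "0 \<le> mr" using fin(2) by (cases M0) auto
  \<comment> \<open>Of the room \<open>2 * e\<close> above \<open>M0\<close>, one \<open>e\<close>
    is spent on \<open>c n\<close> and one on \<open>a n\<close>.\<close>
  obtain e where e: "0 < e" "ennreal (mr + 2 * e) \<le> y"
  proof (cases y)
    case (real r)
    moreover have "mr + 2 * ((r - mr) / 2) = r" by (simp add: field_simps)
    ultimately show ?thesis using y mr
      by (intro that[of "(r - mr) / 2"]) (auto simp: ennreal_less_iff simp del: ennreal_plus)
  next
    case top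
    then show ?thesis by (intro that[of 1]) auto
  qed
  have "A0 + M0 < ennreal (ar + mr + e)" using ar mr e(1) by (simp add: ennreal_plus[symmetric] ennreal_less_iff del: ennreal_plus)
  then have ev1: "\<forall>\<^sub>F n in sequentially. c n < ennreal (ar + mr + e)" by (rule order_tendstoD[OF c])
  have ev2: "\<forall>\<^sub>F n in sequentially. ennreal (ar - e) \<le> a n"
  proof (cases "ar - e \<le> 0")
    case True
    then show ?thesis by (simp add: ennreal_neg)
  next
    case False
    then have "ennreal (ar - e) < A0" using e(1) ar by (simp add: ennreal_less_iff)
    then have "\<forall>\<^sub>F n in sequentially. ennreal (ar - e) < a n" using a unfolding le_Liminf_iff by blast
    then show ?thesis by eventually_elim simp
  qed
  from ev1 ev2 show "\<forall>\<^sub>F n in sequentially. m n < y"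
  proof eventually_elim
    case (elim n)
    have am: "a n + m n < ennreal (ar + mr + e)" using le[of n] elim(1) by (rule le_less_trans)
    then have "a n < top" "m n < top" by (auto simp: less_top[symmetric])
    then obtain \<alpha> \<beta> where *: "a n = ennreal \<alpha>" "0 \<le> \<alpha>" "m n = ennreal \<beta>" "0 \<le> \<beta>"
      by (metis ennreal_cases less_irrefl)
    have "\<alpha> + \<beta> < ar + mr + e" using am * ar(2) mr(2) e(1) by (simp add: ennreal_plus[symmetric] ennreal_less_iff del: ennreal_plus)
    moreover have "ar - e \<le> \<alpha>" using elim(2) * by (simp add: ennreal_le_iff)
    ultimately have "\<beta> < mr + 2 * e" by linarith
    then have "m n < ennreal (mr + 2 * e)" using * by (simp add: ennreal_less_iff)
    then show ?case using e(2) by (rule less_le_trans)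
  qed
qed

lemma tendsto_ennreal_of_liminf_limsup:
  fixes m :: "nat \<Rightarrow> ennreal"
  assumes "M0 \<le> liminf m" "limsup m \<le> M0"
  shows "m \<longlonglongrightarrow> M0"
proof -
  have "liminf m \<le> limsup m" by (rule Liminf_le_Limsup) simp
  then show ?thesis using assms by (intro Liminf_eq_Limsup) auto
qed

lemma nn_integral_affine:
  fixes u v :: "'p \<Rightarrow> real"
  assumes "prob_space \<gamma>" "0 \<le> A" "0 \<le> B" "\<And>p. 0 \<le> u p" "\<And>p. 0 \<le> v p"
    and [measurable]: "u \<in> borel_measurable \<gamma>" "v \<in> borel_measurable \<gamma>"
  shows "(\<integral>\<^sup>+p. ennreal (A + B * (u p + v p)) \<partial>\<gamma>) =
    ennreal A + ennreal B * ((\<integral>\<^sup>+p. ennreal (u p) \<partial>\<gamma>) + (\<integral>\<^sup>+p. ennreal (v p) \<partial>\<gamma>))"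
proof -
  interpret prob_space \<gamma> by fact
  have "(\<integral>\<^sup>+p. ennreal (A + B * (u p + v p)) \<partial>\<gamma>) = (\<integral>\<^sup>+p. ennreal A + ennreal B * (ennreal (u p) + ennreal (v p)) \<partial>\<gamma>)"
    using assms by (intro nn_integral_cong) (simp add: ennreal_mult)
  also have "\<dots> = ennreal A + ennreal B * ((\<integral>\<^sup>+p. ennreal (u p) \<partial>\<gamma>) + (\<integral>\<^sup>+p. ennreal (v p) \<partial>\<gamma>))"
    by (simp add: nn_integral_add nn_integral_cmult emeasure_space_1)
  finally show ?thesis .
qed

section \<open>Plans with prescribed marginals\<close>

lemma measurable_fst_borel [measurable]:
  "fst \<in> (borel :: ('b::second_countable_topology \<times> 'c::second_countable_topology) measure) \<rightarrow>\<^sub>M borel"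
  by (intro borel_measurable_continuous_onI continuous_intros)

lemma measurable_snd_borel [measurable]:
  "snd \<in> (borel :: ('b::second_countable_topology \<times> 'c::second_countable_topology) measure) \<rightarrow>\<^sub>M borel"
  by (intro borel_measurable_continuous_onI continuous_intros)

lemma couplings_borel_iff:
  assumes "\<mu> \<in> borel_probs" "\<nu> \<in> borel_probs"
  shows "\<gamma> \<in> couplings borel \<mu> \<nu> \<longleftrightarrow>
    \<gamma> \<in> borel_probs \<and> distr \<gamma> borel fst = \<mu> \<and> distr \<gamma> borel snd = \<nu>"
proof -
  have "distr \<gamma> \<mu> fst = distr \<gamma> borel fst" "distr \<gamma> \<nu> snd = distr \<gamma> borel snd"
    using borel_probsD(2)[OF assms(1)] borel_probsD(2)[OF assms(2)] by (auto intro!: distr_cong)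
  then show ?thesis by (simp add: couplings_def)
qed

context
  fixes \<mu> \<nu> :: "'a::{metric_space,second_countable_topology} measure" and \<gamma>
  assumes \<mu>: "\<mu> \<in> borel_probs" and \<nu>: "\<nu> \<in> borel_probs" and \<gamma>: "\<gamma> \<in> couplings borel \<mu> \<nu>"
begin

lemma coupling_borel_prob: "\<gamma> \<in> borel_probs"
  and distr_coupling_fst: "distr \<gamma> borel fst = \<mu>"
  and distr_coupling_snd: "distr \<gamma> borel snd = \<nu>"
  using \<gamma> couplings_borel_iff[OF \<mu> \<nu>] by auto

lemma coupling_measurable: "f \<in> borel_measurable borel \<Longrightarrow> f \<in> borel_measurable \<gamma>"
  by (rule borel_measurable_borel_probs[OF coupling_borel_prob])

lemma nn_integral_coupling_fst:
  assumes "f \<in> borel_measurable borel"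
  shows "(\<integral>\<^sup>+p. f (fst p) \<partial>\<gamma>) = (\<integral>\<^sup>+x. f x \<partial>\<mu>)"
proof -
  have "(\<integral>\<^sup>+x. f x \<partial>distr \<gamma> borel fst) = (\<integral>\<^sup>+p. f (fst p) \<partial>\<gamma>)"
    by (rule nn_integral_distr) (use assms in \<open>auto intro: coupling_measurable measurable_fst_borel\<close>)
  then show ?thesis by (simp add: distr_coupling_fst)
qed

lemma nn_integral_coupling_snd:
  assumes "f \<in> borel_measurable borel"
  shows "(\<integral>\<^sup>+p. f (snd p) \<partial>\<gamma>) = (\<integral>\<^sup>+x. f x \<partial>\<nu>)"
proof -
  have "(\<integral>\<^sup>+x. f x \<partial>distr \<gamma> borel snd) = (\<integral>\<^sup>+p. f (snd p) \<partial>\<gamma>)"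
    by (rule nn_integral_distr) (use assms in \<open>auto intro: coupling_measurable measurable_snd_borel\<close>)
  then show ?thesis by (simp add: distr_coupling_snd)
qed

end

lemma product_coupling:
  fixes \<mu> \<nu> :: "'a::{metric_space,second_countable_topology} measure"
  assumes \<mu>: "\<mu> \<in> borel_probs" and \<nu>: "\<nu> \<in> borel_probs"
  shows "\<mu> \<Otimes>\<^sub>M \<nu> \<in> couplings borel \<mu> \<nu>"
proof -
  interpret M: prob_space \<mu> using borel_probsD[OF \<mu>] by simp
  interpret N: prob_space \<nu> using borel_probsD[OF \<nu>] by simp
  interpret P: pair_prob_space \<mu> \<nu> ..
  have s: "sets (\<mu> \<Otimes>\<^sub>M \<nu>) = sets borel"
    using borel_probsD(2)[OF \<mu>] borel_probsD(2)[OF \<nu>]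
    by (subst borel_prod[symmetric]) (rule sets_pair_measure_cong)
  have "distr (\<mu> \<Otimes>\<^sub>M \<nu>) \<nu> snd = \<nu>"
  proof -
    have "distr (\<mu> \<Otimes>\<^sub>M \<nu>) \<nu> snd = distr (distr (\<nu> \<Otimes>\<^sub>M \<mu>) (\<mu> \<Otimes>\<^sub>M \<nu>) (\<lambda>(x, y). (y, x))) \<nu> snd"
      by (subst P.distr_pair_swap) simp
    also have "\<dots> = distr (\<nu> \<Otimes>\<^sub>M \<mu>) \<nu> fst"
      by (subst distr_distr) (auto intro!: distr_cong measurable_pair_swap')
    also have "\<dots> = \<nu>" by (rule M.distr_pair_fst)
    finally show ?thesis .
  qed
  then show ?thesis
    using N.distr_pair_fst[of \<mu>] s P.prob_space_axioms by (auto simp: couplings_def space_prob_algebra)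
qed

section \<open>Elementary properties of the transport cost\<close>

abbreviation (input) plan_cost ::
    "('a::{metric_space,second_countable_topology} \<Rightarrow> 'a \<Rightarrow> real) \<Rightarrow> ('a \<times> 'a) measure \<Rightarrow> ennreal" where
  "plan_cost k \<gamma> \<equiv> \<integral>\<^sup>+p. ennreal (k (fst p) (snd p)) \<partial>\<gamma>"

lemma transport_cost_le:
  assumes "\<gamma> \<in> couplings borel \<mu> \<nu>"
  shows "transport_cost k \<mu> \<nu> \<le> plan_cost k \<gamma>"
  unfolding transport_cost_def case_prod_beta by (rule INF_lower[OF assms])

lemma transport_cost_approx:
  fixes \<mu> \<nu> :: "'a::{metric_space,second_countable_topology} measure"
  assumes "\<mu> \<in> borel_probs" "\<nu> \<in> borel_probs" and e: "0 < e"
  obtains \<gamma> where "\<gamma> \<in> couplings borel \<mu> \<nu>"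
    "plan_cost k \<gamma> \<le> transport_cost k \<mu> \<nu> + ennreal e"
proof (cases "transport_cost k \<mu> \<nu> = \<infinity>")
  case True
  \<comment> \<open>At infinite cost every plan is near-optimal; the product shows that there is
    one.\<close>
  then show thesis using that[OF product_coupling[OF assms(1,2)]] by simp
next
  case False
  have "transport_cost k \<mu> \<nu> < transport_cost k \<mu> \<nu> + ennreal e"
    using False e by (cases "transport_cost k \<mu> \<nu>")
      (auto simp: ennreal_plus[symmetric] ennreal_less_iff simp del: ennreal_plus)
  then obtain \<gamma> where "\<gamma> \<in> couplings borel \<mu> \<nu>"
    "plan_cost k \<gamma> < transport_cost k \<mu> \<nu> + ennreal e"
    unfolding transport_cost_def case_prod_beta INF_less_iff by blast
  then show thesis by (intro that) auto
qed

lemma transport_cost_less_obtain: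
  assumes "transport_cost k \<mu> \<nu> < r"
  obtains \<gamma> where "\<gamma> \<in> couplings borel \<mu> \<nu>" "plan_cost k \<gamma> < r"
  using assms unfolding transport_cost_def case_prod_beta INF_less_iff by blast

lemma coupling_swap:
  fixes \<mu> \<nu> :: "'a::{metric_space,second_countable_topology} measure"
  assumes \<mu>: "\<mu> \<in> borel_probs" and \<nu>: "\<nu> \<in> borel_probs" and \<gamma>: "\<gamma> \<in> couplings borel \<mu> \<nu>"
  shows "distr \<gamma> borel prod.swap \<in> couplings borel \<nu> \<mu>"
    and "f \<in> borel_measurable borel \<Longrightarrow> (\<integral>\<^sup>+p. f p \<partial>distr \<gamma> borel prod.swap) = (\<integral>\<^sup>+p. f (prod.swap p) \<partial>\<gamma>)"
proof -
  note G = coupling_borel_prob[OF \<mu> \<nu> \<gamma>]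
  interpret G: prob_space \<gamma> using borel_probsD[OF G] by simp
  have sw0: "prod.swap \<in> borel \<rightarrow>\<^sub>M (borel :: ('a \<times> 'a) measure)"
    by (intro borel_measurable_continuous_onI continuous_on_swap)
  have sw: "prod.swap \<in> \<gamma> \<rightarrow>\<^sub>M borel" by (rule coupling_measurable[OF \<mu> \<nu> \<gamma> sw0])
  have "distr \<gamma> borel prod.swap \<in> borel_probs"
    by (intro borel_probsI G.prob_space_distr sw) simp
  moreover have "distr (distr \<gamma> borel prod.swap) borel fst = \<nu>"
    using distr_coupling_snd[OF \<mu> \<nu> \<gamma>] by (subst distr_distr[OF measurable_fst_borel sw]) (simp add: o_def)
  moreover have "distr (distr \<gamma> borel prod.swap) borel snd = \<mu>"
    using distr_coupling_fst[OF \<mu> \<nu> \<gamma>] by (subst distr_distr[OF measurable_snd_borel sw]) (simp add: o_def)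
  ultimately show "distr \<gamma> borel prod.swap \<in> couplings borel \<nu> \<mu>"
    using couplings_borel_iff[OF \<nu> \<mu>] by blast
  show "(\<integral>\<^sup>+p. f p \<partial>distr \<gamma> borel prod.swap) = (\<integral>\<^sup>+p. f (prod.swap p) \<partial>\<gamma>)" if "f \<in> borel_measurable borel"
    using that by (intro nn_integral_distr sw) simp
qed

lemma measurable_cost:
  fixes k :: "'a::{metric_space,second_countable_topology} \<Rightarrow> 'a \<Rightarrow> real"
  assumes "continuous_on UNIV (\<lambda>p. k (fst p) (snd p))"
  shows "(\<lambda>p. ennreal (k (fst p) (snd p))) \<in> borel_measurable borel"
  using borel_measurable_continuous_onI[OF assms] by simp

lemma transport_cost_swap_le:
  fixes k :: "'a::{metric_space,second_countable_topology} \<Rightarrow> 'a \<Rightarrow> real"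
  assumes \<mu>: "\<mu> \<in> borel_probs" and \<nu>: "\<nu> \<in> borel_probs"
    and k: "continuous_on UNIV (\<lambda>p. k (snd p) (fst p))"
  shows "transport_cost (\<lambda>x y. k y x) \<nu> \<mu> \<le> transport_cost k \<mu> \<nu>"
proof -
  have "transport_cost (\<lambda>x y. k y x) \<nu> \<mu> \<le> plan_cost k \<gamma>" if \<gamma>: "\<gamma> \<in> couplings borel \<mu> \<nu>" for \<gamma>
    using transport_cost_le[OF coupling_swap(1)[OF \<mu> \<nu> \<gamma>], of "\<lambda>x y. k y x"]
      coupling_swap(2)[OF \<mu> \<nu> \<gamma> measurable_cost[of "\<lambda>x y. k y x", OF k]] by simp
  then show ?thesis unfolding transport_cost_def[of k] case_prod_beta by (rule INF_greatest)
qed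

lemma continuous_cost_swap:
  assumes "continuous_on UNIV (\<lambda>p. k (fst p) (snd p))"
  shows "continuous_on UNIV (\<lambda>p. k (snd p) (fst p))"
  using continuous_on_compose2[OF assms continuous_on_swap subset_UNIV] by simp

lemma transport_cost_swap:
  fixes k :: "'a::{metric_space,second_countable_topology} \<Rightarrow> 'a \<Rightarrow> real"
  assumes "\<mu> \<in> borel_probs" "\<nu> \<in> borel_probs" and k: "continuous_on UNIV (\<lambda>p. k (fst p) (snd p))"
  shows "transport_cost (\<lambda>x y. k y x) \<nu> \<mu> = transport_cost k \<mu> \<nu>"
  using transport_cost_swap_le[OF assms(1,2) continuous_cost_swap[OF k]]
    transport_cost_swap_le[OF assms(2,1), of "\<lambda>x y. k y x", OF k] by simp

lemma transport_cost_self: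
  fixes k :: "'a::{metric_space,second_countable_topology} \<Rightarrow> 'a \<Rightarrow> real"
  assumes \<nu>: "\<nu> \<in> borel_probs" and k: "continuous_on UNIV (\<lambda>p. k (fst p) (snd p))" "\<And>x. k x x = 0"
  shows "transport_cost k \<nu> \<nu> = 0"
proof -
  interpret N: prob_space \<nu> using borel_probsD[OF \<nu>] by simp
  have d0: "(\<lambda>x. (x, x)) \<in> borel \<rightarrow>\<^sub>M (borel :: ('a \<times> 'a) measure)"
    by (intro borel_measurable_continuous_onI continuous_intros)
  have d: "(\<lambda>x. (x, x)) \<in> \<nu> \<rightarrow>\<^sub>M (borel :: ('a \<times> 'a) measure)" by (rule borel_measurable_borel_probs[OF \<nu> d0])
  let ?\<gamma> = "distr \<nu> (borel :: ('a \<times> 'a) measure) (\<lambda>x. (x, x))"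
  have "?\<gamma> \<in> borel_probs" by (intro borel_probsI N.prob_space_distr d) simp
  moreover have "distr ?\<gamma> borel fst = \<nu>" "distr ?\<gamma> borel snd = \<nu>"
    using borel_probsD(2)[OF \<nu>]
    by (simp_all add: distr_distr[OF measurable_fst_borel d] distr_distr[OF measurable_snd_borel d] o_def distr_id2)
  ultimately have "?\<gamma> \<in> couplings borel \<nu> \<nu>" using couplings_borel_iff[OF \<nu> \<nu>] by blast
  from transport_cost_le[OF this, of k] show ?thesis
    by (simp add: nn_integral_distr[OF d] measurable_cost[OF k(1)] k(2))
qed

section \<open>Weak limits of plans\<close>

lemma weakly_converges_distr:
  fixes h :: "'b::{metric_space,second_countable_topology} \<Rightarrow> 'c::{metric_space,second_countable_topology}"
  assumes w: "weakly_converges \<gamma> \<gamma>'" and \<gamma>: "\<And>n. \<gamma> n \<in> borel_probs" "\<gamma>' \<in> borel_probs"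
    and h: "continuous_on UNIV h"
  shows "weakly_converges (\<lambda>n. distr (\<gamma> n) borel h) (distr \<gamma>' borel h)"
  unfolding weakly_converges_def
proof (intro allI impI)
  fix f :: "'c \<Rightarrow> real" assume f: "continuous_on UNIV f \<and> bounded (range f)"
  have "continuous_on UNIV (\<lambda>x. f (h x))" by (rule continuous_on_compose2[OF conjunct1[OF f] h]) simp
  moreover have "bounded (range (\<lambda>x. f (h x)))"
    by (rule bounded_subset[OF conjunct2[OF f]]) auto
  ultimately have "(\<lambda>n. \<integral>x. f (h x) \<partial>\<gamma> n) \<longlonglongrightarrow> (\<integral>x. f (h x) \<partial>\<gamma>')"
    using w unfolding weakly_converges_def by simp
  moreover have "(\<integral>x. f x \<partial>distr \<rho> borel h) = (\<integral>x. f (h x) \<partial>\<rho>)" if "\<rho> \<in> borel_probs" for \<rho>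
    by (rule integral_distr[OF continuous_measurable_borel_probs[OF that h] borel_measurable_continuous_onI[OF conjunct1[OF f]]])
  ultimately show "(\<lambda>n. \<integral>x. f x \<partial>distr (\<gamma> n) borel h) \<longlonglongrightarrow> (\<integral>x. f x \<partial>distr \<gamma>' borel h)"
    using \<gamma> by simp
qed

lemma borel_probs_distr:
  assumes "\<gamma> \<in> borel_probs" "continuous_on UNIV h"
  shows "distr \<gamma> borel h \<in> borel_probs"
  using borel_probsD(1)[OF assms(1)] continuous_measurable_borel_probs[OF assms]
  by (intro borel_probsI prob_space.prob_space_distr) simp_all

text \<open>Taking a marginal is pushing forward along a continuous map, so the marginals converge
  weakly to those of the limit plan, and weak limits are unique.\<close>

lemma coupling_limit:
  fixes \<mu> \<nu> :: "nat \<Rightarrow> 'a::{metric_space,second_countable_topology} measure"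
  assumes \<mu>: "\<And>n. \<mu> n \<in> borel_probs" "\<mu>' \<in> borel_probs" and \<nu>: "\<And>n. \<nu> n \<in> borel_probs" "\<nu>' \<in> borel_probs"
    and \<gamma>: "\<And>n. \<gamma> n \<in> couplings borel (\<mu> n) (\<nu> n)" "\<gamma>' \<in> borel_probs" "weakly_converges \<gamma> \<gamma>'"
    and w: "weakly_converges \<mu> \<mu>'" "weakly_converges \<nu> \<nu>'"
  shows "\<gamma>' \<in> couplings borel \<mu>' \<nu>'"
proof -
  have G: "\<gamma> n \<in> borel_probs" for n by (rule coupling_borel_prob[OF \<mu>(1) \<nu>(1) \<gamma>(1)])
  have f: "continuous_on UNIV (fst :: 'a \<times> 'a \<Rightarrow> 'a)"
    and s: "continuous_on UNIV (snd :: 'a \<times> 'a \<Rightarrow> 'a)"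
    by (intro continuous_on_fst continuous_on_snd continuous_on_id)+
  have "weakly_converges \<mu> (distr \<gamma>' borel fst)"
  proof -
    have "weakly_converges (\<lambda>n. distr (\<gamma> n) borel fst) (distr \<gamma>' borel fst)"
      by (rule weakly_converges_distr) (rule \<gamma>(3) G \<gamma>(2) f)+
    then show ?thesis by (simp add: distr_coupling_fst[OF \<mu>(1) \<nu>(1) \<gamma>(1)])
  qed
  then have "distr \<gamma>' borel fst = \<mu>'"
    using w(1) borel_probs_distr[OF \<gamma>(2) f] \<mu>(2) by (rule weakly_converges_unique)
  moreover have "weakly_converges \<nu> (distr \<gamma>' borel snd)"
  proof -
    have "weakly_converges (\<lambda>n. distr (\<gamma> n) borel snd) (distr \<gamma>' borel snd)"
      by (rule weakly_converges_distr) (rule \<gamma>(3) G \<gamma>(2) s)+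
    then show ?thesis by (simp add: distr_coupling_snd[OF \<mu>(1) \<nu>(1) \<gamma>(1)])
  qed
  then have "distr \<gamma>' borel snd = \<nu>'"
    using w(2) borel_probs_distr[OF \<gamma>(2) s] \<nu>(2) by (rule weakly_converges_unique)
  ultimately show ?thesis using couplings_borel_iff[OF \<mu>(2) \<nu>(2)] \<gamma>(2) by blast
qed

text \<open>\<open>g\<close> will be \<open>c x0\<close>. The cost \<open>k\<close> stays a
  parameter of the lemmas so that they serve \<open>c\<close>, the transposed cost and, for lower
  semicontinuity, \<open>moment_defect\<close>.\<close>

locale proper_function =
  fixes g :: "'a::{metric_space,second_countable_topology} \<Rightarrow> real"
  assumes g_cont: "continuous_on UNIV g" and g_nonneg: "0 \<le> g x" and g_proper: "compact {x. g x \<le> r}"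
begin

definition moment :: "'a measure \<Rightarrow> ennreal" where
  "moment \<nu> = (\<integral>\<^sup>+x. ennreal (g x) \<partial>\<nu>)"

lemma g_measurable: "g \<in> borel_measurable borel"
  by (rule borel_measurable_continuous_onI[OF g_cont])

lemma continuous_g_fst: "continuous_on UNIV (\<lambda>p :: 'a \<times> 'a. g (fst p))"
  and continuous_g_snd: "continuous_on UNIV (\<lambda>p :: 'a \<times> 'a. g (snd p))"
  by (rule continuous_on_compose2[OF g_cont]; auto intro: continuous_intros)+

lemma g_pair_measurable:
  assumes "\<gamma> \<in> borel_probs"
  shows "(\<lambda>p. g (fst p)) \<in> borel_measurable \<gamma>" "(\<lambda>p. g (snd p)) \<in> borel_measurable \<gamma>"
  by (rule continuous_measurable_borel_probs[OF assms] continuous_g_fst continuous_g_snd)+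

text \<open>This opens the compactness theorem to plans: the integral of
  \<open>g (fst p) + g (snd p)\<close> is the sum of the two marginal moments, so bounded marginal
  moments suffice.\<close>

lemma pair_proper:
  "continuous_on UNIV (\<lambda>p. g (fst p) + g (snd p))" "0 \<le> g (fst p) + g (snd p)"
  "compact {p. g (fst p) + g (snd p) \<le> r}"
proof -
  show c: "continuous_on UNIV (\<lambda>p. g (fst p) + g (snd p))"
    by (intro continuous_on_add continuous_g_fst continuous_g_snd)
  show "0 \<le> g (fst p) + g (snd p)" using g_nonneg by (simp add: add_nonneg_nonneg)
  have "compact (({x. g x \<le> r} \<times> {x. g x \<le> r}) \<inter> {p. g (fst p) + g (snd p) \<le> r})"
    by (intro compact_Int_closed compact_Times g_proper closed_Collect_le c) simp
  moreover have "({x. g x \<le> r} \<times> {x. g x \<le> r}) \<inter> {p. g (fst p) + g (snd p) \<le> r} = {p. g (fst p) + g (snd p) \<le> r}"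
    using g_nonneg by (auto intro: order_trans[rotated] simp: add_increasing add_increasing2)
  ultimately show "compact {p. g (fst p) + g (snd p) \<le> r}" by simp
qed

lemma moment_liminf:
  assumes "weakly_converges \<nu> \<mu>" "\<And>n. \<nu> n \<in> borel_probs" "\<mu> \<in> borel_probs"
  shows "moment \<mu> \<le> liminf (\<lambda>n. moment (\<nu> n))"
  unfolding moment_def by (rule weakly_converges_nn_integral_liminf[OF assms g_cont g_nonneg])

lemma nn_integral_pair_moment:
  assumes "\<mu> \<in> borel_probs" "\<nu> \<in> borel_probs" "\<gamma> \<in> couplings borel \<mu> \<nu>"
  shows "(\<integral>\<^sup>+p. ennreal (g (fst p) + g (snd p)) \<partial>\<gamma>) = moment \<mu> + moment \<nu>"
proof -
  note [measurable] = g_pair_measurable[OF coupling_borel_prob[OF assms]]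
  have "(\<integral>\<^sup>+p. ennreal (g (fst p) + g (snd p)) \<partial>\<gamma>) =
      (\<integral>\<^sup>+p. ennreal (g (fst p)) \<partial>\<gamma>) + (\<integral>\<^sup>+p. ennreal (g (snd p)) \<partial>\<gamma>)"
    using g_nonneg by (simp add: nn_integral_add)
  then show ?thesis
    using nn_integral_coupling_fst[OF assms, of "\<lambda>x. ennreal (g x)"]
      nn_integral_coupling_snd[OF assms, of "\<lambda>x. ennreal (g x)"] g_measurable
    by (simp add: moment_def)
qed

lemma moment_bounded_subsequence:
  assumes "\<And>n. \<nu> n \<in> borel_probs" "\<And>n. moment (\<nu> n) \<le> ennreal M"
  obtains r \<mu> where "strict_mono (r :: nat \<Rightarrow> nat)" "\<mu> \<in> borel_probs" "weakly_converges (\<nu> \<circ> r) \<mu>"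
    "moment \<mu> \<le> ennreal M"
proof -
  from weakly_convergent_subsequence[where \<nu>=\<nu>, OF g_cont g_nonneg g_proper assms[unfolded moment_def]]
  obtain r \<mu> where r: "strict_mono (r :: nat \<Rightarrow> nat)" "\<mu> \<in> borel_probs" "weakly_converges (\<nu> \<circ> r) \<mu>"
    by (elim exE conjE)
  have "moment \<mu> \<le> liminf (\<lambda>n. moment ((\<nu> \<circ> r) n))"
    by (rule moment_liminf[OF r(3)]) (simp_all add: assms r)
  also have "\<dots> \<le> liminf (\<lambda>n. ennreal M)"
    using assms by (intro Liminf_mono) simp
  finally show thesis using r by (intro that) (simp_all add: Liminf_const)
qed

lemma couplings_subsequence:
  assumes \<mu>: "\<And>n. \<mu> n \<in> borel_probs" and \<nu>: "\<And>n. \<nu> n \<in> borel_probs"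
    and \<gamma>: "\<And>n. \<gamma> n \<in> couplings borel (\<mu> n) (\<nu> n)"
    and bd: "\<And>n. moment (\<mu> n) \<le> ennreal M" "\<And>n. moment (\<nu> n) \<le> ennreal M"
  obtains r \<gamma>' where "strict_mono (r :: nat \<Rightarrow> nat)" "\<gamma>' \<in> borel_probs" "weakly_converges (\<gamma> \<circ> r) \<gamma>'"
proof -
  have "(\<integral>\<^sup>+p. ennreal (g (fst p) + g (snd p)) \<partial>\<gamma> n) \<le> ennreal (max M 0 + max M 0)" for n
  proof -
    have "ennreal M \<le> ennreal (max M 0)" by (simp add: ennreal_leI)
    then have "moment (\<mu> n) + moment (\<nu> n) \<le> ennreal (max M 0) + ennreal (max M 0)"
      by (intro add_mono order_trans[OF bd(1)] order_trans[OF bd(2)])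
    then show ?thesis
      using nn_integral_pair_moment[OF \<mu> \<nu> \<gamma>, of n] by (subst ennreal_plus) auto
  qed
  from weakly_convergent_subsequence[where \<nu>=\<gamma>, OF pair_proper coupling_borel_prob[OF \<mu> \<nu> \<gamma>] this]
  obtain r \<gamma>' where "strict_mono (r :: nat \<Rightarrow> nat)" "\<gamma>' \<in> borel_probs" "weakly_converges (\<gamma> \<circ> r) \<gamma>'"
    by (elim exE conjE)
  then show thesis by (rule that)
qed

text \<open>Along a subsequence that attains the lower limit, near-optimal plans have a weak limit
  by compactness. It couples the limit measures, and its cost is bounded by lower semicontinuity of
  the integral of \<open>k\<close>.\<close>

lemma transport_cost_liminf:
  assumes \<mu>: "\<And>n. \<mu> n \<in> borel_probs" "\<mu>' \<in> borel_probs" and \<nu>: "\<And>n. \<nu> n \<in> borel_probs" "\<nu>' \<in> borel_probs"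
    and bd: "\<And>n. moment (\<mu> n) \<le> ennreal M" "\<And>n. moment (\<nu> n) \<le> ennreal M"
    and w: "weakly_converges \<mu> \<mu>'" "weakly_converges \<nu> \<nu>'"
    and k: "continuous_on UNIV (\<lambda>p. k (fst p) (snd p))" "\<And>x y. 0 \<le> k x y"
  shows "transport_cost k \<mu>' \<nu>' \<le> liminf (\<lambda>n. transport_cost k (\<mu> n) (\<nu> n))"
proof -
  let ?T = "\<lambda>n. transport_cost k (\<mu> n) (\<nu> n)"
  obtain s where s: "strict_mono (s :: nat \<Rightarrow> nat)" "(?T \<circ> s) \<longlonglongrightarrow> liminf ?T"
    using liminf_subseq_lim by blast
  have "\<exists>\<gamma>. \<gamma> \<in> couplings borel (\<mu> (s n)) (\<nu> (s n)) \<and>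
    plan_cost k \<gamma> \<le> ?T (s n) + ennreal (inverse (real (Suc n)))" for n
    using transport_cost_approx[OF \<mu>(1) \<nu>(1), of "inverse (real (Suc n))" "s n" "s n" k] by (metis inverse_positive_iff_positive of_nat_0_less_iff zero_less_Suc)
  then obtain \<gamma> where \<gamma>: "\<And>n. \<gamma> n \<in> couplings borel (\<mu> (s n)) (\<nu> (s n))"
    "\<And>n. plan_cost k (\<gamma> n) \<le> ?T (s n) + ennreal (inverse (real (Suc n)))"
    by metis
  obtain r \<gamma>' where r: "strict_mono (r :: nat \<Rightarrow> nat)" "\<gamma>' \<in> borel_probs" "weakly_converges (\<gamma> \<circ> r) \<gamma>'"
    by (rule couplings_subsequence[OF \<mu>(1) \<nu>(1) \<gamma>(1) bd])
  have sr: "strict_mono (s \<circ> r)" using s(1) r(1) by (rule strict_mono_o)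
  have "\<gamma>' \<in> couplings borel \<mu>' \<nu>'"
    by (rule coupling_limit[of "\<mu> \<circ> (s \<circ> r)" _ "\<nu> \<circ> (s \<circ> r)" _ "\<gamma> \<circ> r"])
      (simp_all add: \<mu> \<nu> \<gamma>(1) r(2,3) weakly_converges_subseq[OF w(1) sr] weakly_converges_subseq[OF w(2) sr])
  then have "transport_cost k \<mu>' \<nu>' \<le> plan_cost k \<gamma>'" by (rule transport_cost_le)
  also have "\<dots> \<le> liminf (\<lambda>n. plan_cost k ((\<gamma> \<circ> r) n))"
    using coupling_borel_prob[OF \<mu>(1) \<nu>(1) \<gamma>(1)] by (intro weakly_converges_nn_integral_liminf r k) simp_all
  also have "\<dots> \<le> liminf (\<lambda>n. ?T (s (r n)) + ennreal (inverse (real (Suc (r n)))))"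
    using \<gamma>(2) by (intro Liminf_mono) simp
  also have "\<dots> = liminf ?T"
  proof -
    have "(\<lambda>n. ennreal (inverse (real (Suc n)))) \<longlonglongrightarrow> ennreal 0"
      by (intro tendsto_ennrealI LIMSEQ_inverse_real_of_nat)
    then have "(\<lambda>n. ?T (s n) + ennreal (inverse (real (Suc n)))) \<longlonglongrightarrow> liminf ?T + 0"
      using s(2) by (intro tendsto_add) (simp_all add: o_def)
    from LIMSEQ_subseq_LIMSEQ[OF this r(1)]
    have "(\<lambda>n. ?T (s (r n)) + ennreal (inverse (real (Suc (r n))))) \<longlonglongrightarrow> liminf ?T" by (simp add: o_def)
    then show ?thesis by (rule lim_imp_Liminf[rotated]) simp
  qed
  finally show ?thesis .
qed

text \<open>An identity rather than a bound: dropping the slack integral gives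
  \<open>moment_le_transport_cost\<close>, while its lower semicontinuity along weakly convergent
  plans bounds limits of moments from above.\<close>

lemma moment_le_coupling:
  assumes \<mu>: "\<mu> \<in> borel_probs" and \<nu>: "\<nu> \<in> borel_probs" and \<gamma>: "\<gamma> \<in> couplings borel \<mu> \<nu>"
    and k: "continuous_on UNIV (\<lambda>p. k (fst p) (snd p))" "\<And>x y. 0 \<le> k x y"
    and AB: "0 \<le> A" "0 \<le> B" and growth: "\<And>x y. g y \<le> A + B * (g x + k x y)"
  shows "moment \<nu> + (\<integral>\<^sup>+p. ennreal (A + B * (g (fst p) + k (fst p) (snd p)) - g (snd p)) \<partial>\<gamma>) =
    ennreal A + ennreal B * (moment \<mu> + plan_cost k \<gamma>)"
proof -
  have P: "prob_space \<gamma>" using borel_probsD[OF coupling_borel_prob[OF \<mu> \<nu> \<gamma>]] by simp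
  note [measurable] = g_pair_measurable[OF coupling_borel_prob[OF \<mu> \<nu> \<gamma>]]
    coupling_measurable[OF \<mu> \<nu> \<gamma> borel_measurable_continuous_onI[OF k(1)]]
  have "moment \<nu> + (\<integral>\<^sup>+p. ennreal (A + B * (g (fst p) + k (fst p) (snd p)) - g (snd p)) \<partial>\<gamma>) =
    (\<integral>\<^sup>+p. ennreal (g (snd p)) \<partial>\<gamma>) + (\<integral>\<^sup>+p. ennreal (A + B * (g (fst p) + k (fst p) (snd p)) - g (snd p)) \<partial>\<gamma>)"
    using nn_integral_coupling_snd[OF \<mu> \<nu> \<gamma>, of "\<lambda>x. ennreal (g x)"] g_measurable by (simp add: moment_def)
  also have "\<dots> = (\<integral>\<^sup>+p. ennreal (g (snd p)) + ennreal (A + B * (g (fst p) + k (fst p) (snd p)) - g (snd p)) \<partial>\<gamma>)"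
    by (rule nn_integral_add[symmetric]) auto
  also have "\<dots> = (\<integral>\<^sup>+p. ennreal (A + B * (g (fst p) + k (fst p) (snd p))) \<partial>\<gamma>)"
    using growth g_nonneg by (intro nn_integral_cong) (simp add: ennreal_plus[symmetric] del: ennreal_plus)
  also have "\<dots> = ennreal A + ennreal B * ((\<integral>\<^sup>+p. ennreal (g (fst p)) \<partial>\<gamma>) + plan_cost k \<gamma>)"
    using AB k(2) g_nonneg by (intro nn_integral_affine P) auto
  also have "(\<integral>\<^sup>+p. ennreal (g (fst p)) \<partial>\<gamma>) = moment \<mu>"
    using nn_integral_coupling_fst[OF \<mu> \<nu> \<gamma>, of "\<lambda>x. ennreal (g x)"] g_measurable by (simp add: moment_def)
  finally show ?thesis .
qed

lemma moment_le_transport_cost: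
  assumes \<mu>: "\<mu> \<in> borel_probs" and \<nu>: "\<nu> \<in> borel_probs"
    and k: "continuous_on UNIV (\<lambda>p. k (fst p) (snd p))" "\<And>x y. 0 \<le> k x y"
    and AB: "0 \<le> A" "0 \<le> B" and growth: "\<And>x y. g y \<le> A + B * (g x + k x y)"
  shows "moment \<nu> \<le> ennreal A + ennreal B * (moment \<mu> + transport_cost k \<mu> \<nu>)"
proof (rule ennreal_le_epsilon)
  fix e :: real assume e: "0 < e"
  \<comment> \<open>Dividing by \<open>B + 1\<close> rather than \<open>B\<close> allows
    \<open>B = 0\<close>.\<close>
  define d where "d = e / (B + 1)"
  have d: "0 < d" "B * d \<le> e" using e AB by (auto simp: d_def field_simps)
  obtain \<gamma> where \<gamma>: "\<gamma> \<in> couplings borel \<mu> \<nu>"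
    and le: "plan_cost k \<gamma> \<le> transport_cost k \<mu> \<nu> + ennreal d"
    using transport_cost_approx[OF \<mu> \<nu> d(1)] .
  have "moment \<nu> \<le> ennreal A + ennreal B * (moment \<mu> + plan_cost k \<gamma>)"
    unfolding moment_le_coupling[OF \<mu> \<nu> \<gamma> k AB growth, symmetric] by simp
  also have "\<dots> \<le> ennreal A + ennreal B * (moment \<mu> + (transport_cost k \<mu> \<nu> + ennreal d))"
    using le by (intro add_mono mult_left_mono) auto
  also have "\<dots> = ennreal A + ennreal B * (moment \<mu> + transport_cost k \<mu> \<nu>) + ennreal (B * d)"
    using AB d(1) by (simp add: ennreal_mult distrib_left add.assoc)
  also have "\<dots> \<le> ennreal A + ennreal B * (moment \<mu> + transport_cost k \<mu> \<nu>) + ennreal e"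
    using d by (intro add_mono ennreal_leI) auto
  finally show "moment \<nu> \<le> ennreal A + ennreal B * (moment \<mu> + transport_cost k \<mu> \<nu>) + ennreal e" .
qed

lemma transport_cost_le_moments:
  assumes \<mu>: "\<mu> \<in> borel_probs" and \<nu>: "\<nu> \<in> borel_probs"
    and AB: "0 \<le> A" "0 \<le> B" and growth: "\<And>x y. k x y \<le> A + B * (g x + g y)"
  shows "transport_cost k \<mu> \<nu> \<le> ennreal A + ennreal B * (moment \<mu> + moment \<nu>)"
proof -
  note \<gamma> = product_coupling[OF \<mu> \<nu>]
  have P: "prob_space (\<mu> \<Otimes>\<^sub>M \<nu>)" using borel_probsD[OF coupling_borel_prob[OF \<mu> \<nu> \<gamma>]] by simp
  note [measurable] = g_pair_measurable[OF coupling_borel_prob[OF \<mu> \<nu> \<gamma>]]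
  have "transport_cost k \<mu> \<nu> \<le> plan_cost k (\<mu> \<Otimes>\<^sub>M \<nu>)" by (rule transport_cost_le[OF \<gamma>])
  also have "\<dots> \<le> (\<integral>\<^sup>+p. ennreal (A + B * (g (fst p) + g (snd p))) \<partial>(\<mu> \<Otimes>\<^sub>M \<nu>))"
    by (intro nn_integral_mono ennreal_leI growth)
  also have "\<dots> = ennreal A + ennreal B * (moment \<mu> + moment \<nu>)"
    using nn_integral_coupling_fst[OF \<mu> \<nu> \<gamma>, of "\<lambda>x. ennreal (g x)"]
      nn_integral_coupling_snd[OF \<mu> \<nu> \<gamma>, of "\<lambda>x. ennreal (g x)"] g_measurable
    by (subst nn_integral_affine[OF P AB]) (auto simp: moment_def g_nonneg)
  finally show ?thesis .
qed

end

section \<open>Subsequence principles and sequences of vanishing cost\<close>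

lemma tendsto_if_subsequences:
  fixes X :: "nat \<Rightarrow> 't::topological_space"
  assumes "\<And>s. strict_mono (s :: nat \<Rightarrow> nat) \<Longrightarrow> \<exists>r. strict_mono (r :: nat \<Rightarrow> nat) \<and> (\<lambda>n. X (s (r n))) \<longlonglongrightarrow> L"
  shows "X \<longlonglongrightarrow> L"
proof (rule topological_tendstoI, rule ccontr)
  fix S assume S: "open S" "L \<in> S" and n: "\<not> (\<forall>\<^sub>F n in sequentially. X n \<in> S)"
  from not_eventually_sequentiallyD[OF n] obtain s where s: "strict_mono (s :: nat \<Rightarrow> nat)" "\<And>n. X (s n) \<notin> S" by auto
  from assms[OF s(1)] obtain r where "(\<lambda>n. X (s (r n))) \<longlonglongrightarrow> L" by auto
  from topological_tendstoD[OF this S] s(2) show False by simp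
qed

lemma weakly_converges_if_subsequences:
  assumes "\<And>s. strict_mono (s :: nat \<Rightarrow> nat) \<Longrightarrow> \<exists>r. strict_mono (r :: nat \<Rightarrow> nat) \<and> weakly_converges (\<lambda>n. \<nu> (s (r n))) \<mu>"
  shows "weakly_converges \<nu> \<mu>"
  unfolding weakly_converges_def
proof (intro allI impI tendsto_if_subsequences)
  fix f :: "'a \<Rightarrow> real" and s assume f: "continuous_on UNIV f \<and> bounded (range f)" and s: "strict_mono (s :: nat \<Rightarrow> nat)"
  from assms[OF s] obtain r where r: "strict_mono (r :: nat \<Rightarrow> nat)" "weakly_converges (\<lambda>n. \<nu> (s (r n))) \<mu>" by auto
  then show "\<exists>r. strict_mono (r :: nat \<Rightarrow> nat) \<and> (\<lambda>n. \<integral>x. f x \<partial>\<nu> (s (r n))) \<longlonglongrightarrow> (\<integral>x. f x \<partial>\<mu>)"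
    using f unfolding weakly_converges_def by (intro exI[of _ r]) simp
qed

context proper_function
begin

text \<open>A coupling of vanishing cost converges weakly to the diagonal coupling of \<open>\<mu>\<close>.
  The nonnegative function \<open>A + B * (g x + k x y) - g y\<close> is lower semicontinuous under this
  convergence, which bounds the moments from above.\<close>

lemma transport_cost_tendsto_0_subsequence:
  assumes \<mu>: "\<mu> \<in> borel_probs" "moment \<mu> < \<infinity>" and \<nu>: "\<And>n. \<nu> n \<in> borel_probs"
    and k: "continuous_on UNIV (\<lambda>p. k (fst p) (snd p))" "\<And>x y. 0 \<le> k x y" "\<And>x y. k x y = 0 \<Longrightarrow> x = y"
    and AB: "0 \<le> A" "0 \<le> B" and growth: "\<And>x y. g y \<le> A + B * (g x + k x y)"
    and lim: "(\<lambda>n. transport_cost k \<mu> (\<nu> n)) \<longlonglongrightarrow> 0"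
  shows "\<exists>r. strict_mono (r :: nat \<Rightarrow> nat) \<and> weakly_converges (\<lambda>n. \<nu> (r n)) \<mu> \<and> (\<lambda>n. moment (\<nu> (r n))) \<longlonglongrightarrow> moment \<mu>"
proof -
  have "\<forall>\<^sub>F n in sequentially. transport_cost k \<mu> (\<nu> n) < 1" using order_tendstoD(2)[OF lim, of 1] by simp
  then obtain N where N: "\<And>n. n \<ge> N \<Longrightarrow> transport_cost k \<mu> (\<nu> n) < 1" unfolding eventually_sequentially by auto
  \<comment> \<open>Beyond \<open>N\<close> the cost is below 1, which bounds all moments at once
    through \<open>moment_le_transport_cost\<close>.\<close>
  define \<nu>' where "\<nu>' n = \<nu> (n + N)" for n
  have \<nu>': "\<nu>' n \<in> borel_probs" for n by (simp add: \<nu>'_def \<nu>)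
  have less1: "transport_cost k \<mu> (\<nu>' n) < 1" for n using N[of "n + N"] by (simp add: \<nu>'_def)
  have lim': "(\<lambda>n. transport_cost k \<mu> (\<nu>' n)) \<longlonglongrightarrow> 0"
    unfolding \<nu>'_def using LIMSEQ_ignore_initial_segment[OF lim] .
  have "\<exists>\<gamma>. \<gamma> \<in> couplings borel \<mu> (\<nu>' n) \<and>
    plan_cost k \<gamma> \<le> transport_cost k \<mu> (\<nu>' n) + ennreal (inverse (real (Suc n)))" for n
    by (rule transport_cost_approx[OF \<mu>(1) \<nu>', of "inverse (real (Suc n))" n k]) auto
  then obtain \<gamma> where \<gamma>: "\<And>n. \<gamma> n \<in> couplings borel \<mu> (\<nu>' n)"
    "\<And>n. plan_cost k (\<gamma> n) \<le> transport_cost k \<mu> (\<nu>' n) + ennreal (inverse (real (Suc n)))"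
    by metis
  let ?I = "\<lambda>n. plan_cost k (\<gamma> n)"
  have I0: "?I \<longlonglongrightarrow> 0"
  proof (rule tendsto_sandwich[OF _ _ tendsto_const])
    have "(\<lambda>n. transport_cost k \<mu> (\<nu>' n) + ennreal (inverse (real (Suc n)))) \<longlonglongrightarrow> 0 + ennreal 0"
      by (intro tendsto_add lim' tendsto_ennrealI LIMSEQ_inverse_real_of_nat)
    then show "(\<lambda>n. transport_cost k \<mu> (\<nu>' n) + ennreal (inverse (real (Suc n)))) \<longlonglongrightarrow> 0" by simp
    show "\<forall>\<^sub>F n in sequentially. ?I n \<le> transport_cost k \<mu> (\<nu>' n) + ennreal (inverse (real (Suc n)))"
      by (intro always_eventually allI \<gamma>(2))
  qed simp
  obtain m where m: "moment \<mu> = ennreal m" "0 \<le> m" using \<mu>(2) by (cases "moment \<mu>") auto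
  have "moment (\<nu>' n) \<le> ennreal (A + B * (m + 1))" for n
  proof -
    have "moment (\<nu>' n) \<le> ennreal A + ennreal B * (moment \<mu> + transport_cost k \<mu> (\<nu>' n))"
      by (rule moment_le_transport_cost[OF \<mu>(1) \<nu>' k(1,2) AB growth])
    also have "\<dots> \<le> ennreal A + ennreal B * (ennreal m + 1)"
      using less1[of n] m by (intro add_mono mult_left_mono) auto
    also have "\<dots> = ennreal (A + B * (m + 1))" using AB m by (simp add: ennreal_mult)
    finally show ?thesis .
  qed
  then have bd: "moment \<mu> \<le> ennreal (max m (A + B * (m + 1)))"
    "moment (\<nu>' n) \<le> ennreal (max m (A + B * (m + 1)))" for n
    using m by (auto intro!: ennreal_leI intro: order_trans[OF _ ennreal_leI[OF max.cobounded2]])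
  obtain r \<gamma>' where r: "strict_mono (r :: nat \<Rightarrow> nat)" "\<gamma>' \<in> borel_probs" "weakly_converges (\<gamma> \<circ> r) \<gamma>'"
    by (rule couplings_subsequence[OF \<mu>(1) \<nu>' \<gamma>(1) bd])
  have G: "(\<gamma> \<circ> r) n \<in> borel_probs" for n using coupling_borel_prob[OF \<mu>(1) \<nu>' \<gamma>(1)] by simp
  have f: "continuous_on UNIV (fst :: 'a \<times> 'a \<Rightarrow> 'a)" and s: "continuous_on UNIV (snd :: 'a \<times> 'a \<Rightarrow> 'a)"
    by (intro continuous_on_fst continuous_on_snd continuous_on_id)+
  have kI: "(\<lambda>n. ?I (r n)) \<longlonglongrightarrow> 0" using LIMSEQ_subseq_LIMSEQ[OF I0 r(1)] by (simp add: o_def)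
  have "plan_cost k \<gamma>' \<le> liminf (\<lambda>n. plan_cost k ((\<gamma> \<circ> r) n))"
    by (rule weakly_converges_nn_integral_liminf[OF r(3) G r(2) k(1,2)])
  also have "\<dots> = 0" using lim_imp_Liminf[OF _ kI] by simp
  finally have k0: "plan_cost k \<gamma>' = 0" by simp
  then have "AE p in \<gamma>'. ennreal (k (fst p) (snd p)) = 0"
    using borel_measurable_borel_probs[OF r(2) measurable_cost[OF k(1)]] by (subst (asm) nn_integral_0_iff_AE) auto
  then have diag: "AE p in \<gamma>'. fst p = snd p"
  proof eventually_elim
    case (elim p)
    then have "k (fst p) (snd p) = 0" using k(2)[of "fst p" "snd p"] by (simp add: ennreal_eq_0_iff)
    then show ?case by (rule k(3))
  qed
  have fstr: "weakly_converges (\<lambda>n. distr ((\<gamma> \<circ> r) n) borel fst) (distr \<gamma>' borel fst)"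
    by (rule weakly_converges_distr) (rule r(3) G r(2) f)+
  have sndr: "weakly_converges (\<lambda>n. distr ((\<gamma> \<circ> r) n) borel snd) (distr \<gamma>' borel snd)"
    by (rule weakly_converges_distr) (rule r(3) G r(2) s)+
  have "weakly_converges (\<lambda>n. \<mu>) (distr \<gamma>' borel fst)"
    using fstr by (simp add: distr_coupling_fst[OF \<mu>(1) \<nu>' \<gamma>(1)])
  then have fst': "distr \<gamma>' borel fst = \<mu>"
    using weakly_converges_const borel_probs_distr[OF r(2) f] \<mu>(1) by (rule weakly_converges_unique)
  have mf: "fst \<in> \<gamma>' \<rightarrow>\<^sub>M borel" and ms: "snd \<in> \<gamma>' \<rightarrow>\<^sub>M borel"
    by (rule borel_measurable_borel_probs[OF r(2)], measurable)+
  \<comment> \<open>The limit plan is carried by the diagonal, so its still unknown second marginal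
    is the first one, that is \<open>\<mu>\<close>.\<close>
  have "distr \<gamma>' borel snd = distr \<gamma>' borel fst"
    using diag by (intro distr_cong_AE refl mf ms) (auto elim: eventually_mono)
  with fst' have snd': "distr \<gamma>' borel snd = \<mu>" by simp
  have w: "weakly_converges (\<lambda>n. \<nu>' (r n)) \<mu>"
    using sndr by (simp add: distr_coupling_snd[OF \<mu>(1) \<nu>' \<gamma>(1)] snd')
  have \<gamma>'c: "\<gamma>' \<in> couplings borel \<mu> \<mu>"
    using couplings_borel_iff[OF \<mu>(1) \<mu>(1)] r(2) fst' snd' by simp
  let ?F = "\<lambda>p. A + B * (g (fst p) + k (fst p) (snd p)) - g (snd p)"
  have F: "continuous_on UNIV ?F"
    by (intro continuous_on_add continuous_on_diff continuous_on_mult continuous_on_const continuous_g_fst continuous_g_snd k(1))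
  have F0: "0 \<le> ?F p" for p using growth[of "snd p" "fst p"] by simp
  have lF: "(\<integral>\<^sup>+p. ?F p \<partial>\<gamma>') \<le> liminf (\<lambda>n. \<integral>\<^sup>+p. ?F p \<partial>(\<gamma> \<circ> r) n)"
    by (rule weakly_converges_nn_integral_liminf[OF r(3) G r(2) F F0])
  have eq: "moment (\<nu>' (r n)) + (\<integral>\<^sup>+p. ?F p \<partial>\<gamma> (r n)) = ennreal A + ennreal B * (moment \<mu> + ?I (r n))" for n
    by (rule moment_le_coupling[OF \<mu>(1) \<nu>' \<gamma>(1) k(1,2) AB growth])
  have eq': "moment \<mu> + (\<integral>\<^sup>+p. ?F p \<partial>\<gamma>') = ennreal A + ennreal B * (moment \<mu> + 0)"
    using moment_le_coupling[OF \<mu>(1) \<mu>(1) \<gamma>'c k(1,2) AB growth] unfolding k0 .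
  have "limsup (\<lambda>n. moment (\<nu>' (r n))) \<le> moment \<mu>"
  proof (rule limsup_le_of_liminf_add[OF _ _ lF])
    show "(\<integral>\<^sup>+p. ?F p \<partial>(\<gamma> \<circ> r) n) + moment (\<nu>' (r n)) \<le> ennreal A + ennreal B * (moment \<mu> + ?I (r n))" for n
      using eq[of n] by (simp add: add.commute)
    have "(\<lambda>n. ennreal A + ennreal B * (moment \<mu> + ?I (r n))) \<longlonglongrightarrow> ennreal A + ennreal B * (moment \<mu> + 0)"
      by (intro tendsto_add tendsto_const ennreal_tendsto_cmult kI) simp
    then show "(\<lambda>n. ennreal A + ennreal B * (moment \<mu> + ?I (r n))) \<longlonglongrightarrow> (\<integral>\<^sup>+p. ?F p \<partial>\<gamma>') + moment \<mu>"
      unfolding eq'[symmetric] by (simp add: add.commute)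
    have "moment \<mu> + (\<integral>\<^sup>+p. ?F p \<partial>\<gamma>') < \<infinity>" unfolding eq' using \<mu>(2) by (simp add: ennreal_mult_less_top)
    then show "(\<integral>\<^sup>+p. ?F p \<partial>\<gamma>') < \<infinity>" by (simp add: add_top)
  qed (use \<mu> in simp)
  moreover have "moment \<mu> \<le> liminf (\<lambda>n. moment (\<nu>' (r n)))"
    by (rule moment_liminf[OF w \<nu>' \<mu>(1)])
  ultimately have "(\<lambda>n. moment (\<nu>' (r n))) \<longlonglongrightarrow> moment \<mu>"
    by (intro tendsto_ennreal_of_liminf_limsup)
  moreover have "strict_mono (\<lambda>n. r n + N)" using r(1) by (simp add: strict_mono_def)
  ultimately show ?thesis using w unfolding \<nu>'_def by (intro exI[of _ "\<lambda>n. r n + N"]) simp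
qed

lemma transport_cost_tendsto_0_imp:
  assumes \<mu>: "\<mu> \<in> borel_probs" "moment \<mu> < \<infinity>" and \<nu>: "\<And>n. \<nu> n \<in> borel_probs"
    and k: "continuous_on UNIV (\<lambda>p. k (fst p) (snd p))" "\<And>x y. 0 \<le> k x y" "\<And>x y. k x y = 0 \<Longrightarrow> x = y"
    and AB: "0 \<le> A" "0 \<le> B" and growth: "\<And>x y. g y \<le> A + B * (g x + k x y)"
    and lim: "(\<lambda>n. transport_cost k \<mu> (\<nu> n)) \<longlonglongrightarrow> 0"
  shows "weakly_converges \<nu> \<mu>" "(\<lambda>n. moment (\<nu> n)) \<longlonglongrightarrow> moment \<mu>"
proof -
  have *: "\<exists>r. strict_mono (r :: nat \<Rightarrow> nat) \<and> weakly_converges (\<lambda>n. \<nu> (s (r n))) \<mu> \<and> (\<lambda>n. moment (\<nu> (s (r n)))) \<longlonglongrightarrow> moment \<mu>"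
    if "strict_mono (s :: nat \<Rightarrow> nat)" for s
  proof (rule transport_cost_tendsto_0_subsequence[OF \<mu> \<nu> k(1,2) _ AB growth])
    show "(\<lambda>n. transport_cost k \<mu> (\<nu> (s n))) \<longlonglongrightarrow> 0"
      using LIMSEQ_subseq_LIMSEQ[OF lim that] unfolding o_def .
  qed (rule k(3))
  show "weakly_converges \<nu> \<mu>"
    by (rule weakly_converges_if_subsequences) (use * in fast)
  show "(\<lambda>n. moment (\<nu> n)) \<longlonglongrightarrow> moment \<mu>"
    by (rule tendsto_if_subsequences) (use * in fast)
qed

end

section \<open>Approximate gluing\<close>

text \<open>For a partition of unity \<open>\<eta>\<close> with masses \<open>a i\<close> and \<open>b i\<close> under two probability measures,
  this is the density, with respect to their product, of the coupling that matches the \<open>\<eta> i\<close>-parts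
  up to the mass \<open>min (a i) (b i)\<close> and couples the remainders independently.
  Division by zero gives the intended value \<open>0\<close> when \<open>a i = 0\<close>, \<open>b i = 0\<close> or the remainder vanishes.\<close>

definition matching_density ::
    "'i set \<Rightarrow> ('i \<Rightarrow> 'b \<Rightarrow> real) \<Rightarrow> ('i \<Rightarrow> real) \<Rightarrow> ('i \<Rightarrow> real) \<Rightarrow> 'b \<Rightarrow> 'b \<Rightarrow> real" where
  "matching_density I \<eta> a b y z =
    (\<Sum>i\<in>I. min (a i) (b i) / (a i * b i) * (\<eta> i y * \<eta> i z)) +
    (\<Sum>i\<in>I. (1 - min (a i) (b i) / a i) * \<eta> i y) * (\<Sum>i\<in>I. (1 - min (a i) (b i) / b i) * \<eta> i z) /
      (1 - (\<Sum>i\<in>I. min (a i) (b i)))"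

text \<open>Symmetry lets the column integrals be computed as row integrals with the two measures
  exchanged.\<close>

lemma matching_density_commute: "matching_density I \<eta> a b y z = matching_density I \<eta> b a z y"
  by (simp add: matching_density_def min.commute mult.commute)

text \<open>The masses are bare numbers here, not yet tied to measures, so that the locale can also
  be interpreted with \<open>a\<close> and \<open>b\<close> exchanged.\<close>

locale partition_masses =
  fixes I :: "'i set" and \<eta> :: "'i \<Rightarrow> 'b::{metric_space,second_countable_topology} \<Rightarrow> real" and a b :: "'i \<Rightarrow> real"
  assumes fin: "finite I" and eta_nonneg: "\<And>i x. 0 \<le> \<eta> i x" and eta_sum: "\<And>x. (\<Sum>i\<in>I. \<eta> i x) = 1"
    and eta_measurable: "\<And>i. i \<in> I \<Longrightarrow> \<eta> i \<in> borel_measurable borel"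
    and a_nonneg: "\<And>i. 0 \<le> a i" and a_sum: "(\<Sum>i\<in>I. a i) = 1"
    and b_nonneg: "\<And>i. 0 \<le> b i" and b_sum: "(\<Sum>i\<in>I. b i) = 1"
begin

text \<open>Since both mass vectors sum to 1, this is their total variation distance.\<close>

definition rest :: real where "rest = 1 - (\<Sum>i\<in>I. min (a i) (b i))"

lemma rest_nonneg: "0 \<le> rest"
  using sum_mono[of I "\<lambda>i. min (a i) (b i)" a] a_sum by (simp add: rest_def)

lemma coeff_nonneg: "0 \<le> 1 - min (a i) (b i) / a i" "0 \<le> 1 - min (a i) (b i) / b i"
  using a_nonneg[of i] b_nonneg[of i] by (auto simp: divide_le_eq_1 not_less)

lemma sum_coeff_b: "(\<Sum>i\<in>I. (1 - min (a i) (b i) / b i) * b i) = rest"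
proof -
  have "(1 - min (a i) (b i) / b i) * b i = b i - min (a i) (b i)" for i
    using a_nonneg[of i] by (cases "b i = 0") (auto simp: field_simps)
  then show ?thesis by (simp add: sum_subtractf b_sum rest_def)
qed

lemma sum_coeff_a: "(\<Sum>i\<in>I. (1 - min (a i) (b i) / a i) * a i) = rest"
proof -
  have "(1 - min (a i) (b i) / a i) * a i = a i - min (a i) (b i)" for i
    using b_nonneg[of i] by (cases "a i = 0") (auto simp: field_simps)
  then show ?thesis by (simp add: sum_subtractf a_sum rest_def)
qed

lemma matching_density_nonneg: "0 \<le> matching_density I \<eta> a b y z"
  unfolding matching_density_def rest_def[symmetric]
  using a_nonneg b_nonneg eta_nonneg coeff_nonneg rest_nonneg
  by (intro add_nonneg_nonneg sum_nonneg mult_nonneg_nonneg divide_nonneg_nonneg) auto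

lemma eta_le_1: "i \<in> I \<Longrightarrow> \<eta> i x \<le> 1"
  using member_le_sum[OF _ _ fin, of i "\<lambda>i. \<eta> i x"] eta_nonneg eta_sum[of x] by auto

lemma integrable_eta: "\<nu> \<in> borel_probs \<Longrightarrow> i \<in> I \<Longrightarrow> integrable \<nu> (\<eta> i)"
  using eta_nonneg eta_le_1 by (intro integrable_borel_probs[where B=1] eta_measurable) (auto simp: abs_le_iff intro: order_trans[OF _ eta_nonneg])

text \<open>In each cell the matched part carries the fraction \<open>min (a i) (b i) / a i\<close>
  of \<open>\<eta> i y\<close> and the remainder carries the rest, so the total is the sum of all
  \<open>\<eta> i y\<close>.\<close>

lemma integral_matching_density:
  assumes \<nu>: "\<nu> \<in> borel_probs" and b: "\<And>i. i \<in> I \<Longrightarrow> b i = (\<integral>x. \<eta> i x \<partial>\<nu>)"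
    and y: "\<And>i. i \<in> I \<Longrightarrow> a i = 0 \<Longrightarrow> \<eta> i y = 0"
  shows "(\<integral>\<^sup>+z. ennreal (matching_density I \<eta> a b y z) \<partial>\<nu>) = 1"
proof -
  note int = integrable_eta[OF \<nu>]
  let ?w = "\<lambda>i. min (a i) (b i)"
  have i1: "integrable \<nu> (\<lambda>z. \<Sum>i\<in>I. ?w i / (a i * b i) * (\<eta> i y * \<eta> i z))"
    by (intro Bochner_Integration.integrable_sum integrable_mult_right int)
  have i2: "integrable \<nu> (\<lambda>z. \<Sum>i\<in>I. (1 - ?w i / b i) * \<eta> i z)"
    by (intro Bochner_Integration.integrable_sum integrable_mult_right int)
  have e1: "(\<integral>z. (\<Sum>i\<in>I. ?w i / (a i * b i) * (\<eta> i y * \<eta> i z)) \<partial>\<nu>) = (\<Sum>i\<in>I. ?w i / (a i * b i) * (\<eta> i y * b i))"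
    using int by (subst Bochner_Integration.integral_sum) (auto simp: b intro!: sum.cong integrable_mult_right)
  have e2: "(\<integral>z. (\<Sum>i\<in>I. (1 - ?w i / b i) * \<eta> i z) \<partial>\<nu>) = rest"
    using int by (subst Bochner_Integration.integral_sum) (auto simp: b[symmetric] sum_coeff_b intro!: integrable_mult_right)
  let ?\<rho> = "\<Sum>i\<in>I. (1 - ?w i / a i) * \<eta> i y"
  have md: "matching_density I \<eta> a b y z = (\<Sum>i\<in>I. ?w i / (a i * b i) * (\<eta> i y * \<eta> i z)) +
      ?\<rho> / rest * (\<Sum>i\<in>I. (1 - ?w i / b i) * \<eta> i z)" for z
    by (simp add: matching_density_def rest_def)
  have intm: "integrable \<nu> (\<lambda>z. matching_density I \<eta> a b y z)"
    unfolding md by (intro Bochner_Integration.integrable_add integrable_mult_right i1 i2)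
  have "(\<integral>z. matching_density I \<eta> a b y z \<partial>\<nu>) = (\<Sum>i\<in>I. ?w i / (a i * b i) * (\<eta> i y * b i)) + ?\<rho> / rest * rest"
    unfolding md Bochner_Integration.integral_add[OF i1 integrable_mult_right[OF i2]] integral_mult_right_zero e1 e2 ..
  also have "\<dots> = (\<Sum>i\<in>I. \<eta> i y)"
  proof (cases "rest = 0")
    \<comment> \<open>With no remainder the second summand is 0 by division by zero. Every
      \<open>a i\<close> then equals its matched mass, and in cells with \<open>a i = 0\<close>,
      where the first summand is 0 as well, the assumption on \<open>y\<close> makes
      \<open>\<eta> i y\<close> vanish.\<close>
    case True
    have "(\<Sum>i\<in>I. a i - ?w i) = 0" using True by (simp add: sum_subtractf a_sum rest_def)
    then have eq: "a i = ?w i" if "i \<in> I" for i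
      using that fin by (subst (asm) sum_nonneg_eq_0_iff) auto
    have "?w i / (a i * b i) * (\<eta> i y * b i) = \<eta> i y" if "i \<in> I" for i
    proof (cases "a i = 0")
      case False
      then have "b i \<noteq> 0" using eq[OF that] a_nonneg[of i] by (auto simp: min_def split: if_splits)
      then show ?thesis using False eq[OF that] by (simp add: field_simps)
    qed (simp add: y[OF that])
    then show ?thesis using True by simp
  next
    case False
    have "?w i / (a i * b i) * (\<eta> i y * b i) + (1 - ?w i / a i) * \<eta> i y = \<eta> i y" for i
    proof (cases "b i = 0")
      case True
      then have "?w i = 0" using a_nonneg[of i] by simp
      then show ?thesis by simp
    next
      case False
      then show ?thesis by (cases "a i = 0") (auto simp: field_simps)
    qed
    then show ?thesis using False by (simp add: sum.distrib[symmetric])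
  qed
  also have "\<dots> = 1" by (rule eta_sum)
  finally have "(\<integral>z. matching_density I \<eta> a b y z \<partial>\<nu>) = 1" .
  then show ?thesis
    using nn_integral_eq_integral[OF intm] matching_density_nonneg by simp
qed

lemma measurable_matching_density:
  assumes [measurable]: "f \<in> borel_measurable M" "h \<in> borel_measurable M"
  shows "(\<lambda>p. matching_density I \<eta> a b (f p) (h p)) \<in> borel_measurable M"
proof -
  have [measurable]: "(\<lambda>p. \<eta> i (f p)) \<in> borel_measurable M" "(\<lambda>p. \<eta> i (h p)) \<in> borel_measurable M" if "i \<in> I" for i
    by (rule measurable_compose[OF _ eta_measurable[OF that]], measurable)+
  show ?thesis unfolding matching_density_def by measurable
qed

text \<open>Meant for points at distance at least \<open>\<delta>\<close>, where only the
  exceptional cell \<open>i0\<close> can be shared: together with the remainder it is the sole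
  source of mass far from the diagonal.\<close>

lemma matching_density_far:
  assumes i0: "i0 \<in> I" and far: "\<And>i. i \<in> I \<Longrightarrow> i \<noteq> i0 \<Longrightarrow> \<eta> i y * \<eta> i z = 0"
  shows "matching_density I \<eta> a b y z \<le> min (a i0) (b i0) / (a i0 * b i0) * (\<eta> i0 y * \<eta> i0 z) +
    (\<Sum>i\<in>I. (1 - min (a i) (b i) / a i) * \<eta> i y) * (\<Sum>i\<in>I. (1 - min (a i) (b i) / b i) * \<eta> i z) / rest"
proof -
  have "(\<Sum>i\<in>I. min (a i) (b i) / (a i * b i) * (\<eta> i y * \<eta> i z)) =
      (\<Sum>i\<in>{i0}. min (a i) (b i) / (a i * b i) * (\<eta> i y * \<eta> i z))"
    using far i0 fin by (intro sum.mono_neutral_right) auto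
  then show ?thesis by (simp add: matching_density_def rest_def)
qed

end

text \<open>Gluing plans along a common marginal usually takes disintegration. Here
  \<open>\<gamma>\<close> is joined to a nearby \<open>\<nu>\<close> by an explicit density with
  respect to their product. Its rows and columns integrate to 1 almost everywhere, which yields the
  marginals, and only the exceptional cell and the unmatched remainder can separate
  \<open>h (fst q)\<close> from \<open>snd q\<close> by \<open>\<delta>\<close>.\<close>

lemma partition_gluing:
  fixes \<gamma> :: "'c::{metric_space,second_countable_topology} measure"
    and h :: "'c \<Rightarrow> 'b::{metric_space,second_countable_topology}"
  assumes pm: "partition_masses I \<eta> a b" and \<gamma>: "\<gamma> \<in> borel_probs" and \<nu>: "\<nu> \<in> borel_probs"
    and h: "h \<in> borel \<rightarrow>\<^sub>M borel"
    and a: "\<And>i. i \<in> I \<Longrightarrow> a i = (\<integral>p. \<eta> i (h p) \<partial>\<gamma>)" and b: "\<And>i. i \<in> I \<Longrightarrow> b i = (\<integral>x. \<eta> i x \<partial>\<nu>)"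
    and i0: "i0 \<in> I" and far: "\<And>i y z. i \<in> I \<Longrightarrow> i \<noteq> i0 \<Longrightarrow> \<delta> \<le> dist y z \<Longrightarrow> \<eta> i y * \<eta> i z = 0"
  obtains \<Theta> :: "('c \<times> 'b) measure" where "\<Theta> \<in> borel_probs" "distr \<Theta> borel fst = \<gamma>" "distr \<Theta> borel snd = \<nu>"
    "emeasure \<Theta> {q. \<delta> \<le> dist (h (fst q)) (snd q)} \<le> ennreal (a i0 + (1 - (\<Sum>i\<in>I. min (a i) (b i))))"
proof -
  interpret partition_masses I \<eta> a b by fact
  interpret ba: partition_masses I \<eta> b a
    using fin eta_nonneg eta_sum eta_measurable a_nonneg a_sum b_nonneg b_sum by unfold_locales auto
  interpret G: prob_space \<gamma> using borel_probsD[OF \<gamma>] by simp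
  interpret N: prob_space \<nu> using borel_probsD[OF \<nu>] by simp
  interpret P: pair_prob_space \<gamma> \<nu> ..
  have sP: "sets (\<gamma> \<Otimes>\<^sub>M \<nu>) = sets borel"
    using borel_probsD(2)[OF \<gamma>] borel_probsD(2)[OF \<nu>]
    by (subst borel_prod[symmetric]) (rule sets_pair_measure_cong)
  have spP: "space (\<gamma> \<Otimes>\<^sub>M \<nu>) = UNIV" using sets_eq_imp_space_eq[OF sP] by simp
  have Pm: "f \<in> borel_measurable borel \<Longrightarrow> f \<in> borel_measurable (\<gamma> \<Otimes>\<^sub>M \<nu>)" for f :: "'c \<times> 'b \<Rightarrow> 'x::topological_space"
    using sP by (simp cong: measurable_cong_sets)
  have h\<gamma>: "h \<in> \<gamma> \<rightarrow>\<^sub>M borel" by (rule borel_measurable_borel_probs[OF \<gamma> h])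
  have hf: "(\<lambda>q :: 'c \<times> 'b. h (fst q)) \<in> borel \<rightarrow>\<^sub>M borel"
    by (rule measurable_compose[OF measurable_fst_borel h])
  define D where "D q = matching_density I \<eta> a b (h (fst q)) (snd q)" for q :: "'c \<times> 'b"
  have D0: "D \<in> borel_measurable borel"
    unfolding D_def by (rule measurable_matching_density[OF hf measurable_snd_borel])
  have D: "(\<lambda>q. ennreal (D q)) \<in> borel_measurable (\<gamma> \<Otimes>\<^sub>M \<nu>)" using Pm[OF D0] by simp
  define \<Theta> where "\<Theta> = density (\<gamma> \<Otimes>\<^sub>M \<nu>) (\<lambda>q. ennreal (D q))"
  have \<nu>h: "distr \<gamma> borel h \<in> borel_probs" by (intro borel_probsI G.prob_space_distr h\<gamma>) simp
  have a': "a i = (\<integral>x. \<eta> i x \<partial>distr \<gamma> borel h)" if "i \<in> I" for i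
    using a[OF that] integral_distr[OF h\<gamma> eta_measurable[OF that]] by simp
  \<comment> \<open>Only almost everywhere: a cell with \<open>a i = 0\<close> is avoided by almost
    every \<open>h p\<close>, but not by every one.\<close>
  have rows: "AE p in \<gamma>. (\<integral>\<^sup>+z. ennreal (D (p, z)) \<partial>\<nu>) = 1"
  proof -
    have "AE p in \<gamma>. a i = 0 \<longrightarrow> \<eta> i (h p) = 0" if i: "i \<in> I" for i
    proof (cases "a i = 0")
      case True
      have "integrable \<gamma> (\<lambda>p. \<eta> i (h p))"
        using integrable_eta[OF \<nu>h i] integrable_distr[OF h\<gamma>] by blast
      then have "AE p in \<gamma>. \<eta> i (h p) = 0"
        using True a[OF i] eta_nonneg integral_nonneg_eq_0_iff_AE[of \<gamma> "\<lambda>p. \<eta> i (h p)"] by simp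
      then show ?thesis by eventually_elim simp
    qed simp
    then have "AE p in \<gamma>. \<forall>i\<in>I. a i = 0 \<longrightarrow> \<eta> i (h p) = 0"
      by (intro AE_finite_allI fin)
    then show ?thesis
    proof eventually_elim
      case (elim p)
      then show ?case unfolding D_def fst_conv snd_conv
        by (intro integral_matching_density[OF \<nu> b]) auto
    qed
  qed
  have cols: "AE z in \<nu>. (\<integral>\<^sup>+p. ennreal (D (p, z)) \<partial>\<gamma>) = 1"
  proof -
    have "AE z in \<nu>. b i = 0 \<longrightarrow> \<eta> i z = 0" if i: "i \<in> I" for i
    proof (cases "b i = 0")
      case True
      then have "AE z in \<nu>. \<eta> i z = 0"
        using b[OF i] eta_nonneg integral_nonneg_eq_0_iff_AE[OF integrable_eta[OF \<nu> i]] by simp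
      then show ?thesis by eventually_elim simp
    qed simp
    then have "AE z in \<nu>. \<forall>i\<in>I. b i = 0 \<longrightarrow> \<eta> i z = 0"
      by (intro AE_finite_allI fin)
    then show ?thesis
    proof eventually_elim
      case (elim z)
      have Dz: "D (p, z) = matching_density I \<eta> b a z (h p)" for p
        unfolding D_def fst_conv snd_conv by (rule matching_density_commute)
      have m: "(\<lambda>y. matching_density I \<eta> b a z y) \<in> borel_measurable borel"
        by (rule ba.measurable_matching_density) simp_all
      have "(\<integral>\<^sup>+p. ennreal (D (p, z)) \<partial>\<gamma>) = (\<integral>\<^sup>+y. ennreal (matching_density I \<eta> b a z y) \<partial>distr \<gamma> borel h)"
        unfolding Dz by (rule nn_integral_distr[OF h\<gamma>, symmetric]) (use m in simp)
      also have "\<dots> = 1" by (rule ba.integral_matching_density[OF \<nu>h a']) (use elim in auto)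
      finally show ?case .
    qed
  qed
  have int\<Theta>: "(\<integral>\<^sup>+q. f q \<partial>\<Theta>) = (\<integral>\<^sup>+q. ennreal (D q) * f q \<partial>(\<gamma> \<Otimes>\<^sub>M \<nu>))"
    if "f \<in> borel_measurable borel" for f :: "'c \<times> 'b \<Rightarrow> ennreal"
    unfolding \<Theta>_def by (rule nn_integral_density[OF D Pm[OF that]])
  have fst_int: "(\<integral>\<^sup>+q. f (fst q) \<partial>\<Theta>) = (\<integral>\<^sup>+p. f p \<partial>\<gamma>)" if f: "f \<in> borel_measurable borel" for f
  proof -
    have m: "(\<lambda>q :: 'c \<times> 'b. f (fst q)) \<in> borel_measurable borel"
      by (rule measurable_compose[OF measurable_fst_borel f])
    have "(\<integral>\<^sup>+q. f (fst q) \<partial>\<Theta>) = (\<integral>\<^sup>+p. \<integral>\<^sup>+z. ennreal (D (p, z)) * f (fst (p, z)) \<partial>\<nu> \<partial>\<gamma>)"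
      unfolding int\<Theta>[OF m] by (rule N.nn_integral_fst[symmetric]) (intro borel_measurable_times_ennreal D Pm[OF m])
    also have "\<dots> = (\<integral>\<^sup>+p. f p \<partial>\<gamma>)"
    proof (rule nn_integral_cong_AE)
      show "AE p in \<gamma>. (\<integral>\<^sup>+z. ennreal (D (p, z)) * f (fst (p, z)) \<partial>\<nu>) = f p"
        using rows
      proof (eventually_elim)
        case (elim p)
        have "(\<lambda>z. ennreal (D (p, z))) \<in> borel_measurable \<nu>"
          by (rule measurable_Pair2[OF D]) (simp add: borel_probsD(3)[OF \<gamma>])
        then show ?case using elim by (simp add: nn_integral_multc)
      qed
    qed
    finally show ?thesis .
  qed
  have snd_int: "(\<integral>\<^sup>+q. f (snd q) \<partial>\<Theta>) = (\<integral>\<^sup>+z. f z \<partial>\<nu>)" if f: "f \<in> borel_measurable borel" for f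
  proof -
    have m: "(\<lambda>q :: 'c \<times> 'b. f (snd q)) \<in> borel_measurable borel"
      by (rule measurable_compose[OF measurable_snd_borel f])
    have "(\<integral>\<^sup>+q. f (snd q) \<partial>\<Theta>) = (\<integral>\<^sup>+z. \<integral>\<^sup>+p. ennreal (D (p, z)) * f (snd (p, z)) \<partial>\<gamma> \<partial>\<nu>)"
      unfolding int\<Theta>[OF m] by (rule P.nn_integral_snd[symmetric]) (intro borel_measurable_times_ennreal D Pm[OF m])
    also have "\<dots> = (\<integral>\<^sup>+z. f z \<partial>\<nu>)"
    proof (rule nn_integral_cong_AE)
      show "AE z in \<nu>. (\<integral>\<^sup>+p. ennreal (D (p, z)) * f (snd (p, z)) \<partial>\<gamma>) = f z"
        using cols
      proof (eventually_elim)
        case (elim z)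
        have "(\<lambda>p. ennreal (D (p, z))) \<in> borel_measurable \<gamma>"
          by (rule measurable_Pair1[OF D]) (simp add: borel_probsD(3)[OF \<nu>])
        then show ?case using elim by (simp add: nn_integral_multc)
      qed
    qed
    finally show ?thesis .
  qed
  have \<Theta>s: "sets \<Theta> = sets borel" by (simp add: \<Theta>_def sP)
  have \<Theta>sp: "space \<Theta> = UNIV" using sets_eq_imp_space_eq[OF \<Theta>s] by simp
  have "emeasure \<Theta> (space \<Theta>) = 1"
    using fst_int[of "\<lambda>_. 1"] G.emeasure_space_1 by simp
  then have \<Theta>: "\<Theta> \<in> borel_probs" by (intro borel_probsI prob_spaceI \<Theta>s)
  have mf: "fst \<in> \<Theta> \<rightarrow>\<^sub>M borel" and ms: "snd \<in> \<Theta> \<rightarrow>\<^sub>M borel"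
    by (rule borel_measurable_borel_probs[OF \<Theta>], measurable)+
  have "distr \<Theta> borel fst = \<gamma>"
  proof (rule measure_eqI)
    fix A assume "A \<in> sets (distr \<Theta> borel fst)"
    then have A: "A \<in> sets borel" by simp
    have "emeasure (distr \<Theta> borel fst) A = (\<integral>\<^sup>+q. indicator A q \<partial>distr \<Theta> borel fst)"
      using A by simp
    also have "\<dots> = (\<integral>\<^sup>+q. indicator A (fst q) \<partial>\<Theta>)" using A by (intro nn_integral_distr mf) simp
    also have "\<dots> = emeasure \<gamma> A" using A borel_probsD(2)[OF \<gamma>] by (subst fst_int) simp_all
    finally show "emeasure (distr \<Theta> borel fst) A = emeasure \<gamma> A" .
  qed (simp add: borel_probsD(2)[OF \<gamma>])
  moreover have "distr \<Theta> borel snd = \<nu>"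
  proof (rule measure_eqI)
    fix A assume "A \<in> sets (distr \<Theta> borel snd)"
    then have A: "A \<in> sets borel" by simp
    have "emeasure (distr \<Theta> borel snd) A = (\<integral>\<^sup>+q. indicator A q \<partial>distr \<Theta> borel snd)"
      using A by simp
    also have "\<dots> = (\<integral>\<^sup>+q. indicator A (snd q) \<partial>\<Theta>)" using A by (intro nn_integral_distr ms) simp
    also have "\<dots> = emeasure \<nu> A" using A borel_probsD(2)[OF \<nu>] by (subst snd_int) simp_all
    finally show "emeasure (distr \<Theta> borel snd) A = emeasure \<nu> A" .
  qed (simp add: borel_probsD(2)[OF \<nu>])
  moreover have "emeasure \<Theta> {q. \<delta> \<le> dist (h (fst q)) (snd q)} \<le> ennreal (a i0 + rest)"
  proof -
    let ?S = "{q :: 'c \<times> 'b. \<delta> \<le> dist (h (fst q)) (snd q)}"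
    let ?w = "\<lambda>i. min (a i) (b i)"
    have dm: "(\<lambda>q :: 'c \<times> 'b. dist (h (fst q)) (snd q)) \<in> borel_measurable borel"
      by (rule borel_measurable_dist[OF hf measurable_snd_borel])
    have S: "?S \<in> sets borel" using dm by measurable
    \<comment> \<open>A bound for the density at far points, which is then integrated over all
      points: the exceptional cell yields \<open>min (a i0) (b i0)\<close> and the remainder yields
      \<open>rest\<close>.\<close>
    define E where "E p z = ?w i0 / (a i0 * b i0) * (\<eta> i0 (h p) * \<eta> i0 z) +
      (\<Sum>i\<in>I. (1 - ?w i / a i) * \<eta> i (h p)) * (\<Sum>i\<in>I. (1 - ?w i / b i) * \<eta> i z) / rest" for p z
    have E0: "0 \<le> E p z" for p z
      unfolding E_def using a_nonneg b_nonneg eta_nonneg coeff_nonneg rest_nonneg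
      by (intro add_nonneg_nonneg sum_nonneg mult_nonneg_nonneg divide_nonneg_nonneg) auto
    have le: "ennreal (D q) * indicator ?S q \<le> ennreal (E (fst q) (snd q))" for q
    proof (cases "q \<in> ?S")
      case True
      then have "D q \<le> E (fst q) (snd q)"
        unfolding D_def E_def by (intro matching_density_far[OF i0] far) auto
      then show ?thesis by (simp add: indicator_def ennreal_leI)
    qed simp
    have etah: "(\<lambda>p. \<eta> i (h p)) \<in> borel_measurable borel" if "i \<in> I" for i
      by (rule measurable_compose[OF h eta_measurable[OF that]])
    have etah_int: "integrable \<gamma> (\<lambda>p. \<eta> i (h p))" if "i \<in> I" for i
      using integrable_eta[OF \<nu>h that] integrable_distr[OF h\<gamma>] by blast
    have sig: "integrable \<nu> (\<lambda>z. \<Sum>i\<in>I. (1 - ?w i / b i) * \<eta> i z)"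
      by (intro Bochner_Integration.integrable_sum integrable_mult_right integrable_eta[OF \<nu>])
    have rho: "integrable \<gamma> (\<lambda>p. \<Sum>i\<in>I. (1 - ?w i / a i) * \<eta> i (h p))"
      by (intro Bochner_Integration.integrable_sum integrable_mult_right etah_int)
    have sig_int: "(\<integral>z. (\<Sum>i\<in>I. (1 - ?w i / b i) * \<eta> i z) \<partial>\<nu>) = rest"
      using integrable_eta[OF \<nu>] by (subst Bochner_Integration.integral_sum)
        (auto simp: b[symmetric] sum_coeff_b intro!: integrable_mult_right)
    have rho_int: "(\<integral>p. (\<Sum>i\<in>I. (1 - ?w i / a i) * \<eta> i (h p)) \<partial>\<gamma>) = rest"
      using etah_int by (subst Bochner_Integration.integral_sum)
        (auto simp: a[symmetric] sum_coeff_a intro!: integrable_mult_right)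
    \<comment> \<open>The factor \<open>rest / rest\<close> is left as it stands: it is 1, or 0 when
      \<open>rest = 0\<close>, and in both cases its product with \<open>rest\<close> is
      \<open>rest\<close>.\<close>
    let ?F = "\<lambda>p. ?w i0 / (a i0 * b i0) * b i0 * \<eta> i0 (h p) + rest / rest * (\<Sum>i\<in>I. (1 - ?w i / a i) * \<eta> i (h p))"
    have inner: "(\<integral>\<^sup>+z. ennreal (E p z) \<partial>\<nu>) = ennreal (?F p)" for p
    proof -
      let ?c = "?w i0 / (a i0 * b i0) * \<eta> i0 (h p)"
      let ?d = "(\<Sum>i\<in>I. (1 - ?w i / a i) * \<eta> i (h p)) / rest"
      have Eq: "E p = (\<lambda>z. ?c * \<eta> i0 z + ?d * (\<Sum>i\<in>I. (1 - ?w i / b i) * \<eta> i z))"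
        by (rule ext) (simp add: E_def mult.assoc)
      have "integrable \<nu> (E p)" unfolding Eq
        by (intro Bochner_Integration.integrable_add integrable_mult_right sig integrable_eta[OF \<nu> i0])
      moreover have "(\<integral>z. E p z \<partial>\<nu>) = ?c * b i0 + ?d * rest" 
        unfolding Eq Bochner_Integration.integral_add[OF integrable_mult_right[OF integrable_eta[OF \<nu> i0]] integrable_mult_right[OF sig]]
          integral_mult_right_zero sig_int b[OF i0, symmetric] ..
      ultimately show ?thesis using nn_integral_eq_integral[of \<nu> "E p"] E0 by (simp add: mult.commute mult.left_commute)
    qed
    have Fint: "integrable \<gamma> ?F"
      by (intro Bochner_Integration.integrable_add integrable_mult_right rho etah_int i0)
    have F0: "0 \<le> ?F p" for p
      using a_nonneg b_nonneg eta_nonneg coeff_nonneg rest_nonneg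
      by (intro add_nonneg_nonneg sum_nonneg mult_nonneg_nonneg divide_nonneg_nonneg) auto
    have "(\<integral>p. ?F p \<partial>\<gamma>) = ?w i0 / (a i0 * b i0) * b i0 * a i0 + rest / rest * rest"
      unfolding Bochner_Integration.integral_add[OF integrable_mult_right[OF etah_int[OF i0]] integrable_mult_right[OF rho]]
        integral_mult_right_zero rho_int a[OF i0, symmetric] ..
    also have "\<dots> \<le> a i0 + rest"
      using a_nonneg[of i0] b_nonneg[of i0] by (cases "a i0 = 0"; cases "b i0 = 0"; cases "rest = 0") auto
    finally have Fle: "(\<integral>p. ?F p \<partial>\<gamma>) \<le> a i0 + rest" .
    have Em: "(\<lambda>q. ennreal (E (fst q) (snd q))) \<in> borel_measurable (\<gamma> \<Otimes>\<^sub>M \<nu>)"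
    proof (rule Pm)
      have [measurable]: "(\<lambda>q :: 'c \<times> 'b. \<eta> i (h (fst q))) \<in> borel_measurable borel" "(\<lambda>q :: 'c \<times> 'b. \<eta> i (snd q)) \<in> borel_measurable borel" if "i \<in> I" for i
        by (rule measurable_compose[OF measurable_fst_borel etah[OF that]] measurable_compose[OF measurable_snd_borel eta_measurable[OF that]])+
      show "(\<lambda>q :: 'c \<times> 'b. ennreal (E (fst q) (snd q))) \<in> borel_measurable borel"
        unfolding E_def using i0 by measurable
    qed
    have "emeasure \<Theta> ?S = (\<integral>\<^sup>+q. indicator ?S q \<partial>\<Theta>)" using S \<Theta>s by simp
    also have "\<dots> = (\<integral>\<^sup>+q. ennreal (D q) * indicator ?S q \<partial>(\<gamma> \<Otimes>\<^sub>M \<nu>))" using S by (intro int\<Theta>) simp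
    also have "\<dots> \<le> (\<integral>\<^sup>+q. ennreal (E (fst q) (snd q)) \<partial>(\<gamma> \<Otimes>\<^sub>M \<nu>))" by (intro nn_integral_mono le)
    also have "\<dots> = (\<integral>\<^sup>+p. \<integral>\<^sup>+z. ennreal (E p z) \<partial>\<nu> \<partial>\<gamma>)"
      using N.nn_integral_fst[OF Em] by simp
    also have "\<dots> = ennreal (\<integral>p. ?F p \<partial>\<gamma>)"
      unfolding inner using Fint F0 by (intro nn_integral_eq_integral) auto
    also have "\<dots> \<le> ennreal (a i0 + rest)" by (intro ennreal_leI Fle)
    finally show ?thesis .
  qed
  ultimately show thesis using \<Theta> by (intro that) (simp_all add: rest_def)
qed

text \<open>The option type provides the exceptional index: \<open>Some p\<close> are small cells
  around finitely many centres in \<open>K\<close>, and \<open>None\<close> collects what they leave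
  uncovered.\<close>

lemma ex_partition_of_unity:
  fixes K :: "'a::metric_space set"
  assumes K: "compact K" and \<delta>: "0 < \<delta>"
  shows "\<exists>I (\<eta> :: 'a option \<Rightarrow> 'a \<Rightarrow> real). finite I \<and> None \<in> I \<and> (\<forall>i x. 0 \<le> \<eta> i x) \<and> (\<forall>i. continuous_on UNIV (\<eta> i)) \<and>
    (\<forall>x. (\<Sum>i\<in>I. \<eta> i x) = 1) \<and> (\<forall>x\<in>K. \<eta> None x = 0) \<and>
    (\<forall>i\<in>I. \<forall>y z. i \<noteq> None \<longrightarrow> \<delta> \<le> dist y z \<longrightarrow> \<eta> i y * \<eta> i z = 0)"
proof -
  \<comment> \<open>Bumps have radius \<open>2 * e\<close>, so two points at which the same bump is
    positive are closer than \<open>4 * e = \<delta>\<close>.\<close>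
  define e where "e = \<delta> / 4"
  have e: "0 < e" using \<delta> by (simp add: e_def)
  obtain F where F: "F \<subseteq> K" "finite F" "K \<subseteq> (\<Union>p\<in>F. ball p e)"
    by (rule compactE_image[OF K, of K "\<lambda>p. ball p e"]) (use e in auto)
  define \<phi> where "\<phi> p x = max 0 (2 * e - dist x p)" for p x :: 'a
  define s where "s x = (\<Sum>p\<in>F. \<phi> p x)" for x
  \<comment> \<open>Bounding the denominator below by \<open>e\<close> keeps it positive everywhere.
    On \<open>K\<close> the sum \<open>s\<close> is at least \<open>e\<close>, so there the bumps
    alone sum to 1.\<close>
  define D where "D x = max (s x) e" for x
  define \<eta> where "\<eta> i x = (case i of None \<Rightarrow> 1 - s x / D x | Some p \<Rightarrow> \<phi> p x / D x)" for i x
  have phi0: "0 \<le> \<phi> p x" for p x by (simp add: \<phi>_def)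
  have s0: "0 \<le> s x" for x unfolding s_def by (intro sum_nonneg phi0)
  have D0: "0 < D x" for x using e by (simp add: D_def less_max_iff_disj)
  have sD: "s x \<le> D x" for x by (simp add: D_def)
  have n: "0 \<le> \<eta> i x" for i x
    using phi0 D0[of x] sD[of x] by (cases i) (auto simp: \<eta>_def divide_le_eq_1)
  have cphi: "continuous_on UNIV (\<phi> p)" for p unfolding \<phi>_def by (intro continuous_intros)
  have cs: "continuous_on UNIV s" unfolding s_def by (intro continuous_on_sum cphi)
  have cD: "continuous_on UNIV D" unfolding D_def by (intro continuous_on_max cs continuous_on_const)
  have D': "\<forall>x\<in>UNIV. D x \<noteq> 0" using D0 by (auto simp: less_le)
  have c: "continuous_on UNIV (\<eta> i)" for i
  proof (cases i)
    case None
    then have "\<eta> i = (\<lambda>x. 1 - s x / D x)" by (intro ext) (simp add: \<eta>_def)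
    then show ?thesis using D' by (auto intro!: continuous_on_diff continuous_on_divide cs cD continuous_on_const)
  next
    case (Some p)
    then have "\<eta> i = (\<lambda>x. \<phi> p x / D x)" by (intro ext) (simp add: \<eta>_def)
    then show ?thesis using D' by (auto intro!: continuous_on_divide cphi cD)
  qed
  have su: "(\<Sum>i\<in>insert None (Some ` F). \<eta> i x) = 1" for x
  proof -
    have "(\<Sum>i\<in>insert None (Some ` F). \<eta> i x) = \<eta> None x + (\<Sum>i\<in>Some ` F. \<eta> i x)"
      using F(2) by (subst sum.insert) auto
    also have "(\<Sum>i\<in>Some ` F. \<eta> i x) = (\<Sum>p\<in>F. \<phi> p x / D x)"
      by (subst sum.reindex) (auto simp: \<eta>_def)
    also have "\<dots> = s x / D x" by (simp add: s_def sum_divide_distrib)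
    finally show ?thesis by (simp add: \<eta>_def)
  qed
  have z: "\<eta> None x = 0" if "x \<in> K" for x
  proof -
    obtain p where p: "p \<in> F" "dist p x < e" using F(3) \<open>x \<in> K\<close> by auto
    have "\<phi> p x \<le> s x" unfolding s_def by (intro member_le_sum p F phi0)
    moreover have "e \<le> \<phi> p x" using p(2) by (simp add: \<phi>_def dist_commute)
    ultimately have "D x = s x" by (simp add: D_def)
    then show ?thesis using D0[of x] by (simp add: \<eta>_def)
  qed
  have f: "\<eta> i y * \<eta> i z = 0" if "i \<noteq> None" "\<delta> \<le> dist y z" for i y z
  proof -
    obtain p where i: "i = Some p" using \<open>i \<noteq> None\<close> by auto
    have "2 * e \<le> dist y p \<or> 2 * e \<le> dist z p"
      using \<open>\<delta> \<le> dist y z\<close> dist_triangle2[of y z p] by (simp add: e_def) linarith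
    then show ?thesis by (auto simp: i \<eta>_def \<phi>_def)
  qed
  show ?thesis
    by (intro exI[of _ "insert None (Some ` F)"] exI[of _ \<eta>] conjI allI ballI impI n c su z f) (use F in auto)
qed

text \<open>The masses of the finitely many cells converge, so the unmatched mass is eventually
  below \<open>\<delta> / 2\<close>; the exceptional cell lives off \<open>K\<close> and accounts
  for the other half.\<close>

lemma weakly_converges_gluing:
  fixes \<gamma> :: "'c::{metric_space,second_countable_topology} measure"
    and h :: "'c \<Rightarrow> 'a::{metric_space,second_countable_topology}"
  assumes \<gamma>: "\<gamma> \<in> borel_probs" and h: "continuous_on UNIV h"
    and \<nu>: "\<And>n. \<nu> n \<in> borel_probs" and w: "weakly_converges \<nu> (distr \<gamma> borel h)"
    and \<delta>: "0 < \<delta>" and K: "compact K" "measure (distr \<gamma> borel h) (- K) \<le> \<delta> / 2"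
  shows "\<forall>\<^sub>F n in sequentially. \<exists>\<Theta> :: ('c \<times> 'a) measure. \<Theta> \<in> borel_probs \<and> distr \<Theta> borel fst = \<gamma> \<and>
    distr \<Theta> borel snd = \<nu> n \<and> emeasure \<Theta> {q. \<delta> \<le> dist (h (fst q)) (snd q)} \<le> ennreal \<delta>"
proof -
  from ex_partition_of_unity[OF K(1) \<delta>] obtain I and \<eta> :: "'a option \<Rightarrow> 'a \<Rightarrow> real" where
    I: "finite I" "None \<in> I" and "\<forall>i x. 0 \<le> \<eta> i x" "\<forall>i. continuous_on UNIV (\<eta> i)"
    "\<forall>x. (\<Sum>i\<in>I. \<eta> i x) = 1" "\<forall>x\<in>K. \<eta> None x = 0"
    "\<forall>i\<in>I. \<forall>y z. i \<noteq> None \<longrightarrow> \<delta> \<le> dist y z \<longrightarrow> \<eta> i y * \<eta> i z = 0"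
    by (elim exE conjE)
  note n = this(3)[rule_format] and c = this(4)[rule_format] and su = this(5)[rule_format]
    and z = this(6)[rule_format] and far = this(7)[rule_format]
  have n1: "\<eta> i x \<le> 1" if "i \<in> I" for i x
    using member_le_sum[OF that _ I(1), of "\<lambda>i. \<eta> i x"] n su[of x] by simp
  have n2: "\<bar>\<eta> i x\<bar> \<le> 1" if "i \<in> I" for i x
    using n n1[OF that] by (simp add: abs_of_nonneg)
  have cm: "\<eta> i \<in> borel_measurable borel" for i by (rule borel_measurable_continuous_onI[OF c])
  have hm: "h \<in> \<gamma> \<rightarrow>\<^sub>M borel" by (rule continuous_measurable_borel_probs[OF \<gamma> h])
  have \<nu>0: "distr \<gamma> borel h \<in> borel_probs" by (rule borel_probs_distr[OF \<gamma> h])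
  define a where "a i = (\<integral>p. \<eta> i (h p) \<partial>\<gamma>)" for i
  define b where "b n i = (\<integral>x. \<eta> i x \<partial>\<nu> n)" for n i
  have a': "a i = (\<integral>x. \<eta> i x \<partial>distr \<gamma> borel h)" for i
    unfolding a_def by (rule integral_distr[OF hm cm, symmetric])
  have int: "integrable \<rho> (\<eta> i)" if "\<rho> \<in> borel_probs" "i \<in> I" for \<rho> i
    by (rule integrable_borel_probs[where B=1, OF that(1) cm n2[OF that(2)]])
  have sum1: "(\<Sum>i\<in>I. \<integral>x. \<eta> i x \<partial>\<rho>) = 1" if r: "\<rho> \<in> borel_probs" for \<rho>
  proof -
    interpret prob_space \<rho> using borel_probsD[OF r] by simp
    have "(\<Sum>i\<in>I. \<integral>x. \<eta> i x \<partial>\<rho>) = (\<integral>x. (\<Sum>i\<in>I. \<eta> i x) \<partial>\<rho>)"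
      by (rule Bochner_Integration.integral_sum[symmetric]) (rule int[OF r])
    then show ?thesis by (simp add: su prob_space)
  qed
  have pm: "partition_masses I \<eta> a (b n)" for n
    using I n su cm sum1[OF \<nu>0] sum1[OF \<nu>]
    by unfold_locales (auto simp: a'[symmetric] b_def intro!: integral_nonneg simp: a_def)
  have b_lim: "(\<lambda>n. b n i) \<longlonglongrightarrow> a i" if "i \<in> I" for i
  proof -
    have "bounded (range (\<eta> i))" unfolding bounded_iff using n2[OF that] by auto
    then show ?thesis using w c[of i] by (simp add: weakly_converges_def b_def a')
  qed
  have "(\<lambda>n. 1 - (\<Sum>i\<in>I. min (a i) (b n i))) \<longlonglongrightarrow> 1 - (\<Sum>i\<in>I. min (a i) (a i))"
    by (intro tendsto_diff tendsto_const tendsto_sum tendsto_min b_lim)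
  then have "(\<lambda>n. 1 - (\<Sum>i\<in>I. min (a i) (b n i))) \<longlonglongrightarrow> 0" using sum1[OF \<nu>0] by (simp add: a')
  then have ev: "\<forall>\<^sub>F n in sequentially. 1 - (\<Sum>i\<in>I. min (a i) (b n i)) < \<delta> / 2"
    by (rule order_tendstoD) (use \<delta> in simp)
  have aN: "a None \<le> \<delta> / 2"
  proof -
    interpret prob_space "distr \<gamma> borel h" using borel_probsD[OF \<nu>0] by simp
    have "a None \<le> (\<integral>x. indicator (- K) x \<partial>distr \<gamma> borel h)"
      unfolding a'
    proof (rule integral_mono[OF int[OF \<nu>0 I(2)]])
      show "integrable (distr \<gamma> borel h) (indicator (- K) :: 'a \<Rightarrow> real)"
        using compact_imp_closed[OF K(1)]
        by (intro integrable_borel_probs[where B=1, OF \<nu>0] borel_measurable_indicator) (auto simp: indicator_def)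
      show "\<eta> None x \<le> indicator (- K) x" for x
        using z[of x] n1[OF I(2), of x] by (auto simp: indicator_def)
    qed
    also have "\<dots> = measure (distr \<gamma> borel h) (- K)"
      using compact_imp_closed[OF K(1)] by simp
    finally show ?thesis using K(2) by simp
  qed
  from ev show ?thesis
  proof eventually_elim
    case (elim m)
    obtain \<Theta> :: "('c \<times> 'a) measure" where \<Theta>: "\<Theta> \<in> borel_probs" "distr \<Theta> borel fst = \<gamma>" "distr \<Theta> borel snd = \<nu> m"
      "emeasure \<Theta> {q. \<delta> \<le> dist (h (fst q)) (snd q)} \<le> ennreal (a None + (1 - (\<Sum>i\<in>I. min (a i) (b m i))))"
      by (rule partition_gluing[OF pm[of m] \<gamma> \<nu>[of m] borel_measurable_continuous_onI[OF h] a_def b_def I(2) far])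
    have "ennreal (a None + (1 - (\<Sum>i\<in>I. min (a i) (b m i)))) \<le> ennreal \<delta>"
      using elim aN by (intro ennreal_leI) simp
    with \<Theta> show ?case by (intro exI[of _ \<Theta>]) auto
  qed
qed

section \<open>Upper semicontinuity of the transport cost\<close>

context proper_function
begin

lemma ex_compact_small_complement:
  fixes \<nu> :: "'a measure"
  assumes \<nu>: "\<nu> \<in> borel_probs" and e: "0 < e"
  shows "\<exists>K. compact K \<and> measure \<nu> (- K) \<le> e"
proof -
  interpret prob_space \<nu> using borel_probsD[OF \<nu>] by simp
  have gm: "g \<in> borel_measurable borel" by (rule g_measurable)
  have S: "{x. g x \<le> real n} \<in> sets \<nu>" for n using gm borel_probsD(2)[OF \<nu>] by simp
  have "incseq (\<lambda>n. {x. g x \<le> real n})" by (auto simp: incseq_def)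
  then have "(\<lambda>n. prob {x. g x \<le> real n}) \<longlonglongrightarrow> prob (\<Union>n. {x. g x \<le> real n})"
    using S by (intro finite_Lim_measure_incseq) auto
  also have "(\<Union>n. {x. g x \<le> real n}) = space \<nu>" using borel_probsD(3)[OF \<nu>] by (auto intro: real_arch_simple)
  finally have "(\<lambda>n. prob {x. g x \<le> real n}) \<longlonglongrightarrow> 1" by (simp add: prob_space)
  then have "\<forall>\<^sub>F n in sequentially. 1 - e < prob {x. g x \<le> real n}" by (rule order_tendstoD) (use e in simp)
  then obtain n where "1 - e < prob {x. g x \<le> real n}" unfolding eventually_sequentially by auto
  then have "prob (- {x. g x \<le> real n}) \<le> e"
    using prob_compl[OF S[of n]] borel_probsD(3)[OF \<nu>] by (simp add: Compl_eq_Diff_UNIV)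
  then show ?thesis using g_proper by blast
qed

text \<open>Weak convergence bounds costs only from below; convergence of the moments supplies the
  rest. A good plan for \<open>\<nu>'\<close> is glued to \<open>\<nu> n\<close>, which yields plans
  converging weakly to it. Their costs are bounded above because the slack
  \<open>A + B * (g x + g y) - k x y\<close> is lower semicontinuous and its sum with the cost is
  fixed by the moments.\<close>

lemma transport_cost_usc:
  assumes \<mu>: "\<mu> \<in> borel_probs" "moment \<mu> < \<infinity>" and \<nu>': "\<nu>' \<in> borel_probs" "moment \<nu>' < \<infinity>"
    and \<nu>: "\<And>n. \<nu> n \<in> borel_probs" and w: "weakly_converges \<nu> \<nu>'" and m: "(\<lambda>n. moment (\<nu> n)) \<longlonglongrightarrow> moment \<nu>'"
    and k: "continuous_on UNIV (\<lambda>p. k (fst p) (snd p))" "\<And>x y. 0 \<le> k x y"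
    and AB: "0 \<le> A" "0 \<le> B" and growth: "\<And>x y. k x y \<le> A + B * (g x + g y)"
    and less: "transport_cost k \<mu> \<nu>' < c"
  shows "\<forall>\<^sub>F n in sequentially. transport_cost k \<mu> (\<nu> n) < c"
proof (rule ccontr)
  assume "\<not> ?thesis"
  then obtain s where s: "strict_mono (s :: nat \<Rightarrow> nat)" and bad: "\<And>n. \<not> transport_cost k \<mu> (\<nu> (s n)) < c"
    using not_eventually_sequentiallyD[of "\<lambda>n. transport_cost k \<mu> (\<nu> n) < c"] by auto
  obtain \<gamma> where \<gamma>c: "\<gamma> \<in> couplings borel \<mu> \<nu>'" and I: "plan_cost k \<gamma> < c"
    using transport_cost_less_obtain[OF less] .
  note \<gamma> = coupling_borel_prob[OF \<mu>(1) \<nu>'(1) \<gamma>c]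
  have f: "continuous_on UNIV (fst :: 'a \<times> 'a \<Rightarrow> 'a)" and sn: "continuous_on UNIV (snd :: 'a \<times> 'a \<Rightarrow> 'a)"
    by (intro continuous_on_fst continuous_on_snd continuous_on_id)+
  have \<gamma>2: "distr \<gamma> borel snd = \<nu>'" by (rule distr_coupling_snd[OF \<mu>(1) \<nu>'(1) \<gamma>c])
  obtain mn where mn: "moment \<nu>' = ennreal mn" "0 \<le> mn" using \<nu>'(2) by (cases "moment \<nu>'") auto
  obtain mm where mm: "moment \<mu> = ennreal mm" "0 \<le> mm" using \<mu>(2) by (cases "moment \<mu>") auto
  have ws: "weakly_converges (\<lambda>n. \<nu> (s n)) \<nu>'" using weakly_converges_subseq[OF w s] by (simp add: o_def)
  have ms: "(\<lambda>n. moment (\<nu> (s n))) \<longlonglongrightarrow> moment \<nu>'" using LIMSEQ_subseq_LIMSEQ[OF m s] by (simp add: o_def)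
  have "moment \<nu>' < ennreal (mn + 1)" using mn by (simp add: ennreal_less_iff del: ennreal_plus)
  then have evm: "\<forall>\<^sub>F n in sequentially. moment (\<nu> (s n)) < ennreal (mn + 1)" by (rule order_tendstoD[OF ms])
  \<comment> \<open>\<open>Q\<close> bundles all that is needed at tolerance
    \<open>1 / (j + 1)\<close>, so that one choice yields a diagonal sequence;
    \<open>j \<le> n\<close> makes its indices tend to infinity, perhaps not monotonically.\<close>
  define Q where "Q j n \<Theta> \<longleftrightarrow> j \<le> n \<and> moment (\<nu> (s n)) < ennreal (mn + 1) \<and> \<Theta> \<in> borel_probs \<and>
    distr \<Theta> borel fst = \<gamma> \<and> distr \<Theta> borel snd = \<nu> (s n) \<and>
    emeasure \<Theta> {q. inverse (real (Suc j)) \<le> dist (snd (fst q)) (snd q)} \<le> ennreal (inverse (real (Suc j)))"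
    for j n and \<Theta> :: "(('a \<times> 'a) \<times> 'a) measure"
  have "\<exists>n \<Theta>. Q j n \<Theta>" for j
  proof -
    obtain K where K: "compact K" "measure \<nu>' (- K) \<le> inverse (real (Suc j)) / 2"
      using ex_compact_small_complement[OF \<nu>'(1), of "inverse (real (Suc j)) / 2"] by auto
    have "\<forall>\<^sub>F n in sequentially. \<exists>\<Theta> :: (('a \<times> 'a) \<times> 'a) measure. \<Theta> \<in> borel_probs \<and> distr \<Theta> borel fst = \<gamma> \<and>
      distr \<Theta> borel snd = \<nu> (s n) \<and>
      emeasure \<Theta> {q. inverse (real (Suc j)) \<le> dist (snd (fst q)) (snd q)} \<le> ennreal (inverse (real (Suc j)))"
      using ws K by (intro weakly_converges_gluing[OF \<gamma> sn \<nu>, where K=K]) (simp_all add: \<gamma>2)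
    with evm eventually_ge_at_top[of j]
    have "\<forall>\<^sub>F n in sequentially. \<exists>\<Theta>. Q j n \<Theta>"
      by eventually_elim (auto simp: Q_def)
    then show ?thesis unfolding eventually_sequentially by blast
  qed
  then have "\<forall>j. \<exists>n \<Theta>. Q j n \<Theta>" ..
  from choice[OF this] obtain t where "\<forall>j. \<exists>\<Theta>. Q j (t j) \<Theta>" ..
  from choice[OF this] obtain \<Theta> where Q: "\<forall>j. Q j (t j) (\<Theta> j)" ..
  have t: "j \<le> t j" and tm: "moment (\<nu> (s (t j))) < ennreal (mn + 1)"
    and \<Theta>: "\<Theta> j \<in> borel_probs" "distr (\<Theta> j) borel fst = \<gamma>" "distr (\<Theta> j) borel snd = \<nu> (s (t j))"
    and far: "emeasure (\<Theta> j) {q. inverse (real (Suc j)) \<le> dist (snd (fst q)) (snd q)} \<le> ennreal (inverse (real (Suc j)))"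
    for j
    using Q[rule_format, of j] by (simp_all only: Q_def)
  have tt: "filterlim t at_top sequentially"
    by (rule filterlim_at_top_mono[OF filterlim_ident]) (simp add: t)
  have mt: "(\<lambda>j. moment (\<nu> (s (t j)))) \<longlonglongrightarrow> moment \<nu>'" by (rule filterlim_compose[OF ms tt])
  \<comment> \<open>\<open>\<Theta> j\<close> lives on an old pair and a new point. This map
    discards the old second coordinate, which is mostly close to the new point.\<close>
  let ?h = "\<lambda>q :: ('a \<times> 'a) \<times> 'a. (fst (fst q), snd q)"
  have hc: "continuous_on UNIV ?h"
    by (intro continuous_on_Pair continuous_on_fst continuous_on_snd continuous_on_id)
  have f3: "continuous_on UNIV (fst :: ('a \<times> 'a) \<times> 'a \<Rightarrow> 'a \<times> 'a)"
    by (intro continuous_on_fst continuous_on_id)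
  define \<gamma>' where "\<gamma>' j = distr (\<Theta> j) borel ?h" for j
  have \<gamma>'p: "\<gamma>' j \<in> borel_probs" for j unfolding \<gamma>'_def by (rule borel_probs_distr[OF \<Theta>(1) hc])
  have hm: "?h \<in> \<Theta> j \<rightarrow>\<^sub>M borel" for j by (rule continuous_measurable_borel_probs[OF \<Theta>(1) hc])
  have fm: "fst \<in> \<Theta> j \<rightarrow>\<^sub>M borel" for j by (rule continuous_measurable_borel_probs[OF \<Theta>(1) f3])
  have "distr (\<gamma>' j) borel fst = \<mu>" for j
  proof -
    have "distr (\<gamma>' j) borel fst = distr (\<Theta> j) borel (\<lambda>q. fst (fst q))"
      unfolding \<gamma>'_def by (subst distr_distr[OF measurable_fst_borel hm]) (simp add: o_def)
    also have "\<dots> = distr (distr (\<Theta> j) borel fst) borel fst"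
      by (subst distr_distr[OF measurable_fst_borel fm]) (simp add: o_def)
    also have "\<dots> = \<mu>" by (simp add: \<Theta>(2) distr_coupling_fst[OF \<mu>(1) \<nu>'(1) \<gamma>c])
    finally show ?thesis .
  qed
  moreover have "distr (\<gamma>' j) borel snd = \<nu> (s (t j))" for j
    unfolding \<gamma>'_def by (subst distr_distr[OF measurable_snd_borel hm]) (simp add: o_def \<Theta>(3))
  ultimately have \<gamma>'c: "\<gamma>' j \<in> couplings borel \<mu> (\<nu> (s (t j)))" for j
    using couplings_borel_iff[OF \<mu>(1) \<nu>] \<gamma>'p by blast
  have "(\<integral>\<^sup>+p. ennreal (g (fst p) + g (snd p)) \<partial>\<gamma>' j) \<le> ennreal (mm + (mn + 1))" for j
    unfolding nn_integral_pair_moment[OF \<mu>(1) \<nu> \<gamma>'c] mm(1)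
    using mm(2) mn(2) tm[of j] by (subst ennreal_plus) (auto intro: add_mono less_imp_le simp del: ennreal_plus)
  moreover have "(\<lambda>j. \<integral>p. test_function i p \<partial>\<gamma>' j) \<longlonglongrightarrow> (\<integral>p. test_function i p \<partial>\<gamma>)" for i
  proof -
    obtain L where L: "L \<ge> 0" "\<forall>p q :: 'a \<times> 'a. \<bar>test_function i p - test_function i q\<bar> \<le> L * dist p q"
      using test_function_lipschitz by blast
    have tc: "continuous_on UNIV (test_function i :: 'a \<times> 'a \<Rightarrow> real)" by (rule continuous_on_test_function)
    have tb: "test_function i \<in> borel_measurable (borel :: ('a \<times> 'a) measure)" by (rule borel_measurable_continuous_onI[OF tc])
    have "norm ((\<integral>p. test_function i p \<partial>\<gamma>' j) - (\<integral>p. test_function i p \<partial>\<gamma>)) \<le> (L + 1) * inverse (real (Suc j))" for j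
    proof -
      interpret T: prob_space "\<Theta> j" using borel_probsD[OF \<Theta>(1)] by simp
      let ?d = "inverse (real (Suc j))"
      let ?S = "{q :: ('a \<times> 'a) \<times> 'a. ?d \<le> dist (snd (fst q)) (snd q)}"
      have "continuous_on UNIV (\<lambda>q :: ('a \<times> 'a) \<times> 'a. dist (snd (fst q)) (snd q))"
        by (intro continuous_on_dist continuous_on_fst continuous_on_snd continuous_on_id)
      then have "closed ?S" by (intro closed_Collect_le continuous_on_const)
      then have S: "?S \<in> T.events" using borel_probsD(2)[OF \<Theta>(1)] by simp
      have iS: "integrable (\<Theta> j) (indicator ?S :: _ \<Rightarrow> real)"
        using S by (intro integrable_real_indicator) (simp_all add: T.emeasure_eq_measure)
      have i1: "integrable (\<Theta> j) (\<lambda>q. test_function i (?h q))"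
        by (rule integrable_borel_probs[OF \<Theta>(1) _ abs_test_function_le_1])
          (rule measurable_compose[OF borel_measurable_continuous_onI[OF hc] tb])
      have i2: "integrable (\<Theta> j) (\<lambda>q. test_function i (fst q))"
        by (rule integrable_borel_probs[OF \<Theta>(1) _ abs_test_function_le_1])
          (rule measurable_compose[OF measurable_fst_borel tb])
      have "(\<integral>p. test_function i p \<partial>\<gamma>' j) = (\<integral>q. test_function i (?h q) \<partial>\<Theta> j)"
        unfolding \<gamma>'_def by (rule integral_distr[OF hm tb])
      moreover have "(\<integral>p. test_function i p \<partial>\<gamma>) = (\<integral>q. test_function i (fst q) \<partial>\<Theta> j)"
        unfolding \<Theta>(2)[of j, symmetric] by (rule integral_distr[OF fm tb])
      ultimately have "(\<integral>p. test_function i p \<partial>\<gamma>' j) - (\<integral>p. test_function i p \<partial>\<gamma>) =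
        (\<integral>q. test_function i (?h q) - test_function i (fst q) \<partial>\<Theta> j)"
        using i1 i2 by simp
      also have "norm \<dots> \<le> (\<integral>q. norm (test_function i (?h q) - test_function i (fst q)) \<partial>\<Theta> j)"
        by (rule integral_norm_bound)
      \<comment> \<open>Off \<open>?S\<close> the Lipschitz bound gives at most
        \<open>L * ?d\<close>; on \<open>?S\<close> two values in \<open>[0, 1]\<close> differ by at
        most 1, and \<open>?S\<close> has mass at most \<open>?d\<close>.\<close>
      also have "\<dots> \<le> (\<integral>q. L * ?d + indicator ?S q \<partial>\<Theta> j)"
      proof (rule integral_mono)
        show "integrable (\<Theta> j) (\<lambda>q. norm (test_function i (?h q) - test_function i (fst q)))"
          using i1 i2 by simp
        show "integrable (\<Theta> j) (\<lambda>q. L * ?d + indicator ?S q)"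
          by (intro Bochner_Integration.integrable_add T.integrable_const iS)
        show "norm (test_function i (?h q) - test_function i (fst q)) \<le> L * ?d + indicator ?S q" for q
        proof (cases "q \<in> ?S")
          case True
          have "\<bar>test_function i (?h q) - test_function i (fst q)\<bar> \<le> 1"
            using test_function_nonneg[of i "?h q"] test_function_le_1[of i "?h q"]
              test_function_nonneg[of i "fst q"] test_function_le_1[of i "fst q"] by simp
          moreover have "0 \<le> L * ?d" using L(1) by simp
          ultimately show ?thesis using True by simp
        next
          case False
          have "\<bar>test_function i (?h q) - test_function i (fst q)\<bar> \<le> L * dist (?h q) (fst q)" using L(2) by blast
          also have "dist (?h q) (fst q) = dist (snd (fst q)) (snd q)"
            by (cases q) (auto simp: dist_prod_def dist_commute)
          also have "L * dist (snd (fst q)) (snd q) \<le> L * ?d" using False L(1) by (intro mult_left_mono) auto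
          finally show ?thesis using False by simp
        qed
      qed
      also have "\<dots> = L * ?d + T.prob ?S"
        using S by (subst Bochner_Integration.integral_add[OF T.integrable_const iS]) (simp add: T.prob_space)
      also have "T.prob ?S \<le> ?d" using far[of j] by (simp add: T.emeasure_eq_measure)
      finally show ?thesis by (simp add: distrib_right)
    qed
    then have "\<forall>\<^sub>F j in sequentially. norm ((\<integral>p. test_function i p \<partial>\<gamma>' j) - (\<integral>p. test_function i p \<partial>\<gamma>)) \<le> (L + 1) * inverse (real (Suc j))"
      by (intro always_eventually allI)
    then have "(\<lambda>j. (\<integral>p. test_function i p \<partial>\<gamma>' j) - (\<integral>p. test_function i p \<partial>\<gamma>)) \<longlonglongrightarrow> 0"
      by (rule Lim_null_comparison) (rule tendsto_mult_right_zero[OF LIMSEQ_inverse_real_of_nat])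
    then show ?thesis by (rule LIM_zero_cancel)
  qed
  ultimately have w': "weakly_converges \<gamma>' \<gamma>"
    by (intro weakly_convergesI_test_function[where \<nu>=\<gamma>', OF pair_proper \<gamma>'p _ \<gamma>])
  let ?F = "\<lambda>p. A + B * (g (fst p) + g (snd p)) - k (fst p) (snd p)"
  have F: "continuous_on UNIV ?F"
    by (intro continuous_on_add continuous_on_diff continuous_on_mult continuous_on_const continuous_g_fst continuous_g_snd k(1))
  have F0: "0 \<le> ?F p" for p using growth[of "fst p" "snd p"] by simp
  have eq: "(\<integral>\<^sup>+p. ?F p \<partial>\<rho>) + plan_cost k \<rho> = ennreal A + ennreal B * (moment \<mu> + moment \<nu>'')"
    if \<nu>'': "\<nu>'' \<in> borel_probs" and \<rho>: "\<rho> \<in> couplings borel \<mu> \<nu>''" for \<nu>'' \<rho>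
  proof -
    note \<rho>p = coupling_borel_prob[OF \<mu>(1) \<nu>'' \<rho>]
    note [measurable] = g_pair_measurable[OF \<rho>p] borel_measurable_borel_probs[OF \<rho>p borel_measurable_continuous_onI[OF k(1)]]
    have "(\<integral>\<^sup>+p. ?F p \<partial>\<rho>) + plan_cost k \<rho> = (\<integral>\<^sup>+p. ennreal (?F p) + ennreal (k (fst p) (snd p)) \<partial>\<rho>)"
      by (rule nn_integral_add[symmetric]) auto
    also have "\<dots> = (\<integral>\<^sup>+p. ennreal (A + B * (g (fst p) + g (snd p))) \<partial>\<rho>)"
      using F0 k(2) by (intro nn_integral_cong) (simp add: ennreal_plus[symmetric] del: ennreal_plus)
    also have "\<dots> = ennreal A + ennreal B * (moment \<mu> + moment \<nu>'')"
      using nn_integral_coupling_fst[OF \<mu>(1) \<nu>'' \<rho>, of "\<lambda>x. ennreal (g x)"]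
        nn_integral_coupling_snd[OF \<mu>(1) \<nu>'' \<rho>, of "\<lambda>x. ennreal (g x)"] g_measurable
      by (subst nn_integral_affine[OF borel_probsD(1)[OF \<rho>p] AB]) (auto simp: moment_def g_nonneg)
    finally show ?thesis .
  qed
  have "limsup (\<lambda>j. plan_cost k (\<gamma>' j)) \<le> plan_cost k \<gamma>"
  proof (rule limsup_le_of_liminf_add)
    show "(\<integral>\<^sup>+p. ?F p \<partial>\<gamma>' j) + plan_cost k (\<gamma>' j) \<le> ennreal A + ennreal B * (moment \<mu> + moment (\<nu> (s (t j))))" for j
      using eq[OF \<nu> \<gamma>'c] by simp
    show "(\<lambda>j. ennreal A + ennreal B * (moment \<mu> + moment (\<nu> (s (t j))))) \<longlonglongrightarrow> (\<integral>\<^sup>+p. ?F p \<partial>\<gamma>) + plan_cost k \<gamma>"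
      unfolding eq[OF \<nu>'(1) \<gamma>c] by (intro tendsto_add tendsto_const ennreal_tendsto_cmult mt) simp
    show "(\<integral>\<^sup>+p. ?F p \<partial>\<gamma>) \<le> liminf (\<lambda>j. \<integral>\<^sup>+p. ?F p \<partial>\<gamma>' j)"
      by (rule weakly_converges_nn_integral_liminf[OF w' \<gamma>'p \<gamma> F F0])
    have "(\<integral>\<^sup>+p. ?F p \<partial>\<gamma>) + plan_cost k \<gamma> < \<infinity>"
      unfolding eq[OF \<nu>'(1) \<gamma>c] using \<mu>(2) \<nu>'(2) by (simp add: ennreal_mult_less_top)
    then show "(\<integral>\<^sup>+p. ?F p \<partial>\<gamma>) < \<infinity>" "plan_cost k \<gamma> < \<infinity>" by simp_all
  qed
  then have "\<forall>\<^sub>F j in sequentially. plan_cost k (\<gamma>' j) < c"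
    using I unfolding Limsup_le_iff by blast
  then obtain j where "plan_cost k (\<gamma>' j) < c" unfolding eventually_sequentially by auto
  then have "transport_cost k \<mu> (\<nu> (s (t j))) < c"
    using transport_cost_le[OF \<gamma>'c] by (rule le_less_trans[rotated])
  with bad show False by blast
qed

end

section \<open>Measures of finite cost\<close>

lemma return_borel_probs: "return borel a \<in> borel_probs"
  by (intro borel_probsI prob_space_return) simp_all

text \<open>Under every plan the first coordinate is almost surely \<open>a\<close>, so all plans
  have the same cost.\<close>

lemma transport_cost_return:
  fixes \<nu> :: "'a::{metric_space,second_countable_topology} measure"
  assumes \<nu>: "\<nu> \<in> borel_probs" and k: "continuous_on UNIV (\<lambda>p. k (fst p) (snd p))"
  shows "transport_cost k (return borel a) \<nu> = (\<integral>\<^sup>+x. ennreal (k a x) \<partial>\<nu>)"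
proof -
  have "continuous_on UNIV (\<lambda>y. k (fst (a, y)) (snd (a, y)))"
    by (rule continuous_on_compose2[OF k]) (auto intro!: continuous_on_Pair continuous_on_const continuous_on_id)
  then have ka: "(\<lambda>x. ennreal (k a x)) \<in> borel_measurable borel"
    using borel_measurable_continuous_onI[of "k a"] by simp
  have *: "plan_cost k \<gamma> = (\<integral>\<^sup>+x. ennreal (k a x) \<partial>\<nu>)"
    if \<gamma>: "\<gamma> \<in> couplings borel (return borel a) \<nu>" for \<gamma>
  proof -
    note cp = coupling_borel_prob[OF return_borel_probs \<nu> \<gamma>]
    have fm: "fst \<in> \<gamma> \<rightarrow>\<^sub>M borel" by (rule borel_measurable_borel_probs[OF cp]) measurable
    have "AE x in distr \<gamma> borel fst. x = a"
      unfolding distr_coupling_fst[OF return_borel_probs \<nu> \<gamma>] by (subst AE_return) auto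
    then have "AE p in \<gamma>. fst p = a"
      by (subst (asm) AE_distr_iff[OF fm]) auto
    then have "plan_cost k \<gamma> = (\<integral>\<^sup>+p. ennreal (k a (snd p)) \<partial>\<gamma>)"
      by (intro nn_integral_cong_AE) (auto elim: eventually_mono)
    then show ?thesis by (simp add: nn_integral_coupling_snd[OF return_borel_probs \<nu> \<gamma> ka])
  qed
  have "transport_cost k (return borel a) \<nu> = (INF \<gamma>\<in>couplings borel (return borel a) \<nu>. (\<integral>\<^sup>+x. ennreal (k a x) \<partial>\<nu>))"
    unfolding transport_cost_def case_prod_beta by (rule INF_cong[OF refl *])
  also have "\<dots> = (\<integral>\<^sup>+x. ennreal (k a x) \<partial>\<nu>)" using product_coupling[OF return_borel_probs \<nu>] by (intro INF_const) blast
  finally show ?thesis .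
qed

locale transport_space =
  fixes c :: "'a::{metric_space,second_countable_topology} \<Rightarrow> 'a \<Rightarrow> real" and x0 :: 'a and A B :: real
  assumes c_nonneg: "0 \<le> c x y" and c_cont: "continuous_on UNIV (\<lambda>p. c (fst p) (snd p))"
    and c_zero: "c x y = 0 \<longleftrightarrow> x = y" and A: "0 \<le> A" and B: "0 \<le> B"
    and growth1: "c x y \<le> A + B * (c x z + c y z)" and growth2: "c x y \<le> A + B * (c x z + c z y)"
    and growth4: "c x y \<le> A + B * (c z x + c z y)"
    and c_proper: "compact {y. c x0 y \<le> r}"
begin

sublocale proper_function "c x0"
proof
  have "continuous_on UNIV (\<lambda>y. c (fst (x0, y)) (snd (x0, y)))"
    by (rule continuous_on_compose2[OF c_cont]) (auto intro!: continuous_on_Pair continuous_on_const continuous_on_id)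
  then show "continuous_on UNIV (c x0)" by simp
qed (rule c_nonneg, rule c_proper)

abbreviation J :: "'a measure \<Rightarrow> 'a measure \<Rightarrow> ennreal" where "J \<equiv> transport_cost c"

definition E0 :: "'a measure set" where "E0 = {\<nu> \<in> borel_probs. moment \<nu> < \<infinity>}"

lemma E0D: "\<nu> \<in> E0 \<Longrightarrow> \<nu> \<in> borel_probs" "\<nu> \<in> E0 \<Longrightarrow> moment \<nu> < \<infinity>"
  by (auto simp: E0_def)

lemma c_swap_cont: "continuous_on UNIV (\<lambda>p. c (snd p) (fst p))"
  by (rule continuous_cost_swap[OF c_cont])

lemma J_self: "\<nu> \<in> borel_probs \<Longrightarrow> J \<nu> \<nu> = 0"
  by (rule transport_cost_self[OF _ c_cont]) (simp_all add: c_zero)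

lemma J_return: "\<nu> \<in> borel_probs \<Longrightarrow> J (return borel x0) \<nu> = moment \<nu>"
  unfolding moment_def by (rule transport_cost_return[OF _ c_cont])

lemma return_E0: "return borel x0 \<in> E0"
proof -
  have "moment (return borel x0) = 0"
    using J_return[OF return_borel_probs[of x0]] J_self[OF return_borel_probs[of x0]] by simp
  then show ?thesis using return_borel_probs[of x0] by (simp add: E0_def)
qed

lemma moment_le_J1:
  assumes "\<mu> \<in> borel_probs" "\<nu> \<in> borel_probs"
  shows "moment \<nu> \<le> ennreal A + ennreal B * (moment \<mu> + J \<mu> \<nu>)"
  by (rule moment_le_transport_cost[OF assms c_cont c_nonneg A B growth2])

lemma moment_le_J2:
  assumes "\<mu> \<in> borel_probs" "\<nu> \<in> borel_probs"
  shows "moment \<mu> \<le> ennreal A + ennreal B * (moment \<nu> + J \<mu> \<nu>)"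
  using moment_le_transport_cost[OF assms(2,1) c_swap_cont c_nonneg A B growth1]
    transport_cost_swap[OF assms c_cont] by simp

lemma J_le_moments:
  assumes "\<mu> \<in> borel_probs" "\<nu> \<in> borel_probs"
  shows "J \<mu> \<nu> \<le> ennreal A + ennreal B * (moment \<mu> + moment \<nu>)"
  by (rule transport_cost_le_moments[OF assms A B growth4])

lemma J_finite: "\<mu> \<in> E0 \<Longrightarrow> \<nu> \<in> E0 \<Longrightarrow> J \<mu> \<nu> < \<infinity>"
  using J_le_moments[of \<mu> \<nu>] E0D by (auto simp: ennreal_mult_less_top intro: le_less_trans)

lemma J_tendsto_0_right:
  assumes "\<mu> \<in> E0" "\<And>n. \<nu> n \<in> borel_probs" "(\<lambda>n. J \<mu> (\<nu> n)) \<longlonglongrightarrow> 0"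
  shows "weakly_converges \<nu> \<mu>" "(\<lambda>n. moment (\<nu> n)) \<longlonglongrightarrow> moment \<mu>"
  using transport_cost_tendsto_0_imp[OF E0D[OF assms(1)] assms(2) c_cont c_nonneg _ A B growth2 assms(3)] c_zero
  by simp_all

text \<open>\<open>J\<close> need not be symmetric; this is
  \<open>transport_cost_tendsto_0_imp\<close> for the transposed cost.\<close>

lemma J_tendsto_0_left:
  assumes "\<mu> \<in> E0" "\<And>n. \<nu> n \<in> borel_probs" "(\<lambda>n. J (\<nu> n) \<mu>) \<longlonglongrightarrow> 0"
  shows "weakly_converges \<nu> \<mu>" "(\<lambda>n. moment (\<nu> n)) \<longlonglongrightarrow> moment \<mu>"
proof -
  have "(\<lambda>n. transport_cost (\<lambda>x y. c y x) \<mu> (\<nu> n)) \<longlonglongrightarrow> 0"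
    using assms(3) transport_cost_swap[OF assms(2) E0D(1)[OF assms(1)] c_cont] by simp
  from transport_cost_tendsto_0_imp[OF E0D[OF assms(1)] assms(2) c_swap_cont c_nonneg _ A B growth1 this]
  show "weakly_converges \<nu> \<mu>" "(\<lambda>n. moment (\<nu> n)) \<longlonglongrightarrow> moment \<mu>" using c_zero by simp_all
qed

lemma J_usc_right:
  assumes "\<mu> \<in> E0" "\<nu>' \<in> E0" "\<And>n. \<nu> n \<in> borel_probs" "weakly_converges \<nu> \<nu>'" "(\<lambda>n. moment (\<nu> n)) \<longlonglongrightarrow> moment \<nu>'"
    and "J \<mu> \<nu>' < r"
  shows "\<forall>\<^sub>F n in sequentially. J \<mu> (\<nu> n) < r"
  by (rule transport_cost_usc[OF E0D[OF assms(1)] E0D[OF assms(2)] assms(3-5) c_cont c_nonneg A B growth4 assms(6)])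

lemma J_usc_left:
  assumes "\<mu> \<in> E0" "\<nu>' \<in> E0" "\<And>n. \<nu> n \<in> borel_probs" "weakly_converges \<nu> \<nu>'" "(\<lambda>n. moment (\<nu> n)) \<longlonglongrightarrow> moment \<nu>'"
    and "J \<nu>' \<mu> < r"
  shows "\<forall>\<^sub>F n in sequentially. J (\<nu> n) \<mu> < r"
proof -
  note sw = transport_cost_swap[OF _ E0D(1)[OF assms(1)] c_cont]
  have g: "c y x \<le> A + B * (c x0 x + c x0 y)" for x y using growth4[of y x x0] by (simp add: add.commute)
  have "\<forall>\<^sub>F n in sequentially. transport_cost (\<lambda>x y. c y x) \<mu> (\<nu> n) < r"
    by (rule transport_cost_usc[OF E0D[OF assms(1)] E0D[OF assms(2)] assms(3-5) c_swap_cont c_nonneg A B g])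
      (use assms(6) sw[OF E0D(1)[OF assms(2)]] in simp)
  then show ?thesis using sw[OF assms(3)] by simp
qed

lemma topspace_cost_topology: "topspace (cost_topology c) = borel_probs"
proof -
  have "topspace (cost_topology c) = \<Union>{{\<nu> \<in> borel_probs. J \<mu> \<nu> < ennreal r} |\<mu> r. \<mu> \<in> borel_probs \<and> 0 < r}"
    unfolding cost_topology_def by (rule topology_generated_by_topspace)
  also have "\<dots> = borel_probs"
  proof (intro equalityI subsetI)
    fix \<nu> :: "'a measure" assume \<nu>: "\<nu> \<in> borel_probs"
    then have "\<nu> \<in> {\<nu>' \<in> borel_probs. J \<nu> \<nu>' < ennreal 1}" by (simp add: J_self)
    then show "\<nu> \<in> \<Union>{{\<nu> \<in> borel_probs. J \<mu> \<nu> < ennreal r} |\<mu> r. \<mu> \<in> borel_probs \<and> 0 < r}"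
      using \<nu> zero_less_one by blast
  qed auto
  finally show ?thesis .
qed

lemma openin_J_ball:
  assumes "\<mu> \<in> borel_probs" "0 < r"
  shows "openin (cost_topology c) {\<nu> \<in> borel_probs. J \<mu> \<nu> < ennreal r}"
  unfolding cost_topology_def openin_topology_generated_by_iff
  by (rule generate_topology_on.Basis) (use assms in blast)

section \<open>The cost topology on \<open>E0\<close> and its Borel sets\<close>

abbreviation T0 :: "'a measure topology" where "T0 \<equiv> finite_cost_topology c x0"

lemma T0_eq: "T0 = subtopology (cost_topology c) E0"
proof -
  have "{\<nu> \<in> borel_probs. J (return borel x0) \<nu> < \<infinity>} = E0" using J_return by (auto simp: E0_def)
  then show ?thesis by (simp add: finite_cost_topology_def)
qed

lemma topspace_T0: "topspace T0 = E0"
  unfolding T0_eq topspace_subtopology topspace_cost_topology by (auto simp: E0_def)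

lemma space_borel_of: "space (borel_of T) = topspace T"
  by (simp add: borel_of_def space_measure_of_conv)

lemma sets_borel_of: "openin T U \<Longrightarrow> U \<in> sets (borel_of T)"
  unfolding borel_of_def by (subst sets_measure_of) (auto dest: openin_subset)

text \<open>The set is a union of balls about \<open>\<mu>\<close>, over all radii whose affine
  image stays below \<open>r\<close>; \<open>a < \<infinity>\<close> keeps inequalities strict under
  addition. Measurability of envelopes, costs and moments rests on this.\<close>

lemma openin_T0_affine_J:
  assumes \<mu>: "\<mu> \<in> E0" and t: "0 < t"
  shows "openin T0 {\<mu>' \<in> E0. a + ennreal t * J \<mu> \<mu>' < r}"
proof -
  let ?U = "\<lambda>q. {\<mu>' \<in> borel_probs. J \<mu> \<mu>' < ennreal q} \<inter> E0"
  have eq: "{\<mu>' \<in> E0. a + ennreal t * J \<mu> \<mu>' < r} = \<Union>(?U ` {q. 0 < q \<and> a < \<infinity> \<and> a + ennreal t * ennreal q \<le> r})"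
  proof (intro equalityI subsetI)
    fix \<mu>' assume m: "\<mu>' \<in> {\<mu>' \<in> E0. a + ennreal t * J \<mu> \<mu>' < r}"
    then obtain x where x: "J \<mu> \<mu>' = ennreal x" "0 \<le> x" using J_finite[OF \<mu>, of \<mu>'] by (cases "J \<mu> \<mu>'") auto
    have "a < \<infinity>" using m by (cases a) auto
    then obtain a' where a': "a = ennreal a'" "0 \<le> a'" by (cases a) auto
    have "\<exists>q. x < q \<and> a + ennreal t * ennreal q \<le> r"
    proof (cases r)
      case (real r')
      have "a' + t * x < r'" using m x a' t real
        by (simp add: ennreal_mult[symmetric] ennreal_plus[symmetric] ennreal_less_iff del: ennreal_plus)
      \<comment> \<open>The largest radius \<open>q\<close> with \<open>a + t * q \<le> r\<close>
        strictly exceeds the cost \<open>x\<close>.\<close>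
      then have "x < (r' - a') / t" using t by (simp add: field_simps)
      moreover have "a + ennreal t * ennreal ((r' - a') / t) \<le> r"
      proof -
        have "0 \<le> x * t" using x t by simp
        then have p: "0 \<le> r' - a'" using \<open>x < (r' - a') / t\<close> t by (simp add: field_simps)
        have "ennreal t * ennreal ((r' - a') / t) = ennreal (r' - a')" using t p by (simp add: ennreal_mult[symmetric])
        moreover have "ennreal a' + ennreal (r' - a') = ennreal r'" using a' p by (subst ennreal_plus[symmetric]) auto
        ultimately show ?thesis using real a' by simp
      qed
      ultimately show ?thesis by blast
    qed (auto intro: exI[of _ "x + 1"])
    then obtain q where "x < q" "a + ennreal t * ennreal q \<le> r" by blast
    then show "\<mu>' \<in> \<Union>(?U ` {q. 0 < q \<and> a < \<infinity> \<and> a + ennreal t * ennreal q \<le> r})"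
      using m x \<open>a < \<infinity>\<close> E0D(1)[of \<mu>'] by (auto simp: ennreal_less_iff intro!: bexI[of _ q] exI[of _ q])
  next
    fix \<mu>' assume "\<mu>' \<in> \<Union>(?U ` {q. 0 < q \<and> a < \<infinity> \<and> a + ennreal t * ennreal q \<le> r})"
    then obtain q where q: "0 < q" "a < \<infinity>" "a + ennreal t * ennreal q \<le> r" "J \<mu> \<mu>' < ennreal q" "\<mu>' \<in> E0" by auto
    have "ennreal t * J \<mu> \<mu>' < ennreal t * ennreal q"
      using q(4) t by (intro ennreal_mult_strict_left_mono) auto
    then have "a + ennreal t * J \<mu> \<mu>' < a + ennreal t * ennreal q" using q(2)
      by (intro ennreal_add_left_cancel_less[THEN iffD2]) simp
    from less_le_trans[OF this q(3)] show "\<mu>' \<in> {\<mu>' \<in> E0. a + ennreal t * J \<mu> \<mu>' < r}" using q(5) by simp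
  qed
  have U: "openin T0 (?U q)" if "0 < q" for q
    unfolding T0_eq openin_subtopology using openin_J_ball[OF E0D(1)[OF \<mu>] that] by blast
  show ?thesis unfolding eq by (rule openin_Union) (use U in fast)
qed

text \<open>An inf-convolution (Pasch-Hausdorff envelope) in the first argument, with
  \<open>J\<close> in place of a metric. Its strict sublevel sets are open as unions over
  \<open>\<mu>\<close>, whatever the regularity of \<open>transport_cost k \<mu> \<nu>\<close> in
  \<open>\<mu>\<close>.\<close>

definition envelope :: "('a \<Rightarrow> 'a \<Rightarrow> real) \<Rightarrow> real \<Rightarrow> 'a measure \<Rightarrow> 'a measure \<Rightarrow> ennreal" where
  "envelope k t \<nu> \<mu>' = (INF \<mu>\<in>E0. transport_cost k \<mu> \<nu> + ennreal t * J \<mu> \<mu>')"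

lemma measurable_envelope:
  assumes "0 < t"
  shows "envelope k t \<nu> \<in> borel_measurable (borel_of T0)"
proof (rule borel_measurableI_less)
  fix r
  have "{\<mu>' \<in> space (borel_of T0). envelope k t \<nu> \<mu>' < r} =
      (\<Union>\<mu>\<in>E0. {\<mu>' \<in> E0. transport_cost k \<mu> \<nu> + ennreal t * J \<mu> \<mu>' < r})"
    unfolding space_borel_of topspace_T0 envelope_def INF_less_iff by auto
  also have "openin T0 \<dots>" by (intro openin_Union) (auto intro: openin_T0_affine_J[OF _ assms])
  finally show "{\<mu>' \<in> space (borel_of T0). envelope k t \<nu> \<mu>' < r} \<in> sets (borel_of T0)"
    by (rule sets_borel_of)
qed

lemma envelope_le_cost:
  assumes "\<mu>' \<in> E0"
  shows "envelope k t \<nu> \<mu>' \<le> transport_cost k \<mu>' \<nu>"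
proof -
  have "envelope k t \<nu> \<mu>' \<le> transport_cost k \<mu>' \<nu> + ennreal t * J \<mu>' \<mu>'"
    unfolding envelope_def by (rule INF_lower[OF assms])
  then show ?thesis by (simp add: J_self[OF E0D(1)[OF assms]])
qed

text \<open>If the envelopes stay bounded while the weights grow, near-minimisers
  \<open>\<mu> n\<close> satisfy \<open>J (\<mu> n) \<mu>' \<longlonglongrightarrow> 0\<close>. They
  then converge to \<open>\<mu>'\<close> weakly with bounded moments, and
  \<open>transport_cost_liminf\<close> applies in both arguments at once.\<close>

lemma cost_le_liminf_envelope:
  assumes \<nu>: "\<And>n. \<nu> n \<in> borel_probs" "\<nu>' \<in> borel_probs" and w: "weakly_converges \<nu> \<nu>'"
    and bd: "\<And>n. moment (\<nu> n) \<le> ennreal M"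
    and k: "continuous_on UNIV (\<lambda>p. k (fst p) (snd p))" "\<And>x y. 0 \<le> k x y"
    and t: "filterlim t at_top sequentially" and \<mu>': "\<mu>' \<in> E0"
  shows "transport_cost k \<mu>' \<nu>' \<le> liminf (\<lambda>n. envelope k (t n) (\<nu> n) \<mu>')"
proof (cases "liminf (\<lambda>n. envelope k (t n) (\<nu> n) \<mu>') = \<infinity>")
  case False
  let ?L = "liminf (\<lambda>n. envelope k (t n) (\<nu> n) \<mu>')"
  obtain l where l: "?L = ennreal l" "0 \<le> l" using False by (cases ?L) auto
  obtain s where s: "strict_mono (s :: nat \<Rightarrow> nat)" "((\<lambda>n. envelope k (t n) (\<nu> n) \<mu>') \<circ> s) \<longlonglongrightarrow> ?L"
    using liminf_subseq_lim by blast
  have sl: "(\<lambda>n. envelope k (t (s n)) (\<nu> (s n)) \<mu>') \<longlonglongrightarrow> ?L" using s(2) by (simp add: o_def)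
  have ts: "filterlim (\<lambda>n. t (s n)) at_top sequentially"
    by (rule filterlim_compose[OF t filterlim_subseq[OF s(1)]])
  have "\<forall>\<^sub>F n in sequentially. envelope k (t (s n)) (\<nu> (s n)) \<mu>' < ennreal (l + 1)"
    by (rule order_tendstoD(2)[OF sl]) (use l in \<open>simp add: ennreal_less_iff del: ennreal_plus\<close>)
  moreover have "\<forall>\<^sub>F n in sequentially. 1 \<le> t (s n)" using ts by (simp add: filterlim_at_top)
  ultimately have "\<forall>\<^sub>F n in sequentially. envelope k (t (s n)) (\<nu> (s n)) \<mu>' < ennreal (l + 1) \<and> 1 \<le> t (s n)"
    by eventually_elim simp
  then obtain N where N: "\<And>n. N \<le> n \<Longrightarrow> envelope k (t (s n)) (\<nu> (s n)) \<mu>' < ennreal (l + 1) \<and> 1 \<le> t (s n)"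
    unfolding eventually_sequentially by auto
  \<comment> \<open>\<open>u\<close> drops the part of the subsequence where the envelope or the
    weight is not yet under control.\<close>
  define u where "u n = s (n + N)" for n
  have env: "envelope k (t (u n)) (\<nu> (u n)) \<mu>' < ennreal (l + 1)" and t1: "1 \<le> t (u n)" for n
    using N[of "n + N"] by (auto simp: u_def)
  have ul: "(\<lambda>n. envelope k (t (u n)) (\<nu> (u n)) \<mu>') \<longlonglongrightarrow> ?L"
    unfolding u_def using LIMSEQ_ignore_initial_segment[OF sl] .
  have us: "strict_mono u" using s(1) by (simp add: u_def strict_mono_def)
  have tu: "filterlim (\<lambda>n. t (u n)) at_top sequentially"
    by (rule filterlim_compose[OF t filterlim_subseq[OF us]])
  let ?d = "\<lambda>n. ennreal (inverse (real (Suc n)))"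
  have "\<exists>\<mu>. \<mu> \<in> E0 \<and> transport_cost k \<mu> (\<nu> (u n)) + ennreal (t (u n)) * J \<mu> \<mu>' <
    envelope k (t (u n)) (\<nu> (u n)) \<mu>' + ?d n" for n
  proof -
    have "envelope k (t (u n)) (\<nu> (u n)) \<mu>' < envelope k (t (u n)) (\<nu> (u n)) \<mu>' + ?d n"
      using env[of n] by (cases "envelope k (t (u n)) (\<nu> (u n)) \<mu>'")
        (auto simp: ennreal_plus[symmetric] ennreal_less_iff simp del: ennreal_plus)
    then show ?thesis unfolding envelope_def[of k "t (u n)" "\<nu> (u n)" \<mu>'] INF_less_iff by blast
  qed
  then have "\<forall>n. \<exists>\<mu>. \<mu> \<in> E0 \<and> transport_cost k \<mu> (\<nu> (u n)) + ennreal (t (u n)) * J \<mu> \<mu>' <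
    envelope k (t (u n)) (\<nu> (u n)) \<mu>' + ?d n" ..
  from choice[OF this] obtain \<mu> where \<mu>: "\<And>n. \<mu> n \<in> E0"
    and le: "\<And>n. transport_cost k (\<mu> n) (\<nu> (u n)) + ennreal (t (u n)) * J (\<mu> n) \<mu>' <
      envelope k (t (u n)) (\<nu> (u n)) \<mu>' + ?d n" by auto
  have \<mu>p: "\<mu> n \<in> borel_probs" for n by (rule E0D(1)[OF \<mu>])
  \<comment> \<open>The near-minimal value is at most \<open>(l + 1) + 1\<close>, and the weighted
    \<open>J\<close> is one of its summands.\<close>
  have Jle: "J (\<mu> n) \<mu>' \<le> ennreal ((l + 2) / t (u n))" for n
  proof -
    obtain j where j: "J (\<mu> n) \<mu>' = ennreal j" "0 \<le> j" using J_finite[OF \<mu> \<mu>', of n] by (cases "J (\<mu> n) \<mu>'") auto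
    have "ennreal (t (u n) * j) = ennreal (t (u n)) * J (\<mu> n) \<mu>'" using j t1[of n] by (simp add: ennreal_mult)
    also have "\<dots> \<le> transport_cost k (\<mu> n) (\<nu> (u n)) + ennreal (t (u n)) * J (\<mu> n) \<mu>'"
      by (simp add: add_increasing)
    also have "\<dots> \<le> envelope k (t (u n)) (\<nu> (u n)) \<mu>' + ?d n"
      by (rule less_imp_le[OF le])
    also have "\<dots> \<le> ennreal (l + 1) + ennreal 1"
      using env[of n] by (intro add_mono ennreal_leI) (auto simp: inverse_le_1_iff)
    also have "\<dots> = ennreal (l + 1 + 1)" by (rule ennreal_plus[symmetric]) (use l(2) in auto)
    also have "l + 1 + 1 = l + 2" by simp
    finally have e: "ennreal (t (u n) * j) \<le> ennreal (l + 2)" .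
    have "t (u n) * j \<le> l + 2" by (rule ennreal_le_iff[THEN iffD1, OF _ e]) (use l(2) in simp)
    then show ?thesis using t1[of n] j by (auto intro!: ennreal_leI simp: field_simps)
  qed
  have "(\<lambda>n. (l + 2) / t (u n)) \<longlonglongrightarrow> 0"
    by (rule real_tendsto_divide_at_top[OF tendsto_const tu])
  then have "(\<lambda>n. ennreal ((l + 2) / t (u n))) \<longlonglongrightarrow> ennreal 0" by (rule tendsto_ennrealI)
  then have L0: "(\<lambda>n. ennreal ((l + 2) / t (u n))) \<longlonglongrightarrow> 0" by simp
  have "(\<lambda>n. J (\<mu> n) \<mu>') \<longlonglongrightarrow> 0"
    by (rule tendsto_sandwich[OF _ _ tendsto_const L0]) (intro always_eventually allI Jle zero_le)+
  note conv = J_tendsto_0_left[OF \<mu>' \<mu>p this]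
  obtain m where m: "moment \<mu>' = ennreal m" "0 \<le> m" using E0D(2)[OF \<mu>'] by (cases "moment \<mu>'") auto
  have "\<forall>\<^sub>F n in sequentially. moment (\<mu> n) < ennreal (m + 1)"
    by (rule order_tendstoD(2)[OF conv(2)]) (use m in \<open>simp add: ennreal_less_iff del: ennreal_plus\<close>)
  then obtain K where K: "\<And>n. K \<le> n \<Longrightarrow> moment (\<mu> n) < ennreal (m + 1)" unfolding eventually_sequentially by auto
  let ?M = "max M (m + 1)"
  have shift: "strict_mono (\<lambda>n :: nat. n + K)" by (simp add: strict_mono_def)
  have "transport_cost k \<mu>' \<nu>' \<le> liminf (\<lambda>n. transport_cost k (\<mu> (n + K)) (\<nu> (u (n + K))))"
  proof (rule transport_cost_liminf[OF \<mu>p E0D(1)[OF \<mu>'] \<nu> _ _ _ _ k])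
    show "moment (\<mu> (n + K)) \<le> ennreal ?M" for n
      using K[of "n + K"] by (intro order_trans[OF less_imp_le ennreal_leI[OF max.cobounded2]]) simp
    show "moment (\<nu> (u (n + K))) \<le> ennreal ?M" for n
      by (rule order_trans[OF bd ennreal_leI[OF max.cobounded1]])
    show "weakly_converges (\<lambda>n. \<mu> (n + K)) \<mu>'"
      using weakly_converges_subseq[OF conv(1) shift] by (simp add: o_def)
    show "weakly_converges (\<lambda>n. \<nu> (u (n + K))) \<nu>'"
      using weakly_converges_subseq[OF w strict_mono_o[OF us shift]] by (simp add: o_def)
  qed
  also have "\<dots> \<le> liminf (\<lambda>n. envelope k (t (u (n + K))) (\<nu> (u (n + K))) \<mu>' + ?d (n + K))"
  proof (intro Liminf_mono always_eventually allI)
    fix n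
    have "transport_cost k (\<mu> (n + K)) (\<nu> (u (n + K))) \<le>
      transport_cost k (\<mu> (n + K)) (\<nu> (u (n + K))) + ennreal (t (u (n + K))) * J (\<mu> (n + K)) \<mu>'"
      by (simp add: add_increasing2)
    also have "\<dots> \<le> envelope k (t (u (n + K))) (\<nu> (u (n + K))) \<mu>' + ?d (n + K)"
      by (rule less_imp_le[OF le])
    finally show "transport_cost k (\<mu> (n + K)) (\<nu> (u (n + K))) \<le>
      envelope k (t (u (n + K))) (\<nu> (u (n + K))) \<mu>' + ?d (n + K)" .
  qed
  also have "\<dots> = ?L"
  proof -
    have "?d \<longlonglongrightarrow> ennreal 0" by (intro tendsto_ennrealI LIMSEQ_inverse_real_of_nat)
    then have "(\<lambda>n. envelope k (t (u n)) (\<nu> (u n)) \<mu>' + ?d n) \<longlonglongrightarrow> ?L + 0" by (intro tendsto_add ul) simp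
    from LIMSEQ_ignore_initial_segment[OF this, of K] show ?thesis
      by (intro lim_imp_Liminf) simp_all
  qed
  finally show ?thesis .
qed simp

text \<open>On \<open>E0\<close> the cost is the supremum of its envelopes with weights 1, 2, 3 and
  so on, by the previous bound for the constant sequence \<open>\<nu>\<close>.\<close>

lemma measurable_cost_E0:
  assumes k: "continuous_on UNIV (\<lambda>p. k (fst p) (snd p))" "\<And>x y. 0 \<le> k x y" and \<nu>: "\<nu> \<in> E0"
  shows "(\<lambda>\<mu>. transport_cost k \<mu> \<nu>) \<in> borel_measurable (borel_of T0)"
proof -
  have eq: "transport_cost k \<mu> \<nu> = (SUP n. envelope k (real (Suc n)) \<nu> \<mu>)" if "\<mu> \<in> E0" for \<mu>
  proof (rule antisym)
    obtain m where m: "moment \<nu> = ennreal m" using E0D(2)[OF \<nu>] by (cases "moment \<nu>") auto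
    have lim: "filterlim (\<lambda>n. real (Suc n)) at_top sequentially"
      by (rule filterlim_compose[OF filterlim_real_sequentially filterlim_Suc])
    have "transport_cost k \<mu> \<nu> \<le> liminf (\<lambda>n. envelope k (real (Suc n)) \<nu> \<mu>)"
      by (rule cost_le_liminf_envelope[OF E0D(1)[OF \<nu>] E0D(1)[OF \<nu>] weakly_converges_const _ k lim that, where M=m]) (simp add: m)
    also have "\<dots> \<le> liminf (\<lambda>n :: nat. SUP n. envelope k (real (Suc n)) \<nu> \<mu>)"
      by (intro Liminf_mono always_eventually allI SUP_upper) simp
    finally show "transport_cost k \<mu> \<nu> \<le> (SUP n. envelope k (real (Suc n)) \<nu> \<mu>)" by (simp add: Liminf_const)
    show "(SUP n. envelope k (real (Suc n)) \<nu> \<mu>) \<le> transport_cost k \<mu> \<nu>"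
      by (intro SUP_least envelope_le_cost that)
  qed
  have "(\<lambda>\<mu>. SUP n. envelope k (real (Suc n)) \<nu> \<mu>) \<in> borel_measurable (borel_of T0)"
    by (intro borel_measurable_SUP measurable_envelope) auto
  then show ?thesis
    by (subst measurable_cong[OF eq]) (simp_all add: space_borel_of topspace_T0)
qed

text \<open>The moment is \<open>J\<close> from the Dirac measure at \<open>x0\<close>, so its
  strict sublevel sets are balls within \<open>E0\<close>.\<close>

lemma measurable_moment: "moment \<in> borel_measurable (borel_of T0)"
proof (rule borel_measurableI_less)
  fix r
  have "{\<mu>' \<in> space (borel_of T0). moment \<mu>' < r} = {\<mu>' \<in> E0. 0 + ennreal 1 * J (return borel x0) \<mu>' < r}"
    using J_return E0D(1) by (auto simp: space_borel_of topspace_T0)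
  also have "openin T0 \<dots>" by (rule openin_T0_affine_J[OF return_E0]) simp
  finally show "{\<mu>' \<in> space (borel_of T0). moment \<mu>' < r} \<in> sets (borel_of T0)" by (rule sets_borel_of)
qed

end

text \<open>No measurability of \<open>g\<close> is needed here: \<open>nn_integral\<close> is a supremum over simple functions.\<close>

lemma nn_integral_add_cmult_le:
  fixes f g :: "'p \<Rightarrow> ennreal"
  assumes [measurable]: "f \<in> borel_measurable M" and t: "0 < t"
  shows "(\<integral>\<^sup>+x. f x + ennreal t * g x \<partial>M) \<le> (\<integral>\<^sup>+x. f x \<partial>M) + ennreal t * (\<integral>\<^sup>+x. g x \<partial>M)"
  unfolding nn_integral_def[of M "\<lambda>x. f x + ennreal t * g x"]
proof (rule SUP_least)
  fix s assume "s \<in> {s. simple_function M s \<and> s \<le> (\<lambda>x. f x + ennreal t * g x)}"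
  then have s: "simple_function M s" and le: "\<And>x. s x \<le> f x + ennreal t * g x" by (auto simp: le_fun_def)
  have [measurable]: "s \<in> borel_measurable M" by (rule borel_measurable_simple_function[OF s])
  \<comment> \<open>\<open>(s - f) / t\<close>, cut off at 0, is a measurable minorant of
    \<open>g\<close>. Where \<open>f\<close> is infinite, 0 is enough because the bound on
    \<open>s\<close> is trivial.\<close>
  define u where "u x = (if f x = \<infinity> then 0 else ennreal (1 / t) * (s x - f x))" for x
  have [measurable]: "u \<in> borel_measurable M" unfolding u_def by measurable
  have tt: "ennreal (1 / t) * (ennreal t * y) = y" "ennreal t * (ennreal (1 / t) * y) = y" for y
    using t by (simp_all add: mult.assoc[symmetric] ennreal_mult[symmetric])
  have ug: "u x \<le> g x" for x
  proof (cases "f x = \<infinity>")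
    case False
    have "s x - f x \<le> ennreal t * g x"
      using le[of x] False by (subst ennreal_minus_le_iff) simp
    then have "ennreal (1 / t) * (s x - f x) \<le> ennreal (1 / t) * (ennreal t * g x)" by (rule mult_left_mono) simp
    then show ?thesis using False by (simp add: u_def tt)
  qed (simp add: u_def)
  have su: "s x \<le> f x + ennreal t * u x" for x
  proof (cases "f x = \<infinity>")
    case False
    then have "s x \<le> f x + (s x - f x)"
      by (cases "f x \<le> s x") (auto simp: add_diff_inverse_ennreal add_increasing2)
    then show ?thesis using False by (simp add: u_def tt)
  qed simp
  have "integral\<^sup>S M s = (\<integral>\<^sup>+x. s x \<partial>M)" by (rule nn_integral_eq_simple_integral[OF s, symmetric])
  also have "\<dots> \<le> (\<integral>\<^sup>+x. f x + ennreal t * u x \<partial>M)" by (intro nn_integral_mono su)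
  also have "\<dots> = (\<integral>\<^sup>+x. f x \<partial>M) + ennreal t * (\<integral>\<^sup>+x. u x \<partial>M)"
    by (simp add: nn_integral_add nn_integral_cmult)
  also have "\<dots> \<le> (\<integral>\<^sup>+x. f x \<partial>M) + ennreal t * (\<integral>\<^sup>+x. g x \<partial>M)"
    by (intro add_mono mult_left_mono nn_integral_mono ug) auto
  finally show "integral\<^sup>S M s \<le> (\<integral>\<^sup>+x. f x \<partial>M) + ennreal t * (\<integral>\<^sup>+x. g x \<partial>M)" .
qed

section \<open>Infima, lower limits and slow rates in \<open>ennreal\<close>\<close>

lemma le_add_cmult_INF:
  fixes I :: "'p \<Rightarrow> ennreal"
  assumes le: "\<And>F. F \<in> S \<Longrightarrow> a \<le> b + ennreal t * I F" and t: "0 < t"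
  shows "a \<le> b + ennreal t * (INF F\<in>S. I F)"
proof (cases "(INF F\<in>S. I F) = \<infinity>")
  case True
  then show ?thesis using t by (simp add: ennreal_mult_eq_top_iff)
next
  case False
  show ?thesis
  proof (rule ennreal_le_epsilon)
    fix e :: real assume e: "0 < e"
    have "(INF F\<in>S. I F) < (INF F\<in>S. I F) + ennreal (e / t)"
      using False e t by (cases "INF F\<in>S. I F") (auto simp: ennreal_plus[symmetric] ennreal_less_iff simp del: ennreal_plus)
    then obtain F where F: "F \<in> S" "I F < (INF F\<in>S. I F) + ennreal (e / t)" unfolding INF_less_iff by blast
    have "a \<le> b + ennreal t * I F" by (rule le[OF F(1)])
    also have "\<dots> \<le> b + ennreal t * ((INF F\<in>S. I F) + ennreal (e / t))"
      using less_imp_le[OF F(2)] by (intro add_mono mult_left_mono) auto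
    also have "\<dots> = b + ennreal t * (INF F\<in>S. I F) + ennreal e"
      using t e by (simp add: distrib_left add.assoc ennreal_mult[symmetric])
    finally show "a \<le> b + ennreal t * (INF F\<in>S. I F) + ennreal e" .
  qed
qed

lemma liminf_add_tendsto_0:
  fixes a b :: "nat \<Rightarrow> ennreal"
  assumes "b \<longlonglongrightarrow> 0"
  shows "liminf (\<lambda>n. a n + b n) \<le> liminf a"
proof -
  obtain r where r: "strict_mono (r :: nat \<Rightarrow> nat)" "(a \<circ> r) \<longlonglongrightarrow> liminf a" using liminf_subseq_lim by blast
  have br: "(b \<circ> r) \<longlonglongrightarrow> 0" by (rule LIMSEQ_subseq_LIMSEQ[OF assms r(1)])
  have "(\<lambda>n. (a \<circ> r) n + (b \<circ> r) n) \<longlonglongrightarrow> liminf a + 0" by (intro tendsto_add r(2) br)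
  then have "liminf (\<lambda>n. (a \<circ> r) n + (b \<circ> r) n) = liminf a" by (intro lim_imp_Liminf) simp_all
  moreover have "liminf (\<lambda>n. a n + b n) \<le> liminf ((\<lambda>n. a n + b n) \<circ> r)" by (rule liminf_subseq_mono[OF r(1)])
  ultimately show ?thesis by (simp add: o_def)
qed

text \<open>For the weights of the envelopes: they must tend to infinity, yet slowly enough that
  weight times outer cost still vanishes.\<close>

lemma ex_slow_rate:
  fixes a :: "nat \<Rightarrow> ennreal"
  assumes a: "a \<longlonglongrightarrow> 0"
  obtains t :: "nat \<Rightarrow> real" where "\<And>n. 0 < t n" "filterlim t at_top sequentially" "(\<lambda>n. ennreal (t n) * a n) \<longlonglongrightarrow> 0"
proof -
  \<comment> \<open>The added positive null sequence makes the square root invertible even where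
    \<open>a n\<close> is 0; with \<open>t = 1 / sqrt e\<close> the product \<open>t * e\<close> is
    \<open>sqrt e\<close>.\<close>
  define e where "e n = enn2real (a n) + inverse (real (Suc n))" for n
  have e0: "0 < e n" for n by (simp add: e_def add_nonneg_pos)
  have "(\<lambda>n. enn2real (a n)) \<longlonglongrightarrow> enn2real 0"
    by (rule tendsto_enn2real) (use a in simp_all)
  then have "e \<longlonglongrightarrow> enn2real 0 + 0"
    unfolding e_def by (intro tendsto_add LIMSEQ_inverse_real_of_nat)
  then have "e \<longlonglongrightarrow> 0" by simp
  then have s: "(\<lambda>n. sqrt (e n)) \<longlonglongrightarrow> 0" using tendsto_real_sqrt by fastforce
  define t where "t n = inverse (sqrt (e n))" for n
  have t0: "0 < t n" for n using e0[of n] by (simp add: t_def)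
  have "filterlim t at_top sequentially"
    unfolding t_def using e0 by (intro filterlim_inverse_at_top s) simp
  moreover have "(\<lambda>n. ennreal (t n) * a n) \<longlonglongrightarrow> 0"
  proof (rule tendsto_sandwich[OF _ _ tendsto_const])
    show "(\<lambda>n. ennreal (sqrt (e n))) \<longlonglongrightarrow> 0" using tendsto_ennrealI[OF s] by simp
    have "\<forall>\<^sub>F n in sequentially. a n < 1" by (rule order_tendstoD(2)[OF a]) simp
    then show "\<forall>\<^sub>F n in sequentially. ennreal (t n) * a n \<le> ennreal (sqrt (e n))"
    proof eventually_elim
      case (elim n)
      then have "a n < top" by (rule less_trans) simp
      then have "a n = ennreal (enn2real (a n))" by simp
      also have "\<dots> \<le> ennreal (e n)" by (intro ennreal_leI) (simp add: e_def)
      finally have "ennreal (t n) * a n \<le> ennreal (t n) * ennreal (e n)" by (rule mult_left_mono) simp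
      also have "\<dots> = ennreal (t n * e n)" using t0[of n] e0[of n] by (simp add: ennreal_mult)
      also have "t n * e n = sqrt (e n)"
        using e0[of n] real_sqrt_mult_self[of "e n"] by (simp add: t_def field_simps)
      finally show ?case .
    qed
  qed simp
  ultimately show thesis using that t0 by blast
qed

section \<open>Integrated costs under convergence of the outer cost\<close>

context transport_space
begin

abbreviation P0 :: "'a measure measure set" where "P0 \<equiv> space (prob_algebra (borel_of T0))"

lemma P0D:
  assumes "Q \<in> P0"
  shows "prob_space Q" "space Q = E0" "f \<in> borel_measurable (borel_of T0) \<Longrightarrow> f \<in> borel_measurable Q"
proof -
  have s: "sets Q = sets (borel_of T0)" and "prob_space Q" using assms by (simp_all add: space_prob_algebra)
  then show "prob_space Q" "space Q = E0" "f \<in> borel_measurable (borel_of T0) \<Longrightarrow> f \<in> borel_measurable Q"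
    using sets_eq_imp_space_eq[OF s] by (simp_all add: space_borel_of topspace_T0 cong: measurable_cong_sets)
qed

text \<open>The Borel sets of the product topology contain the open rectangles, so both projections
  are measurable and one-coordinate integrals reduce to the marginals.\<close>

lemma outer_coupling:
  assumes Q: "Q \<in> P0" and P: "P \<in> P0" and F: "F \<in> couplings (borel_of (prod_topology T0 T0)) Q P"
  shows "space F = E0 \<times> E0"
    and "f \<in> borel_measurable (borel_of T0) \<Longrightarrow> (\<integral>\<^sup>+p. f (fst p) \<partial>F) = (\<integral>\<^sup>+\<mu>. f \<mu> \<partial>Q)"
    and "f \<in> borel_measurable (borel_of T0) \<Longrightarrow> (\<integral>\<^sup>+p. f (snd p) \<partial>F) = (\<integral>\<^sup>+\<mu>. f \<mu> \<partial>P)"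
    and "f \<in> borel_measurable (borel_of T0) \<Longrightarrow> (\<lambda>p. f (fst p)) \<in> borel_measurable F"
    and "f \<in> borel_measurable (borel_of T0) \<Longrightarrow> (\<lambda>p. f (snd p)) \<in> borel_measurable F"
proof -
  have sF: "sets F = sets (borel_of (prod_topology T0 T0))" and d: "distr F Q fst = Q" "distr F P snd = P"
    using F by (auto simp: couplings_def space_prob_algebra)
  show spF: "space F = E0 \<times> E0"
    using sets_eq_imp_space_eq[OF sF] by (simp add: space_borel_of topspace_T0)
  have op: "openin (prod_topology T0 T0) (U \<times> V)" if "openin T0 U" "openin T0 V" for U V
    using that by (simp add: openin_prod_Times_iff)
  have E: "openin T0 E0" unfolding topspace_T0[symmetric] by (rule openin_topspace)
  have f0: "fst \<in> F \<rightarrow>\<^sub>M borel_of T0" and s0: "snd \<in> F \<rightarrow>\<^sub>M borel_of T0"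
  proof -
    have "fst -` U \<inter> space F \<in> sets F" if "openin T0 U" for U
    proof -
      have "fst -` U \<inter> space F = U \<times> E0" using openin_subset[OF that] by (auto simp: spF topspace_T0)
      then show ?thesis unfolding sF using sets_borel_of[OF op[OF that E]] by simp
    qed
    then show "fst \<in> F \<rightarrow>\<^sub>M borel_of T0"
      unfolding borel_of_def by (intro measurable_measure_of) (use openin_subset[of T0] in \<open>auto simp: spF topspace_T0\<close>)
    have "snd -` U \<inter> space F \<in> sets F" if "openin T0 U" for U
    proof -
      have "snd -` U \<inter> space F = E0 \<times> U" using openin_subset[OF that] by (auto simp: spF topspace_T0)
      then show ?thesis unfolding sF using sets_borel_of[OF op[OF E that]] by simp
    qed
    then show "snd \<in> F \<rightarrow>\<^sub>M borel_of T0"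
      unfolding borel_of_def by (intro measurable_measure_of) (use openin_subset[of T0] in \<open>auto simp: spF topspace_T0\<close>)
  qed
  have sQ: "sets Q = sets (borel_of T0)" and sP: "sets P = sets (borel_of T0)"
    using Q P by (simp_all add: space_prob_algebra)
  have fQ: "fst \<in> F \<rightarrow>\<^sub>M Q" and sP': "snd \<in> F \<rightarrow>\<^sub>M P"
    using f0 s0 measurable_cong_sets[OF refl sQ] measurable_cong_sets[OF refl sP] by auto
  assume f: "f \<in> borel_measurable (borel_of T0)"
  have "(\<integral>\<^sup>+\<mu>. f \<mu> \<partial>distr F Q fst) = (\<integral>\<^sup>+p. f (fst p) \<partial>F)"
    by (rule nn_integral_distr[OF fQ]) (unfold d, rule P0D(3)[OF Q f])
  then show "(\<integral>\<^sup>+p. f (fst p) \<partial>F) = (\<integral>\<^sup>+\<mu>. f \<mu> \<partial>Q)" unfolding d by simp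
  have "(\<integral>\<^sup>+\<mu>. f \<mu> \<partial>distr F P snd) = (\<integral>\<^sup>+p. f (snd p) \<partial>F)"
    by (rule nn_integral_distr[OF sP']) (unfold d, rule P0D(3)[OF P f])
  then show "(\<integral>\<^sup>+p. f (snd p) \<partial>F) = (\<integral>\<^sup>+\<mu>. f \<mu> \<partial>P)" unfolding d by simp
  show "(\<lambda>p. f (fst p)) \<in> borel_measurable F" "(\<lambda>p. f (snd p)) \<in> borel_measurable F"
    using measurable_compose[OF f0 f] measurable_compose[OF s0 f] by simp_all
qed

text \<open>This and the next lemma are the easy half of Kantorovich duality. Two versions arise
  because \<open>J\<close> is directed: either marginal integral may be the one to be bounded.
  \<open>J\<close> enters as a function on pairs, so the sum is split by
  \<open>nn_integral_add_cmult_le\<close>.\<close>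

lemma outer_cost_bound_fst:
  assumes Q: "Q \<in> P0" and P: "P \<in> P0" and t: "0 < t"
    and v: "v \<in> borel_measurable (borel_of T0)" and u: "u \<in> borel_measurable (borel_of T0)"
    and le: "\<And>\<mu> \<mu>'. \<mu> \<in> E0 \<Longrightarrow> \<mu>' \<in> E0 \<Longrightarrow> v \<mu> \<le> u \<mu>' + ennreal t * J \<mu> \<mu>'"
  shows "(\<integral>\<^sup>+\<mu>. v \<mu> \<partial>Q) \<le> (\<integral>\<^sup>+\<mu>. u \<mu> \<partial>P) + ennreal t * outer_cost c x0 Q P"
  unfolding outer_cost_def case_prod_beta
proof (rule le_add_cmult_INF[OF _ t])
  fix F assume F: "F \<in> couplings (borel_of (prod_topology T0 T0)) Q P"
  note oc = outer_coupling[OF Q P F]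
  have "(\<integral>\<^sup>+\<mu>. v \<mu> \<partial>Q) = (\<integral>\<^sup>+p. v (fst p) \<partial>F)" by (rule oc(2)[OF v, symmetric])
  also have "\<dots> \<le> (\<integral>\<^sup>+p. u (snd p) + ennreal t * J (fst p) (snd p) \<partial>F)"
    by (intro nn_integral_mono le) (auto simp: oc(1))
  also have "\<dots> \<le> (\<integral>\<^sup>+p. u (snd p) \<partial>F) + ennreal t * (\<integral>\<^sup>+p. J (fst p) (snd p) \<partial>F)"
    by (rule nn_integral_add_cmult_le[OF oc(5)[OF u] t])
  finally show "(\<integral>\<^sup>+\<mu>. v \<mu> \<partial>Q) \<le> (\<integral>\<^sup>+\<mu>. u \<mu> \<partial>P) + ennreal t * (\<integral>\<^sup>+p. J (fst p) (snd p) \<partial>F)"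
    by (simp add: oc(3)[OF u])
qed

lemma outer_cost_bound_snd:
  assumes Q: "Q \<in> P0" and P: "P \<in> P0" and t: "0 < t"
    and v: "v \<in> borel_measurable (borel_of T0)" and u: "u \<in> borel_measurable (borel_of T0)"
    and le: "\<And>\<mu> \<mu>'. \<mu> \<in> E0 \<Longrightarrow> \<mu>' \<in> E0 \<Longrightarrow> u \<mu>' \<le> v \<mu> + ennreal t * J \<mu> \<mu>'"
  shows "(\<integral>\<^sup>+\<mu>. u \<mu> \<partial>P) \<le> (\<integral>\<^sup>+\<mu>. v \<mu> \<partial>Q) + ennreal t * outer_cost c x0 Q P"
  unfolding outer_cost_def case_prod_beta
proof (rule le_add_cmult_INF[OF _ t])
  fix F assume F: "F \<in> couplings (borel_of (prod_topology T0 T0)) Q P"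
  note oc = outer_coupling[OF Q P F]
  have "(\<integral>\<^sup>+\<mu>. u \<mu> \<partial>P) = (\<integral>\<^sup>+p. u (snd p) \<partial>F)" by (rule oc(3)[OF u, symmetric])
  also have "\<dots> \<le> (\<integral>\<^sup>+p. v (fst p) + ennreal t * J (fst p) (snd p) \<partial>F)"
    by (intro nn_integral_mono le) (auto simp: oc(1))
  also have "\<dots> \<le> (\<integral>\<^sup>+p. v (fst p) \<partial>F) + ennreal t * (\<integral>\<^sup>+p. J (fst p) (snd p) \<partial>F)"
    by (rule nn_integral_add_cmult_le[OF oc(4)[OF v] t])
  finally show "(\<integral>\<^sup>+\<mu>. u \<mu> \<partial>P) \<le> (\<integral>\<^sup>+\<mu>. v \<mu> \<partial>Q) + ennreal t * (\<integral>\<^sup>+p. J (fst p) (snd p) \<partial>F)"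
    by (simp add: oc(2)[OF v])
qed

text \<open>Growing weights make the envelopes recover the cost under \<open>P\<close> by Fatou's
  lemma, while the slow rate keeps the price \<open>t n\<close> times the outer cost negligible.
  Both the measure and the integrand may vary with \<open>n\<close>.\<close>

lemma integral_cost_liminf:
  assumes Pn: "\<And>n. Pn n \<in> P0" and P: "P \<in> P0" and lim: "(\<lambda>n. outer_cost c x0 (Pn n) P) \<longlonglongrightarrow> 0"
    and \<nu>: "\<And>n. \<nu> n \<in> borel_probs" "\<nu>' \<in> borel_probs" and w: "weakly_converges \<nu> \<nu>'"
    and bd: "\<And>n. moment (\<nu> n) \<le> ennreal M"
    and k: "continuous_on UNIV (\<lambda>p. k (fst p) (snd p))" "\<And>x y. 0 \<le> k x y"
  shows "(\<integral>\<^sup>+\<mu>. transport_cost k \<mu> \<nu>' \<partial>P) \<le> liminf (\<lambda>n. \<integral>\<^sup>+\<mu>. transport_cost k \<mu> (\<nu> n) \<partial>Pn n)"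
proof -
  obtain t where t: "\<And>n. 0 < t n" "filterlim t at_top sequentially"
    "(\<lambda>n. ennreal (t n) * outer_cost c x0 (Pn n) P) \<longlonglongrightarrow> 0"
    using ex_slow_rate[OF lim] by blast
  have nE: "\<nu> n \<in> E0" for n
    using \<nu>(1) bd[of n] by (auto simp: E0_def intro: le_less_trans)
  have "(\<integral>\<^sup>+\<mu>. transport_cost k \<mu> \<nu>' \<partial>P) \<le> (\<integral>\<^sup>+\<mu>. liminf (\<lambda>n. envelope k (t n) (\<nu> n) \<mu>) \<partial>P)"
    by (intro nn_integral_mono cost_le_liminf_envelope[OF \<nu> w bd k t(2)]) (simp add: P0D(2)[OF P])
  also have "\<dots> \<le> liminf (\<lambda>n. \<integral>\<^sup>+\<mu>. envelope k (t n) (\<nu> n) \<mu> \<partial>P)"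
    by (intro nn_integral_liminf P0D(3)[OF P] measurable_envelope t)
  also have "\<dots> \<le> liminf (\<lambda>n. (\<integral>\<^sup>+\<mu>. transport_cost k \<mu> (\<nu> n) \<partial>Pn n) + ennreal (t n) * outer_cost c x0 (Pn n) P)"
    by (intro Liminf_mono always_eventually allI outer_cost_bound_snd[OF Pn P t(1)] measurable_cost_E0[OF k nE] measurable_envelope t)
      (auto simp: envelope_def intro: INF_lower)
  also have "\<dots> \<le> liminf (\<lambda>n. \<integral>\<^sup>+\<mu>. transport_cost k \<mu> (\<nu> n) \<partial>Pn n)"
    by (rule liminf_add_tendsto_0[OF t(3)])
  finally show ?thesis .
qed

text \<open>The sup-convolution counterpart of \<open>envelope\<close>. Truncated subtraction is
  harmless: \<open>\<mu> = \<mu>'\<close> already contributes \<open>J \<mu>' \<nu>\<close>, which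
  is nonnegative.\<close>

definition upper_envelope :: "real \<Rightarrow> 'a measure \<Rightarrow> 'a measure \<Rightarrow> ennreal" where
  "upper_envelope t \<nu> \<mu>' = (SUP \<mu>\<in>E0. J \<mu> \<nu> - ennreal t * J \<mu> \<mu>')"

lemma measurable_upper_envelope:
  assumes t: "0 < t" and \<nu>: "\<nu> \<in> E0"
  shows "upper_envelope t \<nu> \<in> borel_measurable (borel_of T0)"
proof (rule borel_measurableI_greater)
  fix r
  have "{\<mu>' \<in> space (borel_of T0). r < upper_envelope t \<nu> \<mu>'} =
      (\<Union>\<mu>\<in>E0. {\<mu>' \<in> E0. r + ennreal t * J \<mu> \<mu>' < J \<mu> \<nu>})"
    unfolding space_borel_of topspace_T0 upper_envelope_def less_SUP_iff
    using J_finite[OF _ \<nu>] by (auto simp: less_diff_eq_ennreal)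
  also have "openin T0 \<dots>" by (intro openin_Union) (auto intro: openin_T0_affine_J[OF _ t])
  finally show "{\<mu>' \<in> space (borel_of T0). r < upper_envelope t \<nu> \<mu>'} \<in> sets (borel_of T0)"
    by (rule sets_borel_of)
qed

text \<open>\<open>J \<mu> \<nu>\<close> grows with \<open>\<mu>\<close> at slope at most
  \<open>B\<^sup>2\<close> in \<open>J \<mu> \<mu>'\<close>, one factor \<open>B\<close> from each
  use of the growth condition. From the weight \<open>B\<^sup>2\<close> on, the upper envelope is
  finite.\<close>

lemma J_le_affine:
  assumes \<mu>: "\<mu> \<in> borel_probs" and \<mu>': "\<mu>' \<in> borel_probs" and \<nu>: "\<nu> \<in> borel_probs"
  shows "J \<mu> \<nu> \<le> (ennreal A + ennreal B * (ennreal A + ennreal B * moment \<mu>' + moment \<nu>)) + ennreal (B\<^sup>2) * J \<mu> \<mu>'"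
proof -
  have "J \<mu> \<nu> \<le> ennreal A + ennreal B * (moment \<mu> + moment \<nu>)" by (rule J_le_moments[OF \<mu> \<nu>])
  also have "\<dots> \<le> ennreal A + ennreal B * ((ennreal A + ennreal B * (moment \<mu>' + J \<mu> \<mu>')) + moment \<nu>)"
    using moment_le_J2[OF \<mu> \<mu>'] by (intro add_mono mult_left_mono) auto
  also have "\<dots> = (ennreal A + ennreal B * (ennreal A + ennreal B * moment \<mu>' + moment \<nu>)) + ennreal (B\<^sup>2) * J \<mu> \<mu>'"
    using B by (simp add: distrib_left power2_eq_square ennreal_mult mult.assoc add_ac)
  finally show ?thesis .
qed

lemma upper_envelope_le:
  assumes t: "B\<^sup>2 \<le> t" and \<mu>': "\<mu>' \<in> E0" and \<nu>: "\<nu> \<in> E0"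
  shows "upper_envelope t \<nu> \<mu>' \<le> ennreal A + ennreal B * (ennreal A + ennreal B * moment \<mu>' + moment \<nu>)"
  unfolding upper_envelope_def
proof (rule SUP_least)
  fix \<mu> assume \<mu>: "\<mu> \<in> E0"
  let ?W = "ennreal A + ennreal B * (ennreal A + ennreal B * moment \<mu>' + moment \<nu>)"
  have "J \<mu> \<nu> \<le> ?W + ennreal (B\<^sup>2) * J \<mu> \<mu>'" by (rule J_le_affine[OF E0D(1)[OF \<mu>] E0D(1)[OF \<mu>'] E0D(1)[OF \<nu>]])
  also have "\<dots> \<le> ?W + ennreal t * J \<mu> \<mu>'" using t by (intro add_mono mult_right_mono ennreal_leI) auto
  finally show "J \<mu> \<nu> - ennreal t * J \<mu> \<mu>' \<le> ?W"
    using J_finite[OF \<mu> \<nu>] by (subst ennreal_minus_le_iff) (auto simp: add.commute)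
qed

text \<open>Measures that keep the envelopes above some \<open>q > J \<mu>' \<nu>\<close> must
  approach \<open>\<mu>'\<close> as the weight grows, with convergent moments; upper semicontinuity
  of \<open>J\<close> in its first argument then contradicts \<open>q\<close>.\<close>

lemma INF_upper_envelope_le:
  assumes \<mu>': "\<mu>' \<in> E0" and \<nu>: "\<nu> \<in> E0"
  shows "(INF n. upper_envelope (B\<^sup>2 + real (Suc n)) \<nu> \<mu>') \<le> J \<mu>' \<nu>"
proof (rule ccontr)
  let ?t = "\<lambda>n. B\<^sup>2 + real (Suc n)"
  assume "\<not> ?thesis"
  then have "J \<mu>' \<nu> < (INF n. upper_envelope (?t n) \<nu> \<mu>')" by simp
  then obtain q where q: "J \<mu>' \<nu> < q" "q < (INF n. upper_envelope (?t n) \<nu> \<mu>')" using dense by blast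
  have "q < upper_envelope (?t n) \<nu> \<mu>'" for n by (rule less_le_trans[OF q(2) INF_lower]) simp
  then have "\<forall>n. \<exists>\<mu>. \<mu> \<in> E0 \<and> q < J \<mu> \<nu> - ennreal (?t n) * J \<mu> \<mu>'"
    unfolding upper_envelope_def less_SUP_iff by blast
  from choice[OF this] obtain \<mu> where \<mu>: "\<And>n. \<mu> n \<in> E0"
    and ql: "\<And>n. q < J (\<mu> n) \<nu> - ennreal (?t n) * J (\<mu> n) \<mu>'" by auto
  have \<mu>p: "\<mu> n \<in> borel_probs" for n by (rule E0D(1)[OF \<mu>])
  let ?W = "ennreal A + ennreal B * (ennreal A + ennreal B * moment \<mu>' + moment \<nu>)"
  have "?W < \<infinity>" using E0D(2)[OF \<mu>'] E0D(2)[OF \<nu>] by (simp add: ennreal_mult_less_top)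
  then obtain W where W: "?W = ennreal W" "0 \<le> W" by (cases ?W) auto
  have ql': "q + ennreal (?t n) * J (\<mu> n) \<mu>' < J (\<mu> n) \<nu>" for n
    using ql[of n] J_finite[OF \<mu>[of n] \<nu>] by (simp add: less_diff_eq_ennreal)
  have Jle: "J (\<mu> n) \<mu>' \<le> ennreal (W * inverse (real (Suc n)))" for n
  proof -
    obtain j where j: "J (\<mu> n) \<mu>' = ennreal j" "0 \<le> j" using J_finite[OF \<mu> \<mu>', of n] by (cases "J (\<mu> n) \<mu>'") auto
    have "ennreal (?t n * j) = ennreal (?t n) * J (\<mu> n) \<mu>'" using j by (simp add: ennreal_mult)
    also have "\<dots> \<le> q + ennreal (?t n) * J (\<mu> n) \<mu>'" by (simp add: add_increasing)
    also have "\<dots> \<le> J (\<mu> n) \<nu>" by (rule less_imp_le[OF ql'])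
    also have "\<dots> \<le> ?W + ennreal (B\<^sup>2) * J (\<mu> n) \<mu>'" by (rule J_le_affine[OF \<mu>p E0D(1)[OF \<mu>'] E0D(1)[OF \<nu>]])
    also have "\<dots> = ennreal W + ennreal (B\<^sup>2 * j)" unfolding W(1) using j by (simp add: ennreal_mult)
    also have "\<dots> = ennreal (W + B\<^sup>2 * j)" by (rule ennreal_plus[symmetric]) (use W j in simp_all)
    finally have e: "ennreal (?t n * j) \<le> ennreal (W + B\<^sup>2 * j)" .
    have "?t n * j \<le> W + B\<^sup>2 * j"
      by (rule ennreal_le_iff[THEN iffD1, OF _ e]) (use W j in simp)
    \<comment> \<open>The share \<open>B\<^sup>2\<close> of the weight cancels the slope from
      \<open>J_le_affine\<close>; the surplus \<open>Suc n\<close> forces \<open>j\<close> to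
      0.\<close>
    then have "real (Suc n) * j \<le> W" by (simp add: distrib_right)
    then show ?thesis using j by (auto intro!: ennreal_leI simp: field_simps)
  qed
  have "(\<lambda>n. W * inverse (real (Suc n))) \<longlonglongrightarrow> 0" by (rule tendsto_mult_right_zero[OF LIMSEQ_inverse_real_of_nat])
  then have L0: "(\<lambda>n. ennreal (W * inverse (real (Suc n)))) \<longlonglongrightarrow> 0" using tendsto_ennrealI by fastforce
  have "(\<lambda>n. J (\<mu> n) \<mu>') \<longlonglongrightarrow> 0"
    by (rule tendsto_sandwich[OF _ _ tendsto_const L0]) (intro always_eventually allI Jle zero_le)+
  note conv = J_tendsto_0_left[OF \<mu>' \<mu>p this]
  have "\<forall>\<^sub>F n in sequentially. J (\<mu> n) \<nu> < q" by (rule J_usc_left[OF \<nu> \<mu>' \<mu>p conv q(1)])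
  then obtain n where "J (\<mu> n) \<nu> < q" unfolding eventually_sequentially by auto
  moreover have "q \<le> q + ennreal (?t n) * J (\<mu> n) \<mu>'" by (rule add_increasing2) simp_all
  then have "q < J (\<mu> n) \<nu>" using ql' by (rule le_less_trans)
  ultimately show False by (rule less_asym)
qed

text \<open>Decreasing monotone convergence needs one integrable envelope, which the finite mean
  moment provides. As \<open>\<nu>\<close> is fixed, a single weight \<open>?t N\<close> then serves
  all \<open>n\<close>, and its multiple of the outer cost vanishes.\<close>

lemma integral_J_usc:
  assumes Pn: "\<And>n. Pn n \<in> P0" and P: "P \<in> P0" and lim: "(\<lambda>n. outer_cost c x0 (Pn n) P) \<longlonglongrightarrow> 0"
    and \<nu>: "\<nu> \<in> E0" and fin: "(\<integral>\<^sup>+\<mu>. moment \<mu> \<partial>P) < \<infinity>" and less: "(\<integral>\<^sup>+\<mu>. J \<mu> \<nu> \<partial>P) < r"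
  shows "\<forall>\<^sub>F n in sequentially. (\<integral>\<^sup>+\<mu>. J \<mu> \<nu> \<partial>Pn n) < r"
proof -
  interpret P: prob_space P by (rule P0D(1)[OF P])
  let ?t = "\<lambda>n. B\<^sup>2 + real (Suc n)"
  have t: "0 < ?t n" for n by (simp add: add_nonneg_pos)
  have mm: "moment \<in> borel_measurable P" by (rule P0D(3)[OF P measurable_moment])
  have Um: "upper_envelope (?t n) \<nu> \<in> borel_measurable P" for n
    by (rule P0D(3)[OF P measurable_upper_envelope[OF t \<nu>]])
  have "(\<integral>\<^sup>+\<mu>. upper_envelope (?t 0) \<nu> \<mu> \<partial>P) \<le>
      (\<integral>\<^sup>+\<mu>. ennreal A + ennreal B * (ennreal A + ennreal B * moment \<mu> + moment \<nu>) \<partial>P)"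
    by (intro nn_integral_mono upper_envelope_le \<nu>) (simp_all add: P0D(2)[OF P])
  also have "\<dots> = ennreal A + ennreal B * (ennreal A + ennreal B * (\<integral>\<^sup>+\<mu>. moment \<mu> \<partial>P) + moment \<nu>)"
    using mm by (simp add: nn_integral_add nn_integral_cmult P.emeasure_space_1)
  also have "\<dots> < \<infinity>" using fin E0D(2)[OF \<nu>] by (simp add: ennreal_mult_less_top)
  finally have fin0: "(\<integral>\<^sup>+\<mu>. upper_envelope (?t 0) \<nu> \<mu> \<partial>P) < \<infinity>" .
  have "(INF n. \<integral>\<^sup>+\<mu>. upper_envelope (?t n) \<nu> \<mu> \<partial>P) = (\<integral>\<^sup>+\<mu>. (INF n. upper_envelope (?t n) \<nu> \<mu>) \<partial>P)"
  proof (rule nn_integral_monotone_convergence_INF_AE[where f="\<lambda>n. upper_envelope (?t n) \<nu>", OF _ Um fin0, symmetric])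
    show "AE \<mu> in P. upper_envelope (?t (Suc n)) \<nu> \<mu> \<le> upper_envelope (?t n) \<nu> \<mu>" for n
      unfolding upper_envelope_def
      by (intro AE_I2 SUP_mono) (auto intro!: bexI ennreal_minus_mono mult_right_mono ennreal_leI)
  qed
  also have "\<dots> \<le> (\<integral>\<^sup>+\<mu>. J \<mu> \<nu> \<partial>P)"
    by (intro nn_integral_mono INF_upper_envelope_le \<nu>) (simp add: P0D(2)[OF P])
  finally have "(INF n. \<integral>\<^sup>+\<mu>. upper_envelope (?t n) \<nu> \<mu> \<partial>P) < r" using less by simp
  then obtain N where N: "(\<integral>\<^sup>+\<mu>. upper_envelope (?t N) \<nu> \<mu> \<partial>P) < r" unfolding INF_less_iff by blast
  have le: "(\<integral>\<^sup>+\<mu>. J \<mu> \<nu> \<partial>Pn n) \<le> (\<integral>\<^sup>+\<mu>. upper_envelope (?t N) \<nu> \<mu> \<partial>P) + ennreal (?t N) * outer_cost c x0 (Pn n) P" for n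
  proof (rule outer_cost_bound_fst[OF Pn P t measurable_cost_E0[OF c_cont c_nonneg \<nu>] measurable_upper_envelope[OF t \<nu>]])
    fix \<mu> \<mu>' assume \<mu>: "\<mu> \<in> E0"
    have "J \<mu> \<nu> - ennreal (?t N) * J \<mu> \<mu>' \<le> upper_envelope (?t N) \<nu> \<mu>'"
      unfolding upper_envelope_def by (rule SUP_upper[OF \<mu>])
    then show "J \<mu> \<nu> \<le> upper_envelope (?t N) \<nu> \<mu>' + ennreal (?t N) * J \<mu> \<mu>'"
      using J_finite[OF \<mu> \<nu>] by (subst (asm) ennreal_minus_le_iff) (simp add: add.commute)
  qed
  have "(\<lambda>n. (\<integral>\<^sup>+\<mu>. upper_envelope (?t N) \<nu> \<mu> \<partial>P) + ennreal (?t N) * outer_cost c x0 (Pn n) P) \<longlonglongrightarrow>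
      (\<integral>\<^sup>+\<mu>. upper_envelope (?t N) \<nu> \<mu> \<partial>P) + ennreal (?t N) * 0"
    by (intro tendsto_add tendsto_const ennreal_tendsto_cmult lim) simp
  then have "\<forall>\<^sub>F n in sequentially. (\<integral>\<^sup>+\<mu>. upper_envelope (?t N) \<nu> \<mu> \<partial>P) + ennreal (?t N) * outer_cost c x0 (Pn n) P < r"
    by (rule order_tendstoD) (use N in simp)
  then show ?thesis by eventually_elim (rule le_less_trans[OF le])
qed

end

section \<open>Precompactness in the cost topology\<close>

lemma tendsto_fun_iff_pointwise:
  fixes f :: "'n \<Rightarrow> 'i \<Rightarrow> 'b::topological_space"
  shows "(f \<longlongrightarrow> l) F \<longleftrightarrow> (\<forall>i. ((\<lambda>n. f n i) \<longlongrightarrow> l i) F)"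
proof -
  have "(f \<longlongrightarrow> l) F \<longleftrightarrow> limitin (product_topology (\<lambda>i. euclidean) UNIV) f l F"
    unfolding euclidean_product_topology by simp
  also have "\<dots> \<longleftrightarrow> (\<forall>i. ((\<lambda>n. f n i) \<longlongrightarrow> l i) F)"
    unfolding limitin_componentwise by simp
  finally show ?thesis .
qed

text \<open>A sequence drawn from the range of another one may repeat members in any order. If no
  index recurs infinitely often, only finitely many terms have an index below a given bound.\<close>

lemma nat_seq_const_subseq_or_at_top:
  fixes j :: "nat \<Rightarrow> nat"
  obtains (const) v r where "strict_mono (r :: nat \<Rightarrow> nat)" "\<And>i. j (r i) = v" | (at_top) "filterlim j at_top sequentially"
proof (cases "\<exists>v. infinite {i. j i = v}")
  case True
  then obtain v where v: "infinite {i. j i = v}" ..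
  have "strict_mono (enumerate {i. j i = v})" by (rule strict_mono_enumerate[OF v])
  moreover have "j (enumerate {i. j i = v} i) = v" for i using enumerate_in_set[OF v, of i] by simp
  ultimately show thesis by (rule const)
next
  case False
  have "\<forall>\<^sub>F i in sequentially. Z \<le> j i" for Z
  proof -
    have "finite (\<Union>v\<in>{..<Z}. {i. j i = v})" using False by (intro finite_UN_I) auto
    then have "finite {i. \<not> Z \<le> j i}" by (rule finite_subset[rotated]) auto
    then show ?thesis unfolding cofinite_eq_sequentially[symmetric] eventually_cofinite .
  qed
  then show thesis by (intro at_top) (simp add: filterlim_at_top)
qed

context transport_space
begin

text \<open>Induction over the generated topology reduces the claim to balls. The centre of a ball
  containing \<open>\<nu>'\<close> has finite cost to \<open>\<nu>'\<close>, hence finite moment, so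
  \<open>J_usc_right\<close> applies.\<close>

lemma limitin_cost_topologyI:
  assumes \<nu>': "\<nu>' \<in> E0" and \<nu>: "\<And>n. \<nu> n \<in> borel_probs"
    and w: "weakly_converges \<nu> \<nu>'" and m: "(\<lambda>n. moment (\<nu> n)) \<longlonglongrightarrow> moment \<nu>'"
  shows "limitin (cost_topology c) \<nu> \<nu>' sequentially"
  unfolding limitin_def
proof (intro conjI allI impI)
  show "\<nu>' \<in> topspace (cost_topology c)" using E0D(1)[OF \<nu>'] by (simp add: topspace_cost_topology)
  fix U assume "openin (cost_topology c) U \<and> \<nu>' \<in> U"
  then have U: "generate_topology_on {{\<nu> \<in> borel_probs. J \<mu> \<nu> < ennreal r} |\<mu> r. \<mu> \<in> borel_probs \<and> 0 < r} U" "\<nu>' \<in> U"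
    unfolding cost_topology_def openin_topology_generated_by_iff by simp_all
  then show "\<forall>\<^sub>F n in sequentially. \<nu> n \<in> U"
  proof (induction rule: generate_topology_on.induct)
    case (Int a b)
    then have "\<forall>\<^sub>F n in sequentially. \<nu> n \<in> a" "\<forall>\<^sub>F n in sequentially. \<nu> n \<in> b" by simp_all
    then show ?case by eventually_elim simp
  next
    case (UN K)
    then obtain k where k: "k \<in> K" "\<nu>' \<in> k" by blast
    then have "\<forall>\<^sub>F n in sequentially. \<nu> n \<in> k" using UN.IH by simp
    then show ?case by eventually_elim (use k in blast)
  next
    case (Basis s)
    then obtain \<mu> r where s: "s = {\<nu> \<in> borel_probs. J \<mu> \<nu> < ennreal r}" and \<mu>: "\<mu> \<in> borel_probs" by blast
    have less: "J \<mu> \<nu>' < ennreal r" using Basis(2) s by simp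
    have "moment \<mu> \<le> ennreal A + ennreal B * (moment \<nu>' + J \<mu> \<nu>')" by (rule moment_le_J2[OF \<mu> E0D(1)[OF \<nu>']])
    also have "\<dots> < \<infinity>" using less E0D(2)[OF \<nu>'] by (auto simp: ennreal_mult_less_top intro: less_trans)
    finally have "\<mu> \<in> E0" using \<mu> by (simp add: E0_def)
    from J_usc_right[OF this \<nu>' \<nu> w m less] show ?case by eventually_elim (simp add: s \<nu>)
  qed simp
qed

lemma limitin_cost_topologyD:
  assumes l: "limitin (cost_topology c) \<nu> \<nu>' sequentially" and \<nu>: "\<And>n. \<nu> n \<in> E0"
  shows "\<nu>' \<in> E0" "weakly_converges \<nu> \<nu>'" "(\<lambda>n. moment (\<nu> n)) \<longlonglongrightarrow> moment \<nu>'"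
proof -
  have \<nu>': "\<nu>' \<in> borel_probs" using limitin_topspace[OF l] by (simp add: topspace_cost_topology)
  have ev: "\<forall>\<^sub>F n in sequentially. J \<nu>' (\<nu> n) < ennreal r" if r: "0 < r" for r
  proof -
    have mem: "\<nu>' \<in> {\<nu> \<in> borel_probs. J \<nu>' \<nu> < ennreal r}" using r \<nu>' by (simp add: J_self)
    have "\<forall>\<^sub>F n in sequentially. \<nu> n \<in> {\<nu> \<in> borel_probs. J \<nu>' \<nu> < ennreal r}"
      by (rule l[unfolded limitin_def, THEN conjunct2, rule_format, OF conjI[OF openin_J_ball[OF \<nu>' r] mem]])
    then show ?thesis by eventually_elim simp
  qed
  have lim: "(\<lambda>n. J \<nu>' (\<nu> n)) \<longlonglongrightarrow> 0"
  proof (rule order_tendstoI)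
    fix a :: ennreal assume "0 < a"
    then obtain q where q: "0 < q" "q < a" using dense by blast
    then have "q < top" by (auto simp: less_top[symmetric])
    then obtain r where "q = ennreal r" by (cases q) auto
    with q have r: "0 < r" "ennreal r < a" by auto
    show "\<forall>\<^sub>F n in sequentially. J \<nu>' (\<nu> n) < a" using ev[OF r(1)] by eventually_elim (use r in auto)
  qed simp
  obtain n where n: "J \<nu>' (\<nu> n) < ennreal 1" using ev[of 1] unfolding eventually_sequentially by auto
  have "moment \<nu>' \<le> ennreal A + ennreal B * (moment (\<nu> n) + J \<nu>' (\<nu> n))" by (rule moment_le_J2[OF \<nu>' E0D(1)[OF \<nu>]])
  also have "\<dots> < \<infinity>" using n E0D(2)[OF \<nu>[of n]] by (auto simp: ennreal_mult_less_top intro: less_trans)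
  finally show e: "\<nu>' \<in> E0" using \<nu>' by (simp add: E0_def)
  show "weakly_converges \<nu> \<nu>'" "(\<lambda>n. moment (\<nu> n)) \<longlonglongrightarrow> moment \<nu>'"
    using J_tendsto_0_right[OF e E0D(1)[OF \<nu>] lim] by simp_all
qed

text \<open>On \<open>E0\<close> the coordinates are a homeomorphism onto a subset of a metric space; compactness in the
  a priori non-metrizable cost topology is reduced to sequences in this way.\<close>

definition coords :: "'a measure \<Rightarrow> nat \<Rightarrow> real" where
  "coords \<nu> i = (case i of 0 \<Rightarrow> enn2real (moment \<nu>) | Suc j \<Rightarrow> \<integral>x. test_function j x \<partial>\<nu>)"

lemma inj_on_coords: "inj_on coords E0"
proof (rule inj_onI)
  fix \<mu> \<nu> assume *: "\<mu> \<in> E0" "\<nu> \<in> E0" "coords \<mu> = coords \<nu>"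
  have "(\<integral>x. test_function i x \<partial>\<mu>) = (\<integral>x. test_function i x \<partial>\<nu>)" for i
    using fun_cong[OF *(3), of "Suc i"] by (simp add: coords_def)
  then show "\<mu> = \<nu>" by (rule test_functions_determine[OF E0D(1)[OF *(1)] E0D(1)[OF *(2)]])
qed

lemma coords_tendstoI:
  assumes \<nu>': "\<nu>' \<in> E0" and w: "weakly_converges \<nu> \<nu>'" and m: "(\<lambda>n. moment (\<nu> n)) \<longlonglongrightarrow> moment \<nu>'"
  shows "(\<lambda>n. coords (\<nu> n)) \<longlonglongrightarrow> coords \<nu>'"
  unfolding tendsto_fun_iff_pointwise
proof
  fix i
  show "(\<lambda>n. coords (\<nu> n) i) \<longlonglongrightarrow> coords \<nu>' i"
  proof (cases i)
    case 0
    have "(\<lambda>n. enn2real (moment (\<nu> n))) \<longlonglongrightarrow> enn2real (moment \<nu>')"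
      using E0D(2)[OF \<nu>'] m by (intro tendsto_enn2real) simp_all
    then show ?thesis by (simp add: coords_def 0)
  next
    case (Suc j)
    then show ?thesis
      using w[unfolded weakly_converges_def, THEN spec, of "test_function j", THEN mp,
          OF conjI[OF continuous_on_test_function bounded_range_test_function]]
      by (simp add: coords_def)
  qed
qed

text \<open>Convergence of the moment coordinate bounds the moments, and under such a bound the test
  functions detect weak convergence.\<close>

lemma coords_tendstoD:
  assumes \<nu>: "\<And>n. \<nu> n \<in> E0" and \<nu>': "\<nu>' \<in> E0" and l: "(\<lambda>n. coords (\<nu> n)) \<longlonglongrightarrow> coords \<nu>'"
  shows "weakly_converges \<nu> \<nu>'" "(\<lambda>n. moment (\<nu> n)) \<longlonglongrightarrow> moment \<nu>'"
proof -
  have li: "(\<lambda>n. coords (\<nu> n) i) \<longlonglongrightarrow> coords \<nu>' i" for i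
    using l unfolding tendsto_fun_iff_pointwise by blast
  have fin: "ennreal (enn2real (moment \<rho>)) = moment \<rho>" if "\<rho> \<in> E0" for \<rho>
    using E0D(2)[OF that] by simp
  have r: "(\<lambda>n. enn2real (moment (\<nu> n))) \<longlonglongrightarrow> enn2real (moment \<nu>')"
    using li[of 0] by (simp add: coords_def)
  from tendsto_ennrealI[OF this] show "(\<lambda>n. moment (\<nu> n)) \<longlonglongrightarrow> moment \<nu>'" by (simp add: fin \<nu> \<nu>')
  have "Bseq (\<lambda>n. enn2real (moment (\<nu> n)))" using r by (intro convergent_imp_Bseq convergentI)
  then obtain K where "\<And>n. norm (enn2real (moment (\<nu> n))) \<le> K" unfolding Bseq_def by blast
  then have "ennreal (enn2real (moment (\<nu> n))) \<le> ennreal K" for n by (intro ennreal_leI) simp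
  then have "(\<integral>\<^sup>+x. ennreal (c x0 x) \<partial>\<nu> n) \<le> ennreal K" for n by (simp add: fin \<nu> moment_def[symmetric])
  moreover have "(\<lambda>n. \<integral>x. test_function i x \<partial>\<nu> n) \<longlonglongrightarrow> (\<integral>x. test_function i x \<partial>\<nu>')" for i
    using li[of "Suc i"] by (simp add: coords_def)
  ultimately show "weakly_converges \<nu> \<nu>'"
    by (intro weakly_convergesI_test_function[where \<nu>=\<nu>, OF g_cont g_nonneg g_proper E0D(1)[OF \<nu>] _ E0D(1)[OF \<nu>']])
qed

text \<open>The closure \<open>D\<close> of the coordinates is compact in a metric space and
  consists of coordinates of measures in \<open>E0\<close>. The inverse map carries it continuously
  to a compact set that contains the closure of \<open>S\<close>, and closed subsets of compact sets
  are compact.\<close>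

lemma precompact_in_cost_topologyI:
  assumes S: "S \<subseteq> E0"
    and sub: "\<And>\<sigma>. (\<And>n. \<sigma> n \<in> S) \<Longrightarrow> \<exists>r \<nu>'. strict_mono (r :: nat \<Rightarrow> nat) \<and> \<nu>' \<in> E0 \<and>
      weakly_converges (\<lambda>n. \<sigma> (r n)) \<nu>' \<and> (\<lambda>n. moment (\<sigma> (r n))) \<longlonglongrightarrow> moment \<nu>'"
  shows "precompact_in (cost_topology c) S"
proof -
  let ?T = "cost_topology c"
  define D where "D = closure (coords ` S)"
  have Dsub: "\<exists>r \<nu>'. strict_mono (r :: nat \<Rightarrow> nat) \<and> \<nu>' \<in> E0 \<and> (\<lambda>n. x (r n)) \<longlonglongrightarrow> coords \<nu>'"
    if x: "\<And>n. x n \<in> D" for x :: "nat \<Rightarrow> nat \<Rightarrow> real"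
  proof -
    have "\<exists>\<nu>. \<nu> \<in> S \<and> dist (coords \<nu>) (x n) < inverse (real (Suc n))" for n
    proof -
      have "0 < inverse (real (Suc n))" by simp
      then have "\<exists>y\<in>coords ` S. dist y (x n) < inverse (real (Suc n))"
        by (rule x[of n, unfolded D_def closure_approachable, rule_format])
      then show ?thesis by blast
    qed
    then have "\<forall>n. \<exists>\<nu>. \<nu> \<in> S \<and> dist (coords \<nu>) (x n) < inverse (real (Suc n))" ..
    from choice[OF this] obtain \<sigma> where \<sigma>: "\<And>n. \<sigma> n \<in> S"
      and d: "\<And>n. dist (coords (\<sigma> n)) (x n) < inverse (real (Suc n))" by auto
    from sub[of \<sigma>, OF \<sigma>] obtain r \<nu>' where r: "strict_mono (r :: nat \<Rightarrow> nat)" "\<nu>' \<in> E0"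
      "weakly_converges (\<lambda>n. \<sigma> (r n)) \<nu>'" "(\<lambda>n. moment (\<sigma> (r n))) \<longlonglongrightarrow> moment \<nu>'"
      by (elim exE conjE)
    have "(\<lambda>n. dist (x n) (coords (\<sigma> n))) \<longlonglongrightarrow> 0"
      by (rule tendsto_sandwich[OF _ _ tendsto_const LIMSEQ_inverse_real_of_nat])
        (intro always_eventually allI zero_le_dist less_imp_le d[unfolded dist_commute[of "coords _"]])+
    from LIMSEQ_subseq_LIMSEQ[OF this r(1)]
    have "(\<lambda>n. dist (x (r n)) (coords (\<sigma> (r n)))) \<longlonglongrightarrow> 0" by (simp add: o_def)
    from tendsto_dist_close[OF this coords_tendstoI[OF r(2-4)]] show ?thesis using r(1,2) by blast
  qed
  \<comment> \<open>A constant sequence in \<open>D\<close> converges to the coordinates of some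
    \<open>\<nu>'\<close>, so its value is those coordinates.\<close>
  have DE: "D \<subseteq> coords ` E0"
  proof
    fix x assume "x \<in> D"
    from Dsub[of "\<lambda>_. x", OF this] show "x \<in> coords ` E0" by (auto simp: LIMSEQ_const_iff)
  qed
  have cD: "closed D" by (simp add: D_def)
  have compD: "compact D"
    unfolding compact_def
  proof (intro allI impI)
    fix x :: "nat \<Rightarrow> nat \<Rightarrow> real" assume x: "\<forall>n. x n \<in> D"
    then obtain r \<nu>' where r: "strict_mono (r :: nat \<Rightarrow> nat)" "(\<lambda>n. x (r n)) \<longlonglongrightarrow> coords \<nu>'"
      using Dsub[of x] by auto
    have "coords \<nu>' \<in> D" by (rule closed_sequentially[OF cD _ r(2)]) (use x in simp)
    then show "\<exists>l\<in>D. \<exists>r. strict_mono r \<and> (x \<circ> r) \<longlonglongrightarrow> l" using r by (auto simp: o_def)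
  qed
  let ?\<Psi> = "inv_into E0 coords"
  have Psi: "?\<Psi> x \<in> E0" "coords (?\<Psi> x) = x" if "x \<in> D" for x
    using that DE by (auto intro: inv_into_into f_inv_into_f)
  have "continuous_map (top_of_set D) ?T ?\<Psi>"
    unfolding continuous_map_def
  proof (intro conjI allI impI)
    show "?\<Psi> \<in> topspace (top_of_set D) \<rightarrow> topspace ?T"
      using Psi E0D(1) by (auto simp: topspace_cost_topology)
    fix U assume U: "openin ?T U"
    \<comment> \<open>Sequences suffice for closedness here because the domain \<open>D\<close> is
      metric; nothing of the kind is asked of the target.\<close>
    have "closed {x \<in> D. ?\<Psi> x \<notin> U}"
      unfolding closed_sequential_limits
    proof (intro allI impI)
      fix x l assume x: "(\<forall>n. x n \<in> {x \<in> D. ?\<Psi> x \<notin> U}) \<and> x \<longlonglongrightarrow> l"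
      then have xD: "\<And>n. x n \<in> D" by simp
      have l: "l \<in> D" by (rule closed_sequentially[OF cD]) (use x in auto)
      have "(\<lambda>n. coords (?\<Psi> (x n))) \<longlonglongrightarrow> coords (?\<Psi> l)"
        using x Psi(2)[OF xD] Psi(2)[OF l] by simp
      from limitin_cost_topologyI[OF Psi(1)[OF l] E0D(1)[OF Psi(1)[OF xD]] coords_tendstoD[OF Psi(1)[OF xD] Psi(1)[OF l] this]]
      have lim: "limitin ?T (\<lambda>n. ?\<Psi> (x n)) (?\<Psi> l) sequentially" .
      have "?\<Psi> l \<notin> U"
      proof
        assume "?\<Psi> l \<in> U"
        then have "\<forall>\<^sub>F n in sequentially. ?\<Psi> (x n) \<in> U"
          by (intro lim[unfolded limitin_def, THEN conjunct2, rule_format] conjI U)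
        then show False using x unfolding eventually_sequentially by auto
      qed
      then show "l \<in> {x \<in> D. ?\<Psi> x \<notin> U}" using l by simp
    qed
    moreover have "{x \<in> topspace (top_of_set D). ?\<Psi> x \<in> U} = D \<inter> (- {x \<in> D. ?\<Psi> x \<notin> U})" by auto
    ultimately show "openin (top_of_set D) {x \<in> topspace (top_of_set D). ?\<Psi> x \<in> U}"
      by (simp only: openin_open_Int open_Compl)
  qed
  moreover have "compactin (top_of_set D) D" using compD by (simp add: compactin_subtopology)
  ultimately have comp: "compactin ?T (?\<Psi> ` D)" by (intro image_compactin)
  have "?T closure_of S \<subseteq> ?\<Psi> ` D"
  proof
    fix \<nu> assume c: "\<nu> \<in> ?T closure_of S"
    then have \<nu>: "\<nu> \<in> borel_probs" by (simp add: in_closure_of topspace_cost_topology)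
    \<comment> \<open>Balls about \<open>\<nu>\<close> are open and contain \<open>\<nu>\<close>, so
      a closure point is reached by a sequence in \<open>S\<close>.\<close>
    have "\<exists>\<rho>. \<rho> \<in> S \<and> J \<nu> \<rho> < ennreal (inverse (real (Suc n)))" for n
    proof -
      have mem: "\<nu> \<in> {\<rho> \<in> borel_probs. J \<nu> \<rho> < ennreal (inverse (real (Suc n)))}" using \<nu> by (simp add: J_self)
      have op: "openin ?T {\<rho> \<in> borel_probs. J \<nu> \<rho> < ennreal (inverse (real (Suc n)))}"
        by (rule openin_J_ball[OF \<nu>]) simp
      from c[unfolded in_closure_of, THEN conjunct2, rule_format, OF conjI[OF mem op]] show ?thesis by auto
    qed
    then have "\<forall>n. \<exists>\<rho>. \<rho> \<in> S \<and> J \<nu> \<rho> < ennreal (inverse (real (Suc n)))" ..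
    from choice[OF this] obtain \<sigma> where \<sigma>: "\<And>n. \<sigma> n \<in> S" and d: "\<And>n. J \<nu> (\<sigma> n) < ennreal (inverse (real (Suc n)))" by auto
    have \<sigma>E: "\<sigma> n \<in> E0" for n using \<sigma> S by auto
    have "(\<lambda>n. ennreal (inverse (real (Suc n)))) \<longlonglongrightarrow> ennreal 0"
      by (intro tendsto_ennrealI LIMSEQ_inverse_real_of_nat)
    then have L0: "(\<lambda>n. ennreal (inverse (real (Suc n)))) \<longlonglongrightarrow> 0" by simp
    have lim: "(\<lambda>n. J \<nu> (\<sigma> n)) \<longlonglongrightarrow> 0"
      by (rule tendsto_sandwich[OF _ _ tendsto_const L0]) (intro always_eventually allI zero_le less_imp_le d)+
    have "moment \<nu> \<le> ennreal A + ennreal B * (moment (\<sigma> 0) + J \<nu> (\<sigma> 0))" by (rule moment_le_J2[OF \<nu> E0D(1)[OF \<sigma>E]])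
    also have "\<dots> < \<infinity>" using d[of 0] E0D(2)[OF \<sigma>E[of 0]] by (auto simp: ennreal_mult_less_top intro: less_trans)
    finally have \<nu>E: "\<nu> \<in> E0" using \<nu> by (simp add: E0_def)
    have sD: "coords (\<sigma> n) \<in> D" for n
      unfolding D_def by (rule subsetD[OF closure_subset imageI[OF \<sigma>]])
    have "(\<lambda>n. coords (\<sigma> n)) \<longlonglongrightarrow> coords \<nu>"
      by (rule coords_tendstoI[OF \<nu>E J_tendsto_0_right[OF \<nu>E E0D(1)[OF \<sigma>E] lim]])
    from closed_sequentially[OF cD sD this] have "coords \<nu> \<in> D" .
    moreover have "?\<Psi> (coords \<nu>) = \<nu>" by (rule inv_into_f_f[OF inj_on_coords \<nu>E])
    ultimately show "\<nu> \<in> ?\<Psi> ` D" by force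
  qed
  then show ?thesis unfolding precompact_in_def
    by (rule closed_compactin[OF comp]) simp
qed

end

section \<open>Barycenters\<close>

locale penalized_space = transport_space c x0 A B
  for c :: "'a::{metric_space,second_countable_topology} \<Rightarrow> 'a \<Rightarrow> real" and x0 A B +
  fixes G :: "'a measure \<Rightarrow> ereal" and b :: real
  assumes G_bdd: "\<nu> \<in> borel_probs \<Longrightarrow> ereal b \<le> G \<nu>" and G_lsc: "weakly_lsc G"
begin

text \<open>Subtracting the lower bound moves the minimisation into \<open>ennreal\<close>, where
  superadditivity of lower limits and Fatou's lemma apply directly; minimisers are unaffected by the
  shift.\<close>

definition penalty :: "'a measure \<Rightarrow> ennreal" where
  "penalty \<nu> = e2ennreal (G \<nu> - ereal b)"

definition objective :: "'a measure measure \<Rightarrow> 'a measure \<Rightarrow> ennreal" where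
  "objective Q \<nu> = (\<integral>\<^sup>+\<mu>. J \<mu> \<nu> \<partial>Q) + penalty \<nu>"

lemma G_eq: "\<nu> \<in> borel_probs \<Longrightarrow> G \<nu> = enn2ereal (penalty \<nu>) + ereal b"
  using G_bdd[of \<nu>] unfolding penalty_def
  by (subst enn2ereal_e2ennreal) (cases "G \<nu>"; auto simp: ereal_diff_positive)+

lemma frechet_functional_eq:
  "\<nu> \<in> borel_probs \<Longrightarrow> frechet_functional c G Q \<nu> = enn2ereal (objective Q \<nu>) + ereal b"
  by (simp add: frechet_functional_def objective_def G_eq plus_ennreal.rep_eq add.assoc)

lemma barycenters_iff:
  "\<nu> \<in> barycenters c G Q \<longleftrightarrow>
    \<nu> \<in> borel_probs \<and> objective Q \<nu> < \<infinity> \<and> (\<forall>\<nu>'\<in>borel_probs. objective Q \<nu> \<le> objective Q \<nu>')"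
proof -
  have fin: "\<bar>enn2ereal x + ereal b\<bar> \<noteq> \<infinity> \<longleftrightarrow> x < \<infinity>" for x
    by (cases x) (auto simp: enn2ereal_ennreal)
  have le: "enn2ereal x + ereal b \<le> enn2ereal y + ereal b \<longleftrightarrow> x \<le> y" for x y
    by (cases x; cases y) (auto simp: enn2ereal_ennreal top_unique)
  show ?thesis
  proof (cases "\<nu> \<in> borel_probs")
    case True
    have "\<bar>frechet_functional c G Q \<nu>\<bar> \<noteq> \<infinity> \<longleftrightarrow> objective Q \<nu> < \<infinity>"
      by (simp only: frechet_functional_eq[OF True] fin)
    moreover have "(\<forall>\<nu>'\<in>borel_probs. frechet_functional c G Q \<nu> \<le> frechet_functional c G Q \<nu>') \<longleftrightarrow>
        (\<forall>\<nu>'\<in>borel_probs. objective Q \<nu> \<le> objective Q \<nu>')"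
      by (rule ball_cong[OF refl]) (simp only: frechet_functional_eq True le)
    ultimately show ?thesis by (simp only: barycenters_def mem_Collect_eq)
  qed (simp add: barycenters_def)
qed

lemma penalty_liminf:
  assumes w: "weakly_converges \<nu> \<nu>'" and \<nu>: "\<And>n. \<nu> n \<in> borel_probs" "\<nu>' \<in> borel_probs"
  shows "penalty \<nu>' \<le> liminf (\<lambda>n. penalty (\<nu> n))"
  unfolding le_Liminf_iff
proof (intro allI impI)
  fix y assume y: "y < penalty \<nu>'"
  then have "y < top" by (auto simp: less_top[symmetric])
  then obtain r where r: "y = ennreal r" "0 \<le> r" by (cases y) auto
  have *: "ereal (r + b) < G \<rho> \<longleftrightarrow> y < penalty \<rho>" if "\<rho> \<in> borel_probs" for \<rho>
    unfolding G_eq[OF that] r(1) using r(2)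
    by (cases "penalty \<rho>") (auto simp: enn2ereal_ennreal ennreal_less_iff)
  have "G \<nu>' \<le> liminf (\<lambda>n. G (\<nu> n))"
    using G_lsc w \<nu> unfolding weakly_lsc_def by simp
  then have "\<forall>\<^sub>F n in sequentially. ereal (r + b) < G (\<nu> n)"
    using y *[OF \<nu>(2)] unfolding le_Liminf_iff by simp
  then show "\<forall>\<^sub>F n in sequentially. y < penalty (\<nu> n)" by eventually_elim (simp add: * \<nu>)
qed

lemma measurable_J:
  assumes "Q \<in> P0" "\<nu> \<in> E0"
  shows "(\<lambda>\<mu>. J \<mu> \<nu>) \<in> borel_measurable Q"
  by (rule P0D(3)[OF assms(1) measurable_cost_E0[OF c_cont c_nonneg assms(2)]])

text \<open>A finite integral leaves some \<open>\<mu>\<close> in \<open>E0\<close> at finite cost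
  to \<open>\<nu>\<close>, and finite moments spread along finite costs.\<close>

lemma finite_integral_J_E0:
  assumes Q: "Q \<in> P0" and \<nu>: "\<nu> \<in> borel_probs" and fin: "(\<integral>\<^sup>+\<mu>. J \<mu> \<nu> \<partial>Q) < \<infinity>"
  shows "\<nu> \<in> E0"
proof -
  interpret prob_space Q by (rule P0D(1)[OF Q])
  have "\<exists>\<mu>\<in>E0. J \<mu> \<nu> < \<infinity>"
  proof (rule ccontr)
    assume "\<not> ?thesis"
    then have "(\<integral>\<^sup>+\<mu>. J \<mu> \<nu> \<partial>Q) = (\<integral>\<^sup>+\<mu>. \<infinity> \<partial>Q)"
      by (intro nn_integral_cong) (auto simp: P0D(2)[OF Q] less_top[symmetric])
    then show False using fin by (simp add: emeasure_space_1)
  qed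
  then obtain \<mu> where \<mu>: "\<mu> \<in> E0" "J \<mu> \<nu> < \<infinity>" ..
  have "moment \<nu> \<le> ennreal A + ennreal B * (moment \<mu> + J \<mu> \<nu>)" by (rule moment_le_J1[OF E0D(1)[OF \<mu>(1)] \<nu>])
  also have "\<dots> < \<infinity>" using \<mu>(2) E0D(2)[OF \<mu>(1)] by (simp add: ennreal_mult_less_top)
  finally show ?thesis using \<nu> by (simp add: E0_def)
qed

lemma integral_moment_le:
  assumes Q: "Q \<in> P0" and \<nu>: "\<nu> \<in> E0"
  shows "(\<integral>\<^sup>+\<mu>. moment \<mu> \<partial>Q) \<le> ennreal A + ennreal B * (moment \<nu> + (\<integral>\<^sup>+\<mu>. J \<mu> \<nu> \<partial>Q))"
proof -
  interpret prob_space Q by (rule P0D(1)[OF Q])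
  have "(\<integral>\<^sup>+\<mu>. moment \<mu> \<partial>Q) \<le> (\<integral>\<^sup>+\<mu>. ennreal A + ennreal B * (moment \<nu> + J \<mu> \<nu>) \<partial>Q)"
    by (intro nn_integral_mono moment_le_J2 E0D(1)[OF \<nu>]) (simp add: P0D(2)[OF Q] E0D)
  also have "\<dots> = ennreal A + ennreal B * (moment \<nu> + (\<integral>\<^sup>+\<mu>. J \<mu> \<nu> \<partial>Q))"
    using measurable_J[OF Q \<nu>] by (simp add: nn_integral_add nn_integral_cmult emeasure_space_1)
  finally show ?thesis .
qed

text \<open>The coercivity estimate: \<open>moment \<nu>\<close> is bounded by the mean of
  \<open>moment \<mu>\<close> under \<open>Q\<close>, which a reference measure
  \<open>\<rho>\<close> bounds in turn. It depends on \<open>Q\<close> only through two integrated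
  costs, so it can be uniform along \<open>Pn n\<close>.\<close>

lemma moment_le_integral:
  assumes Q: "Q \<in> P0" and \<nu>: "\<nu> \<in> E0" and \<rho>: "\<rho> \<in> E0"
  shows "moment \<nu> \<le> ennreal A + ennreal B *
    ((ennreal A + ennreal B * (moment \<rho> + (\<integral>\<^sup>+\<mu>. J \<mu> \<rho> \<partial>Q))) + (\<integral>\<^sup>+\<mu>. J \<mu> \<nu> \<partial>Q))"
proof -
  interpret prob_space Q by (rule P0D(1)[OF Q])
  have mm: "moment \<in> borel_measurable Q" by (rule P0D(3)[OF Q measurable_moment])
  have "moment \<nu> = (\<integral>\<^sup>+\<mu>. moment \<nu> \<partial>Q)" by (simp add: emeasure_space_1)
  also have "\<dots> \<le> (\<integral>\<^sup>+\<mu>. ennreal A + ennreal B * (moment \<mu> + J \<mu> \<nu>) \<partial>Q)"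
    by (intro nn_integral_mono moment_le_J1 E0D(1)[OF \<nu>]) (simp add: P0D(2)[OF Q] E0D)
  also have "\<dots> = ennreal A + ennreal B * ((\<integral>\<^sup>+\<mu>. moment \<mu> \<partial>Q) + (\<integral>\<^sup>+\<mu>. J \<mu> \<nu> \<partial>Q))"
    using measurable_J[OF Q \<nu>] mm by (simp add: nn_integral_add nn_integral_cmult emeasure_space_1)
  also have "\<dots> \<le> ennreal A + ennreal B *
    ((ennreal A + ennreal B * (moment \<rho> + (\<integral>\<^sup>+\<mu>. J \<mu> \<rho> \<partial>Q))) + (\<integral>\<^sup>+\<mu>. J \<mu> \<nu> \<partial>Q))"
    using integral_moment_le[OF Q \<rho>] by (intro add_mono mult_left_mono) auto
  finally show ?thesis .
qed

lemma integral_J_liminf: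
  assumes Q: "Q \<in> P0" and \<nu>: "\<And>n. \<nu> n \<in> borel_probs" "\<nu>' \<in> borel_probs" and w: "weakly_converges \<nu> \<nu>'"
    and bd: "\<And>n. moment (\<nu> n) \<le> ennreal M"
  shows "(\<integral>\<^sup>+\<mu>. J \<mu> \<nu>' \<partial>Q) \<le> liminf (\<lambda>n. \<integral>\<^sup>+\<mu>. J \<mu> (\<nu> n) \<partial>Q)"
proof -
  have nE: "\<nu> n \<in> E0" for n using \<nu>(1) bd[of n] by (auto simp: E0_def intro: le_less_trans)
  have "(\<integral>\<^sup>+\<mu>. J \<mu> \<nu>' \<partial>Q) \<le> (\<integral>\<^sup>+\<mu>. liminf (\<lambda>n. J \<mu> (\<nu> n)) \<partial>Q)"
  proof (rule nn_integral_mono)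
    fix \<mu> assume "\<mu> \<in> space Q"
    then have \<mu>: "\<mu> \<in> E0" by (simp add: P0D(2)[OF Q])
    obtain m where m: "moment \<mu> = ennreal m" using E0D(2)[OF \<mu>] by (cases "moment \<mu>") auto
    have bd1: "moment \<mu> \<le> ennreal (max m M)" unfolding m by (rule ennreal_leI) simp
    have bd2: "moment (\<nu> n) \<le> ennreal (max m M)" for n by (rule order_trans[OF bd ennreal_leI]) simp
    show "J \<mu> \<nu>' \<le> liminf (\<lambda>n. J \<mu> (\<nu> n))"
      by (rule transport_cost_liminf[OF E0D(1)[OF \<mu>] E0D(1)[OF \<mu>] \<nu> bd1 bd2 weakly_converges_const w c_cont c_nonneg])
  qed
  also have "\<dots> \<le> liminf (\<lambda>n. \<integral>\<^sup>+\<mu>. J \<mu> (\<nu> n) \<partial>Q)"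
    by (intro nn_integral_liminf measurable_J Q nE)
  finally show ?thesis .
qed

lemma liminf_add_ennreal:
  fixes u v :: "nat \<Rightarrow> ennreal"
  shows "liminf u + liminf v \<le> liminf (\<lambda>n. u n + v n)"
  unfolding liminf_SUP_INF
proof (subst ennreal_SUP_add[symmetric])
  show "incseq (\<lambda>n. INF m\<in>{n..}. u m)" "incseq (\<lambda>n. INF m\<in>{n..}. v m)"
    by (auto simp: incseq_def intro!: INF_superset_mono)
  show "(SUP n. (INF m\<in>{n..}. u m) + (INF m\<in>{n..}. v m)) \<le> (SUP n. INF m\<in>{n..}. u m + v m)"
    by (intro SUP_mono bexI[OF _ UNIV_I] INF_greatest add_mono INF_lower) auto
qed

lemma barycenters_nonempty:
  assumes Q: "Q \<in> P0" and \<rho>: "\<rho> \<in> E0" and fin: "objective Q \<rho> < \<infinity>"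
  shows "barycenters c G Q \<noteq> {}"
proof -
  define L where "L = (INF \<nu>\<in>borel_probs. objective Q \<nu>)"
  have "L \<le> objective Q \<rho>" unfolding L_def by (rule INF_lower[OF E0D(1)[OF \<rho>]])
  then have "L < \<infinity>" using fin by (rule le_less_trans)
  then obtain l where l: "L = ennreal l" "0 \<le> l" by (cases L) auto
  let ?d = "\<lambda>n. ennreal (inverse (real (Suc n)))"
  have "\<exists>\<nu>. \<nu> \<in> borel_probs \<and> objective Q \<nu> < L + ?d n" for n
  proof -
    have "L < L + ?d n" unfolding l(1) using l(2)
      by (subst ennreal_plus[symmetric]) (auto simp: ennreal_less_iff simp del: ennreal_plus)
    then show ?thesis unfolding L_def INF_less_iff by blast
  qed
  then have "\<forall>n. \<exists>\<nu>. \<nu> \<in> borel_probs \<and> objective Q \<nu> < L + ?d n" ..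
  from choice[OF this] obtain \<nu> where \<nu>: "\<And>n. \<nu> n \<in> borel_probs" and less: "\<And>n. objective Q (\<nu> n) < L + ?d n" by auto
  have I: "(\<integral>\<^sup>+\<mu>. J \<mu> (\<nu> n) \<partial>Q) \<le> ennreal (l + 1)" for n
  proof -
    have "(\<integral>\<^sup>+\<mu>. J \<mu> (\<nu> n) \<partial>Q) \<le> objective Q (\<nu> n)" by (simp add: objective_def)
    also have "\<dots> \<le> L + ?d n" by (rule less_imp_le[OF less])
    also have "\<dots> \<le> ennreal l + ennreal 1" unfolding l(1) by (intro add_mono ennreal_leI) (auto simp: inverse_le_1_iff)
    also have "\<dots> = ennreal (l + 1)" by (rule ennreal_plus[symmetric]) (use l in auto)
    finally show ?thesis .
  qed
  have nE: "\<nu> n \<in> E0" for n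
    by (rule finite_integral_J_E0[OF Q \<nu>]) (rule le_less_trans[OF I], simp)
  \<comment> \<open>The coercivity bound of \<open>moment_le_integral\<close>, with the minimising
    sequence's integrated cost replaced by its bound \<open>l + 1\<close>.\<close>
  define M where "M = ennreal A + ennreal B * ((ennreal A + ennreal B * (moment \<rho> + (\<integral>\<^sup>+\<mu>. J \<mu> \<rho> \<partial>Q))) + ennreal (l + 1))"
  have "(\<integral>\<^sup>+\<mu>. J \<mu> \<rho> \<partial>Q) < \<infinity>" using fin by (simp add: objective_def)
  then have "M < \<infinity>" unfolding M_def using E0D(2)[OF \<rho>] by (simp add: ennreal_mult_less_top del: ennreal_plus)
  then obtain m where m: "M = ennreal m" by (cases M) auto
  have bd: "moment (\<nu> n) \<le> ennreal m" for n
    unfolding m[symmetric] M_def using I[of n]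
    by (intro order_trans[OF moment_le_integral[OF Q nE \<rho>]] add_mono mult_left_mono) auto
  obtain r \<nu>' where r: "strict_mono (r :: nat \<Rightarrow> nat)" "\<nu>' \<in> borel_probs" "weakly_converges (\<nu> \<circ> r) \<nu>'"
    by (rule moment_bounded_subsequence[OF \<nu> bd])
  have rp: "(\<nu> \<circ> r) n \<in> borel_probs" "moment ((\<nu> \<circ> r) n) \<le> ennreal m" for n using \<nu> bd by simp_all
  have "objective Q \<nu>' \<le> liminf (\<lambda>n. \<integral>\<^sup>+\<mu>. J \<mu> ((\<nu> \<circ> r) n) \<partial>Q) + liminf (\<lambda>n. penalty ((\<nu> \<circ> r) n))"
    unfolding objective_def
    by (intro add_mono integral_J_liminf[OF Q rp(1) r(2,3) rp(2)] penalty_liminf[OF r(3) rp(1) r(2)])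
  also have "\<dots> \<le> liminf (\<lambda>n. objective Q ((\<nu> \<circ> r) n))"
    unfolding objective_def by (rule liminf_add_ennreal)
  also have "\<dots> \<le> liminf (\<lambda>n. L + ?d (r n))"
    using less by (intro Liminf_mono always_eventually allI less_imp_le) simp
  also have "\<dots> = L"
  proof -
    have "?d \<longlonglongrightarrow> ennreal 0" by (intro tendsto_ennrealI LIMSEQ_inverse_real_of_nat)
    from LIMSEQ_subseq_LIMSEQ[OF this r(1)] have "(\<lambda>n. ?d (r n)) \<longlonglongrightarrow> 0" by (simp add: o_def)
    then have "(\<lambda>n. L + ?d (r n)) \<longlonglongrightarrow> L + 0" by (intro tendsto_add tendsto_const)
    then show ?thesis by (intro lim_imp_Liminf) simp_all
  qed
  finally have le: "objective Q \<nu>' \<le> L" .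
  have "\<nu>' \<in> barycenters c G Q"
    unfolding barycenters_iff
  proof (intro conjI ballI r(2))
    show "objective Q \<nu>' < \<infinity>" using le \<open>L < \<infinity>\<close> by (rule le_less_trans)
    show "objective Q \<nu>' \<le> objective Q \<rho>" if "\<rho> \<in> borel_probs" for \<rho>
      using le unfolding L_def by (rule order_trans) (rule INF_lower[OF that])
  qed
  then show ?thesis by blast
qed

end

text \<open>Lower semicontinuity of the transport cost for \<open>moment_defect\<close> turns convergence of the transport
  costs for \<open>c\<close> into an upper bound for the moments.\<close>

context transport_space
begin

definition moment_defect :: "'a \<Rightarrow> 'a \<Rightarrow> real" where
  "moment_defect x y = A + B * (c x x0 + c x y) - c x0 y"

lemma moment_defect_nonneg: "0 \<le> moment_defect x y"
  using growth4[of x0 y x] by (simp add: moment_defect_def)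

lemma continuous_c_x0: "continuous_on UNIV (\<lambda>p :: 'a \<times> 'a. c (fst p) x0)"
proof -
  have "continuous_on UNIV (\<lambda>p :: 'a \<times> 'a. c (fst (fst p, x0)) (snd (fst p, x0)))"
    by (rule continuous_on_compose2[OF c_cont])
      (auto intro!: continuous_on_Pair continuous_on_const continuous_on_fst continuous_on_id)
  then show ?thesis by simp
qed

lemma continuous_moment_defect: "continuous_on UNIV (\<lambda>p. moment_defect (fst p) (snd p))"
  unfolding moment_defect_def
  by (intro continuous_on_add continuous_on_diff continuous_on_mult continuous_on_const continuous_g_snd c_cont continuous_c_x0)

text \<open>The term is \<open>c x x0\<close>, not \<open>c x0 x\<close>, so that it integrates to
  \<open>J \<mu> (return borel x0)\<close>: a cost with fixed second argument, whose integrals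
  against \<open>Pn n\<close> converge by \<open>integral_J_tendsto\<close>.\<close>

lemma coupling_moment_defect:
  assumes \<mu>: "\<mu> \<in> borel_probs" and \<nu>: "\<nu> \<in> borel_probs" and \<gamma>: "\<gamma> \<in> couplings borel \<mu> \<nu>"
  shows "plan_cost moment_defect \<gamma> + moment \<nu> =
    ennreal A + ennreal B * (J \<mu> (return borel x0) + plan_cost c \<gamma>)"
proof -
  note \<gamma>p = coupling_borel_prob[OF \<mu> \<nu> \<gamma>]
  note [measurable] = g_pair_measurable(2)[OF \<gamma>p] borel_measurable_borel_probs[OF \<gamma>p borel_measurable_continuous_onI[OF c_cont]]
    borel_measurable_borel_probs[OF \<gamma>p borel_measurable_continuous_onI[OF continuous_c_x0]]
    borel_measurable_borel_probs[OF \<gamma>p borel_measurable_continuous_onI[OF continuous_moment_defect]]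
  have "continuous_on UNIV (\<lambda>x. c (fst (x, x0)) (snd (x, x0)))"
    by (rule continuous_on_compose2[OF c_cont]) (auto intro!: continuous_on_Pair continuous_on_const continuous_on_id)
  then have cm: "(\<lambda>x. ennreal (c x x0)) \<in> borel_measurable borel"
    using borel_measurable_continuous_onI[of "\<lambda>x. c x x0"] by simp
  have "J \<mu> (return borel x0) = transport_cost (\<lambda>x y. c y x) (return borel x0) \<mu>"
    using transport_cost_swap[OF \<mu> return_borel_probs c_cont] by simp
  also have "\<dots> = (\<integral>\<^sup>+x. ennreal (c x x0) \<partial>\<mu>)" by (rule transport_cost_return[OF \<mu> c_swap_cont])
  also have "\<dots> = (\<integral>\<^sup>+p. ennreal (c (fst p) x0) \<partial>\<gamma>)" by (rule nn_integral_coupling_fst[OF \<mu> \<nu> \<gamma> cm, symmetric])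
  finally have Jr: "J \<mu> (return borel x0) = (\<integral>\<^sup>+p. ennreal (c (fst p) x0) \<partial>\<gamma>)" .
  have "plan_cost moment_defect \<gamma> + moment \<nu> =
    plan_cost moment_defect \<gamma> + (\<integral>\<^sup>+p. ennreal (c x0 (snd p)) \<partial>\<gamma>)"
    using nn_integral_coupling_snd[OF \<mu> \<nu> \<gamma>, of "\<lambda>x. ennreal (c x0 x)"] g_measurable by (simp add: moment_def)
  also have "\<dots> = (\<integral>\<^sup>+p. ennreal (moment_defect (fst p) (snd p)) + ennreal (c x0 (snd p)) \<partial>\<gamma>)"
    by (rule nn_integral_add[symmetric]) auto
  also have "\<dots> = (\<integral>\<^sup>+p. ennreal (A + B * (c (fst p) x0 + c (fst p) (snd p))) \<partial>\<gamma>)"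
  proof (rule nn_integral_cong)
    fix p
    have "ennreal (moment_defect (fst p) (snd p)) + ennreal (c x0 (snd p)) = ennreal (moment_defect (fst p) (snd p) + c x0 (snd p))"
      by (rule ennreal_plus[symmetric]) (rule moment_defect_nonneg c_nonneg)+
    then show "ennreal (moment_defect (fst p) (snd p)) + ennreal (c x0 (snd p)) = ennreal (A + B * (c (fst p) x0 + c (fst p) (snd p)))"
      by (simp add: moment_defect_def)
  qed
  also have "\<dots> = ennreal A + ennreal B * ((\<integral>\<^sup>+p. ennreal (c (fst p) x0) \<partial>\<gamma>) + plan_cost c \<gamma>)"
    by (rule nn_integral_affine[OF borel_probsD(1)[OF \<gamma>p] A B c_nonneg c_nonneg]) measurable
  finally show ?thesis unfolding Jr .
qed

text \<open>Plan by plan the two costs are tied by an identity whose other terms depend on the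
  marginals only, so it passes to the infima. Each inequality uses a near-optimal plan for the cost
  on its larger side.\<close>

lemma transport_cost_moment_defect:
  assumes \<mu>: "\<mu> \<in> borel_probs" and \<nu>: "\<nu> \<in> borel_probs"
  shows "transport_cost moment_defect \<mu> \<nu> + moment \<nu> = ennreal A + ennreal B * (J \<mu> (return borel x0) + J \<mu> \<nu>)"
proof (rule antisym)
  show "transport_cost moment_defect \<mu> \<nu> + moment \<nu> \<le> ennreal A + ennreal B * (J \<mu> (return borel x0) + J \<mu> \<nu>)"
  proof (rule ennreal_le_epsilon)
    fix e :: real assume e: "0 < e"
    define d where "d = e / (B + 1)"
    have d: "0 < d" "B * d \<le> e" using e B by (auto simp: d_def field_simps)
    obtain \<gamma> where \<gamma>: "\<gamma> \<in> couplings borel \<mu> \<nu>"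
      and le: "plan_cost c \<gamma> \<le> J \<mu> \<nu> + ennreal d"
      using transport_cost_approx[OF \<mu> \<nu> d(1)] .
    have "transport_cost moment_defect \<mu> \<nu> + moment \<nu> \<le> plan_cost moment_defect \<gamma> + moment \<nu>"
      by (intro add_mono transport_cost_le[OF \<gamma>] order_refl)
    also have "\<dots> = ennreal A + ennreal B * (J \<mu> (return borel x0) + plan_cost c \<gamma>)"
      by (rule coupling_moment_defect[OF \<mu> \<nu> \<gamma>])
    also have "\<dots> \<le> ennreal A + ennreal B * (J \<mu> (return borel x0) + (J \<mu> \<nu> + ennreal d))"
      using le by (intro add_mono mult_left_mono) auto
    also have "\<dots> = ennreal A + ennreal B * (J \<mu> (return borel x0) + J \<mu> \<nu>) + ennreal (B * d)"
      using B d(1) by (simp add: ennreal_mult distrib_left add.assoc)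
    also have "\<dots> \<le> ennreal A + ennreal B * (J \<mu> (return borel x0) + J \<mu> \<nu>) + ennreal e"
      using d by (intro add_mono ennreal_leI) auto
    finally show "transport_cost moment_defect \<mu> \<nu> + moment \<nu> \<le> ennreal A + ennreal B * (J \<mu> (return borel x0) + J \<mu> \<nu>) + ennreal e" .
  qed
  show "ennreal A + ennreal B * (J \<mu> (return borel x0) + J \<mu> \<nu>) \<le> transport_cost moment_defect \<mu> \<nu> + moment \<nu>"
  proof (rule ennreal_le_epsilon)
    fix e :: real assume e: "0 < e"
    obtain \<gamma> where \<gamma>: "\<gamma> \<in> couplings borel \<mu> \<nu>"
      and le: "plan_cost moment_defect \<gamma> \<le> transport_cost moment_defect \<mu> \<nu> + ennreal e"
      using transport_cost_approx[OF \<mu> \<nu> e] .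
    have "ennreal A + ennreal B * (J \<mu> (return borel x0) + J \<mu> \<nu>) \<le>
        ennreal A + ennreal B * (J \<mu> (return borel x0) + plan_cost c \<gamma>)"
      by (intro add_mono mult_left_mono transport_cost_le[OF \<gamma>] order_refl) simp
    also have "\<dots> = plan_cost moment_defect \<gamma> + moment \<nu>"
      by (rule coupling_moment_defect[OF \<mu> \<nu> \<gamma>, symmetric])
    also have "\<dots> \<le> (transport_cost moment_defect \<mu> \<nu> + ennreal e) + moment \<nu>" by (intro add_mono le order_refl)
    finally show "ennreal A + ennreal B * (J \<mu> (return borel x0) + J \<mu> \<nu>) \<le> transport_cost moment_defect \<mu> \<nu> + moment \<nu> + ennreal e"
      by (simp add: add_ac)
  qed
qed

lemma integral_moment_defect:
  assumes Q: "Q \<in> P0" and \<nu>: "\<nu> \<in> E0"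
  shows "(\<integral>\<^sup>+\<mu>. transport_cost moment_defect \<mu> \<nu> \<partial>Q) + moment \<nu> =
    ennreal A + ennreal B * ((\<integral>\<^sup>+\<mu>. J \<mu> (return borel x0) \<partial>Q) + (\<integral>\<^sup>+\<mu>. J \<mu> \<nu> \<partial>Q))"
proof -
  interpret prob_space Q by (rule P0D(1)[OF Q])
  note [measurable] = P0D(3)[OF Q measurable_cost_E0[OF c_cont c_nonneg \<nu>]] P0D(3)[OF Q measurable_cost_E0[OF c_cont c_nonneg return_E0]]
    P0D(3)[OF Q measurable_cost_E0[OF continuous_moment_defect moment_defect_nonneg \<nu>]]
  have "(\<integral>\<^sup>+\<mu>. transport_cost moment_defect \<mu> \<nu> \<partial>Q) + moment \<nu> = (\<integral>\<^sup>+\<mu>. transport_cost moment_defect \<mu> \<nu> + moment \<nu> \<partial>Q)"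
    by (simp add: nn_integral_add emeasure_space_1)
  also have "\<dots> = (\<integral>\<^sup>+\<mu>. ennreal A + ennreal B * (J \<mu> (return borel x0) + J \<mu> \<nu>) \<partial>Q)"
    by (intro nn_integral_cong transport_cost_moment_defect E0D(1)[OF \<nu>]) (simp add: P0D(2)[OF Q] E0D)
  also have "\<dots> = ennreal A + ennreal B * ((\<integral>\<^sup>+\<mu>. J \<mu> (return borel x0) \<partial>Q) + (\<integral>\<^sup>+\<mu>. J \<mu> \<nu> \<partial>Q))"
    by (simp add: nn_integral_add nn_integral_cmult emeasure_space_1)
  finally show ?thesis .
qed

end

section \<open>Convergence and finiteness of integrated costs\<close>

context transport_space
begin

lemma integral_J_tendsto:
  assumes Pn: "\<And>n. Pn n \<in> P0" and P: "P \<in> P0" and lim: "(\<lambda>n. outer_cost c x0 (Pn n) P) \<longlonglongrightarrow> 0"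
    and \<nu>: "\<nu> \<in> E0" and fin: "(\<integral>\<^sup>+\<mu>. moment \<mu> \<partial>P) < \<infinity>"
  shows "(\<lambda>n. \<integral>\<^sup>+\<mu>. J \<mu> \<nu> \<partial>Pn n) \<longlonglongrightarrow> (\<integral>\<^sup>+\<mu>. J \<mu> \<nu> \<partial>P)"
proof (rule tendsto_ennreal_of_liminf_limsup)
  obtain m where m: "moment \<nu> = ennreal m" using E0D(2)[OF \<nu>] by (cases "moment \<nu>") auto
  show "(\<integral>\<^sup>+\<mu>. J \<mu> \<nu> \<partial>P) \<le> liminf (\<lambda>n. \<integral>\<^sup>+\<mu>. J \<mu> \<nu> \<partial>Pn n)"
    by (rule integral_cost_liminf[where \<nu>="\<lambda>_. \<nu>" and M=m, OF Pn P lim E0D(1)[OF \<nu>] E0D(1)[OF \<nu>] weakly_converges_const _ c_cont c_nonneg])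
      (simp add: m)
  show "limsup (\<lambda>n. \<integral>\<^sup>+\<mu>. J \<mu> \<nu> \<partial>Pn n) \<le> (\<integral>\<^sup>+\<mu>. J \<mu> \<nu> \<partial>P)"
    unfolding Limsup_le_iff using integral_J_usc[OF Pn P lim \<nu> fin] by blast
qed

lemma integral_J_finite:
  assumes Q: "Q \<in> P0" and \<nu>: "\<nu> \<in> E0" and fin: "(\<integral>\<^sup>+\<mu>. moment \<mu> \<partial>Q) < \<infinity>"
  shows "(\<integral>\<^sup>+\<mu>. J \<mu> \<nu> \<partial>Q) < \<infinity>"
proof -
  interpret prob_space Q by (rule P0D(1)[OF Q])
  have "(\<integral>\<^sup>+\<mu>. J \<mu> \<nu> \<partial>Q) \<le> (\<integral>\<^sup>+\<mu>. ennreal A + ennreal B * (moment \<mu> + moment \<nu>) \<partial>Q)"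
    by (intro nn_integral_mono J_le_moments E0D(1)[OF \<nu>]) (simp add: P0D(2)[OF Q] E0D)
  also have "\<dots> = ennreal A + ennreal B * ((\<integral>\<^sup>+\<mu>. moment \<mu> \<partial>Q) + moment \<nu>)"
    using P0D(3)[OF Q measurable_moment] by (simp add: nn_integral_add nn_integral_cmult emeasure_space_1)
  also have "\<dots> < \<infinity>" using fin E0D(2)[OF \<nu>] by (simp add: ennreal_mult_less_top)
  finally show ?thesis .
qed

end

section \<open>Minimisers along a convergent sequence\<close>

context penalized_space
begin

lemma barycenters_E0:
  assumes "Q \<in> P0" "\<nu> \<in> barycenters c G Q"
  shows "\<nu> \<in> E0" "(\<integral>\<^sup>+\<mu>. J \<mu> \<nu> \<partial>Q) < \<infinity>" "penalty \<nu> < \<infinity>"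
proof -
  have \<nu>: "\<nu> \<in> borel_probs" "objective Q \<nu> < \<infinity>" using assms(2) by (auto simp: barycenters_iff)
  then show "(\<integral>\<^sup>+\<mu>. J \<mu> \<nu> \<partial>Q) < \<infinity>" "penalty \<nu> < \<infinity>" by (simp_all add: objective_def)
  then show "\<nu> \<in> E0" using finite_integral_J_E0[OF assms(1) \<nu>(1)] by blast
qed

context
  fixes P :: "'a measure measure" and Pn :: "nat \<Rightarrow> 'a measure measure" and \<rho> :: "'a measure"
  assumes Pn: "\<And>n. Pn n \<in> P0" and P: "P \<in> P0" and lim: "(\<lambda>n. outer_cost c x0 (Pn n) P) \<longlonglongrightarrow> 0"
    and \<rho>: "\<rho> \<in> barycenters c G P"
begin

lemma finite_integral_moment: "(\<integral>\<^sup>+\<mu>. moment \<mu> \<partial>P) < \<infinity>"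
proof -
  have "(\<integral>\<^sup>+\<mu>. moment \<mu> \<partial>P) \<le> ennreal A + ennreal B * (moment \<rho> + (\<integral>\<^sup>+\<mu>. J \<mu> \<rho> \<partial>P))"
    by (rule integral_moment_le[OF P barycenters_E0(1)[OF P \<rho>]])
  also have "\<dots> < \<infinity>" using E0D(2)[OF barycenters_E0(1)[OF P \<rho>]] barycenters_E0(2)[OF P \<rho>] by (simp add: ennreal_mult_less_top)
  finally show ?thesis .
qed

text \<open>\<open>\<rho>\<close> is a competitor for every \<open>Pn n\<close>, and its integrated
  cost is eventually below \<open>i + 1\<close>. This bounds the minimal values and, by coercivity,
  the moments of all minimisers.\<close>

lemma eventually_barycenters_bounded:
  "\<exists>n0 M. \<forall>n\<ge>n0. objective (Pn n) \<rho> < \<infinity> \<and> (\<forall>\<nu>\<in>barycenters c G (Pn n). \<nu> \<in> E0 \<and> moment \<nu> \<le> ennreal M)"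
proof -
  note \<rho>E = barycenters_E0[OF P \<rho>]
  obtain i where i: "(\<integral>\<^sup>+\<mu>. J \<mu> \<rho> \<partial>P) = ennreal i" "0 \<le> i" using \<rho>E(2) by (cases "\<integral>\<^sup>+\<mu>. J \<mu> \<rho> \<partial>P") auto
  have "(\<integral>\<^sup>+\<mu>. J \<mu> \<rho> \<partial>P) < ennreal (i + 1)" using i by (simp add: ennreal_less_iff del: ennreal_plus)
  from integral_J_usc[OF Pn P lim \<rho>E(1) finite_integral_moment this]
  obtain n0 where n0: "\<And>n. n0 \<le> n \<Longrightarrow> (\<integral>\<^sup>+\<mu>. J \<mu> \<rho> \<partial>Pn n) < ennreal (i + 1)" unfolding eventually_sequentially by blast
  define C where "C = ennreal A + ennreal B *
    ((ennreal A + ennreal B * (moment \<rho> + ennreal (i + 1))) + (ennreal (i + 1) + penalty \<rho>))"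
  have "C < \<infinity>" unfolding C_def using E0D(2)[OF \<rho>E(1)] \<rho>E(3) by (simp add: ennreal_mult_less_top del: ennreal_plus)
  then obtain M where M: "C = ennreal M" by (cases C) auto
  show ?thesis
  proof (intro exI[of _ n0] exI[of _ M] allI impI conjI ballI)
    fix n assume n: "n0 \<le> n"
    have ob: "objective (Pn n) \<rho> \<le> ennreal (i + 1) + penalty \<rho>"
      unfolding objective_def using n0[OF n] by (intro add_mono) auto
    also have "\<dots> < \<infinity>" using \<rho>E(3) by (simp del: ennreal_plus)
    finally show "objective (Pn n) \<rho> < \<infinity>" .
    fix \<nu> assume \<nu>: "\<nu> \<in> barycenters c G (Pn n)"
    show \<nu>E: "\<nu> \<in> E0" by (rule barycenters_E0(1)[OF Pn \<nu>])
    have "(\<integral>\<^sup>+\<mu>. J \<mu> \<nu> \<partial>Pn n) \<le> objective (Pn n) \<nu>" by (simp add: objective_def)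
    also have "\<dots> \<le> objective (Pn n) \<rho>" using \<nu> E0D(1)[OF \<rho>E(1)] by (auto simp: barycenters_iff)
    finally have I: "(\<integral>\<^sup>+\<mu>. J \<mu> \<nu> \<partial>Pn n) \<le> ennreal (i + 1) + penalty \<rho>" using ob by (rule order_trans)
    have "moment \<nu> \<le> ennreal A + ennreal B *
      ((ennreal A + ennreal B * (moment \<rho> + (\<integral>\<^sup>+\<mu>. J \<mu> \<rho> \<partial>Pn n))) + (\<integral>\<^sup>+\<mu>. J \<mu> \<nu> \<partial>Pn n))"
      by (rule moment_le_integral[OF Pn \<nu>E \<rho>E(1)])
    also have "\<dots> \<le> C" unfolding C_def using n0[OF n] I by (intro add_mono mult_left_mono) auto
    finally show "moment \<nu> \<le> ennreal M" unfolding M .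
  qed
qed

text \<open>The indices \<open>u\<close> need only tend to infinity, since sequences drawn from the
  minimisers can come in any order. Minimality is inherited by comparing with \<open>\<rho>\<close>,
  whose objective values converge.\<close>

lemma barycenters_weak_limit:
  assumes u: "filterlim u at_top sequentially" and \<nu>: "\<And>k. \<nu> k \<in> barycenters c G (Pn (u k))"
    and bd: "\<And>k. moment (\<nu> k) \<le> ennreal M" and w: "weakly_converges \<nu> \<nu>'" and \<nu>': "\<nu>' \<in> borel_probs"
  shows "\<nu>' \<in> E0" "\<nu>' \<in> barycenters c G P" "(\<lambda>k. moment (\<nu> k)) \<longlonglongrightarrow> moment \<nu>'"
proof -
  note \<rho>E = barycenters_E0[OF P \<rho>]
  note Pu = Pn[of "u _"]
  have limu: "(\<lambda>k. outer_cost c x0 (Pn (u k)) P) \<longlonglongrightarrow> 0" by (rule filterlim_compose[OF lim u])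
  have \<nu>E: "\<nu> k \<in> E0" for k by (rule barycenters_E0(1)[OF Pn \<nu>])
  note \<nu>p = E0D(1)[OF \<nu>E]
  have "moment \<nu>' \<le> liminf (\<lambda>k. moment (\<nu> k))" by (rule moment_liminf[OF w \<nu>p \<nu>'])
  also have "\<dots> \<le> liminf (\<lambda>k :: nat. ennreal M)" by (intro Liminf_mono always_eventually allI bd)
  also have "\<dots> < \<infinity>" by (simp add: Liminf_const)
  finally show \<nu>'E: "\<nu>' \<in> E0" using \<nu>' by (simp add: E0_def)
  let ?I = "\<lambda>k. \<integral>\<^sup>+\<mu>. J \<mu> (\<nu> k) \<partial>Pn (u k)"
  have lI: "(\<integral>\<^sup>+\<mu>. J \<mu> \<nu>' \<partial>P) \<le> liminf ?I"
    by (rule integral_cost_liminf[where Pn="\<lambda>k. Pn (u k)" and \<nu>=\<nu>, OF Pn P limu \<nu>p \<nu>' w bd c_cont c_nonneg])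
  have lp: "penalty \<nu>' \<le> liminf (\<lambda>k. penalty (\<nu> k))" by (rule penalty_liminf[OF w \<nu>p \<nu>'])
  have "(\<lambda>k. (\<integral>\<^sup>+\<mu>. J \<mu> \<rho> \<partial>Pn (u k)) + penalty \<rho>) \<longlonglongrightarrow> (\<integral>\<^sup>+\<mu>. J \<mu> \<rho> \<partial>P) + penalty \<rho>"
    by (intro tendsto_add tendsto_const filterlim_compose[OF integral_J_tendsto[OF Pn P lim \<rho>E(1) finite_integral_moment] u])
  then have obj_lim: "(\<lambda>k. objective (Pn (u k)) \<rho>) \<longlonglongrightarrow> objective P \<rho>" by (simp add: objective_def)
  have obj_le: "penalty (\<nu> k) + ?I k \<le> objective (Pn (u k)) \<rho>" for k
    using \<nu>[of k] E0D(1)[OF \<rho>E(1)] by (auto simp: barycenters_iff objective_def add.commute)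
  have "objective P \<nu>' \<le> liminf ?I + liminf (\<lambda>k. penalty (\<nu> k))"
    unfolding objective_def by (intro add_mono lI lp)
  also have "\<dots> \<le> liminf (\<lambda>k. ?I k + penalty (\<nu> k))" by (rule liminf_add_ennreal)
  also have "\<dots> \<le> liminf (\<lambda>k. objective (Pn (u k)) \<rho>)"
    using obj_le by (intro Liminf_mono always_eventually allI) (simp add: add.commute)
  also have "\<dots> = objective P \<rho>" by (rule lim_imp_Liminf[OF _ obj_lim]) simp
  finally have le: "objective P \<nu>' \<le> objective P \<rho>" .
  moreover have "objective P \<rho> \<le> objective P \<nu>'" using \<rho> \<nu>' by (auto simp: barycenters_iff)
  ultimately have eq: "objective P \<nu>' = objective P \<rho>" by (rule antisym)
  show \<nu>'b: "\<nu>' \<in> barycenters c G P" using \<rho> \<nu>' by (simp add: barycenters_iff eq)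
  note \<nu>'F = barycenters_E0[OF P \<nu>'b]
  \<comment> \<open>The sum of penalty and integrated cost is bounded by a sequence converging to
    its value at \<open>\<nu>'\<close>, and each part is lower semicontinuous; hence the integrated
    cost cannot jump.\<close>
  have "limsup ?I \<le> (\<integral>\<^sup>+\<mu>. J \<mu> \<nu>' \<partial>P)"
  proof (rule limsup_le_of_liminf_add[OF obj_le _ lp \<nu>'F(3,2)])
    show "(\<lambda>k. objective (Pn (u k)) \<rho>) \<longlonglongrightarrow> penalty \<nu>' + (\<integral>\<^sup>+\<mu>. J \<mu> \<nu>' \<partial>P)"
      using obj_lim unfolding eq[symmetric] by (simp add: objective_def add.commute)
  qed
  with lI have I: "?I \<longlonglongrightarrow> (\<integral>\<^sup>+\<mu>. J \<mu> \<nu>' \<partial>P)" by (rule tendsto_ennreal_of_liminf_limsup)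
  let ?D = "\<lambda>Q \<nu>. \<integral>\<^sup>+\<mu>. transport_cost moment_defect \<mu> \<nu> \<partial>Q"
  let ?R = "\<lambda>Q. \<integral>\<^sup>+\<mu>. J \<mu> (return borel x0) \<partial>Q"
  have lD: "?D P \<nu>' \<le> liminf (\<lambda>k. ?D (Pn (u k)) (\<nu> k))"
    by (rule integral_cost_liminf[where Pn="\<lambda>k. Pn (u k)" and \<nu>=\<nu>, OF Pn P limu \<nu>p \<nu>' w bd continuous_moment_defect moment_defect_nonneg])
  have eqD: "?D P \<nu>' + moment \<nu>' = ennreal A + ennreal B * (?R P + (\<integral>\<^sup>+\<mu>. J \<mu> \<nu>' \<partial>P))"
    by (rule integral_moment_defect[OF P \<nu>'E])
  have R: "(\<lambda>k. ?R (Pn (u k))) \<longlonglongrightarrow> ?R P"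
    by (rule filterlim_compose[OF integral_J_tendsto[OF Pn P lim return_E0 finite_integral_moment] u])
  \<comment> \<open>The same argument once more: now \<open>?D\<close> is the lower semicontinuous
    part, and its sum with the moment converges because \<open>?R\<close> and \<open>?I\<close>
    do.\<close>
  have "limsup (\<lambda>k. moment (\<nu> k)) \<le> moment \<nu>'"
  proof (rule limsup_le_of_liminf_add[OF _ _ lD])
    show "?D (Pn (u k)) (\<nu> k) + moment (\<nu> k) \<le> ennreal A + ennreal B * (?R (Pn (u k)) + ?I k)" for k
      using integral_moment_defect[OF Pn \<nu>E, of "u k" k] by simp
    show "(\<lambda>k. ennreal A + ennreal B * (?R (Pn (u k)) + ?I k)) \<longlonglongrightarrow> ?D P \<nu>' + moment \<nu>'"
      unfolding eqD by (intro tendsto_add tendsto_const ennreal_tendsto_cmult R I) simp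
    have "?D P \<nu>' + moment \<nu>' < \<infinity>"
      unfolding eqD using integral_J_finite[OF P return_E0 finite_integral_moment] \<nu>'F(2) by (simp add: ennreal_mult_less_top)
    then show "?D P \<nu>' < \<infinity>" by simp
    show "moment \<nu>' < \<infinity>" by (rule E0D(2)[OF \<nu>'E])
  qed
  with moment_liminf[OF w \<nu>p \<nu>'] show "(\<lambda>k. moment (\<nu> k)) \<longlonglongrightarrow> moment \<nu>'"
    by (rule tendsto_ennreal_of_liminf_limsup)
qed

lemma barycenters_subsequence:
  assumes u: "filterlim u at_top sequentially" and \<nu>: "\<And>k. \<nu> k \<in> barycenters c G (Pn (u k))"
    and bd: "\<And>k. moment (\<nu> k) \<le> ennreal M"
  shows "\<exists>r \<nu>'. strict_mono (r :: nat \<Rightarrow> nat) \<and> \<nu>' \<in> E0 \<and> weakly_converges (\<lambda>k. \<nu> (r k)) \<nu>' \<and>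
    (\<lambda>k. moment (\<nu> (r k))) \<longlonglongrightarrow> moment \<nu>' \<and> \<nu>' \<in> barycenters c G P"
proof -
  have \<nu>p: "\<nu> k \<in> borel_probs" for k using \<nu> by (simp add: barycenters_iff)
  obtain r \<nu>' where r: "strict_mono (r :: nat \<Rightarrow> nat)" "\<nu>' \<in> borel_probs" "weakly_converges (\<nu> \<circ> r) \<nu>'"
    by (rule moment_bounded_subsequence[OF \<nu>p bd])
  have w: "weakly_converges (\<lambda>k. \<nu> (r k)) \<nu>'" using r(3) by (simp add: o_def)
  have ur: "filterlim (\<lambda>k. u (r k)) at_top sequentially" by (rule filterlim_compose[OF u filterlim_subseq[OF r(1)]])
  from barycenters_weak_limit[where u="\<lambda>k. u (r k)" and \<nu>="\<lambda>k. \<nu> (r k)", OF ur \<nu> bd w r(2)] r(1) w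
  show ?thesis by blast
qed

lemma barycenters_stability:
  "\<exists>n0. (\<forall>n\<ge>n0. barycenters c G (Pn n) \<noteq> {}) \<and>
    (\<forall>\<nu>. (\<forall>n\<ge>n0. \<nu> n \<in> barycenters c G (Pn n)) \<longrightarrow>
       precompact_in (cost_topology c) (\<nu> ` {n0..}) \<and>
       (\<forall>s \<nu>'. strict_mono s \<and> (\<forall>k. n0 \<le> s k) \<and>
          limitin (cost_topology c) (\<nu> \<circ> s) \<nu>' sequentially \<longrightarrow> \<nu>' \<in> barycenters c G P) \<and>
       (\<forall>\<nu>s. barycenters c G P = {\<nu>s} \<longrightarrow> limitin (cost_topology c) \<nu> \<nu>s sequentially))"
proof -
  obtain n0 M where ob: "\<And>n. n0 \<le> n \<Longrightarrow> objective (Pn n) \<rho> < \<infinity>"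
    and bE: "\<And>n \<nu>. n0 \<le> n \<Longrightarrow> \<nu> \<in> barycenters c G (Pn n) \<Longrightarrow> \<nu> \<in> E0"
    and bM: "\<And>n \<nu>. n0 \<le> n \<Longrightarrow> \<nu> \<in> barycenters c G (Pn n) \<Longrightarrow> moment \<nu> \<le> ennreal M"
    using eventually_barycenters_bounded by auto
  show ?thesis
  proof (intro exI[of _ n0] conjI allI impI)
    fix n assume "n0 \<le> n"
    then show "barycenters c G (Pn n) \<noteq> {}"
      using barycenters_nonempty[OF Pn barycenters_E0(1)[OF P \<rho>]] ob by blast
  next
    fix \<nu> assume \<nu>: "\<forall>n\<ge>n0. \<nu> n \<in> barycenters c G (Pn n)"
    then have \<nu>b: "\<nu> n \<in> barycenters c G (Pn n)" if "n0 \<le> n" for n using that by blast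
    have \<nu>E: "\<nu> n \<in> E0" and \<nu>M: "moment (\<nu> n) \<le> ennreal M" if "n0 \<le> n" for n
      using bE[OF that \<nu>b[OF that]] bM[OF that \<nu>b[OF that]] .
    show "precompact_in (cost_topology c) (\<nu> ` {n0..})"
    proof (rule precompact_in_cost_topologyI)
      show "\<nu> ` {n0..} \<subseteq> E0" using \<nu>E by auto
      fix \<sigma> :: "nat \<Rightarrow> 'a measure" assume "\<And>n. \<sigma> n \<in> \<nu> ` {n0..}"
      then have "\<forall>n. \<exists>j. n0 \<le> j \<and> \<sigma> n = \<nu> j" by (auto simp: image_iff)
      from choice[OF this] obtain j where j: "\<And>n. n0 \<le> j n" "\<And>n. \<sigma> n = \<nu> (j n)" by auto
      show "\<exists>r \<nu>'. strict_mono (r :: nat \<Rightarrow> nat) \<and> \<nu>' \<in> E0 \<and>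
        weakly_converges (\<lambda>n. \<sigma> (r n)) \<nu>' \<and> (\<lambda>n. moment (\<sigma> (r n))) \<longlonglongrightarrow> moment \<nu>'"
      \<comment> \<open>If one index recurs, the constant subsequence converges to a member of the
        family; otherwise the indices tend to infinity and the weak limits above apply.\<close>
      proof (cases rule: nat_seq_const_subseq_or_at_top[of j])
        case (const v r)
        then have "n0 \<le> v" using j(1)[of "r 0"] by simp
        then show ?thesis using const \<nu>E[of v] weakly_converges_const[of "\<nu> v"]
          by (intro exI[of _ r] exI[of _ "\<nu> v"]) (simp add: j(2))
      next
        case at_top
        from barycenters_subsequence[where \<nu>=\<sigma>, OF at_top _ , of M] \<nu>b \<nu>M j show ?thesis by auto
      qed
    qed
    show "\<nu>' \<in> barycenters c G P" if s: "strict_mono s \<and> (\<forall>k. n0 \<le> s k) \<and>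
        limitin (cost_topology c) (\<nu> \<circ> s) \<nu>' sequentially" for s \<nu>'
    proof -
      have sE: "(\<nu> \<circ> s) k \<in> E0" for k using s \<nu>E by simp
      note l = limitin_cost_topologyD[OF conjunct2[OF conjunct2[OF s]] sE]
      show ?thesis
        by (rule barycenters_weak_limit(2)[where \<nu>="\<nu> \<circ> s" and u=s and M=M, OF filterlim_subseq _ _ l(2) E0D(1)[OF l(1)]])
          (use s \<nu>b \<nu>M in auto)
    qed
    show "limitin (cost_topology c) \<nu> \<nu>s sequentially" if single: "barycenters c G P = {\<nu>s}" for \<nu>s
      unfolding limitin_def
    proof (intro conjI allI impI)
      have "\<nu>s \<in> barycenters c G P" using single by simp
      then show "\<nu>s \<in> topspace (cost_topology c)" by (simp add: barycenters_iff topspace_cost_topology)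
      fix U assume U: "openin (cost_topology c) U \<and> \<nu>s \<in> U"
      show "\<forall>\<^sub>F n in sequentially. \<nu> n \<in> U"
      \<comment> \<open>A subsequence avoiding \<open>U\<close> would have a further subsequence
        converging in the cost topology to a minimiser for \<open>P\<close>, that is to
        \<open>\<nu>s\<close>.\<close>
      proof (rule ccontr)
        assume "\<not> ?thesis"
        from not_eventually_sequentiallyD[OF this] obtain s where s: "strict_mono (s :: nat \<Rightarrow> nat)" "\<And>n. \<nu> (s n) \<notin> U" by auto
        \<comment> \<open>A strictly increasing \<open>s\<close> satisfies
          \<open>k \<le> s k\<close>, so shifting by \<open>n0\<close> reaches indices where the
          bounds hold.\<close>
        have s0: "n0 \<le> s (k + n0)" for k using seq_suble[OF s(1), of "k + n0"] by simp
        have u: "filterlim (\<lambda>k. s (k + n0)) at_top sequentially"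
          by (rule filterlim_subseq) (use s(1) in \<open>simp add: strict_mono_def\<close>)
        from barycenters_subsequence[where \<nu>="\<lambda>k. \<nu> (s (k + n0))", OF u \<nu>b[OF s0] \<nu>M[OF s0]]
        obtain r \<nu>' where r: "strict_mono (r :: nat \<Rightarrow> nat)" "\<nu>' \<in> E0" "weakly_converges (\<lambda>k. \<nu> (s (r k + n0))) \<nu>'"
          "(\<lambda>k. moment (\<nu> (s (r k + n0)))) \<longlonglongrightarrow> moment \<nu>'" "\<nu>' \<in> barycenters c G P"
          by (elim exE conjE)
        have "\<nu>' = \<nu>s" using r(5) single by simp
        with limitin_cost_topologyI[OF r(2) E0D(1)[OF \<nu>E[OF s0]] r(3,4)]
        have l: "limitin (cost_topology c) (\<lambda>k. \<nu> (s (r k + n0))) \<nu>s sequentially" by simp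
        have "\<forall>\<^sub>F k in sequentially. \<nu> (s (r k + n0)) \<in> U"
          by (rule l[unfolded limitin_def, THEN conjunct2, rule_format, OF U])
        then show False using s(2) by simp
      qed
    qed
  qed
qed

end

end

theorem theorem5p5:
  fixes c :: "'a::{metric_space,second_countable_topology} \<Rightarrow> 'a \<Rightarrow> real"
    and x0 :: 'a
    and G :: "'a measure \<Rightarrow> ereal"
    and P :: "'a measure measure"
    and Pn :: "nat \<Rightarrow> 'a measure measure"
  assumes radon: "radon_space TYPE('a)"
    and c_nonneg: "\<And>x y. 0 \<le> c x y"
    and c_cont: "continuous_on UNIV (\<lambda>(x, y). c x y)"
    and c_consistent: "consistent_cost c"
    and c_growth: "growth_condition c"
    and c_compact: "compact_cost_balls c"
    and G_bdd: "\<exists>b::real. \<forall>\<nu>\<in>space (prob_algebra borel). ereal b \<le> G \<nu>"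
    and G_lsc: "weakly_lsc G"
    and Pn_prob: "\<And>n. Pn n \<in> space (prob_algebra (borel_of (finite_cost_topology c x0)))"
    and P_prob: "P \<in> space (prob_algebra (borel_of (finite_cost_topology c x0)))"
    and Pn_P: "(\<lambda>n. outer_cost c x0 (Pn n) P) \<longlonglongrightarrow> 0"
    and P_Pn: "(\<lambda>n. outer_cost c x0 P (Pn n)) \<longlonglongrightarrow> 0"
    and P_bar: "barycenters c G P \<noteq> {}"
  shows "\<exists>n0. (\<forall>n\<ge>n0. barycenters c G (Pn n) \<noteq> {}) \<and>
    (\<forall>\<nu>. (\<forall>n\<ge>n0. \<nu> n \<in> barycenters c G (Pn n)) \<longrightarrow>
       precompact_in (cost_topology c) (\<nu> ` {n0..}) \<and>
       (\<forall>s \<nu>'. strict_mono s \<and> (\<forall>k. n0 \<le> s k) \<and>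
          limitin (cost_topology c) (\<nu> \<circ> s) \<nu>' sequentially \<longrightarrow> \<nu>' \<in> barycenters c G P) \<and>
       (\<forall>\<nu>s. barycenters c G P = {\<nu>s} \<longrightarrow> limitin (cost_topology c) \<nu> \<nu>s sequentially))"
proof -
  from c_growth obtain A B where A: "0 \<le> A" and B: "0 \<le> B"
    and growth: "\<forall>x y z. c x y \<le> A + B * (c x z + c y z) \<and> c x y \<le> A + B * (c x z + c z y) \<and>
      c x y \<le> A + B * (c z x + c y z) \<and> c x y \<le> A + B * (c z x + c z y)"
    unfolding growth_condition_def by blast
  from G_bdd obtain b where b: "\<forall>\<nu>\<in>space (prob_algebra borel). ereal b \<le> G \<nu>" by blast
  from c_compact obtain x1 where x1: "\<And>r. 0 \<le> r \<Longrightarrow> compact {y. c x1 y \<le> r}"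
    unfolding compact_cost_balls_def by blast
  have cont: "continuous_on UNIV (\<lambda>p. c (fst p) (snd p))" using c_cont by (simp add: case_prod_beta)
  have cont0: "continuous_on UNIV (\<lambda>y. c (fst (x0, y)) (snd (x0, y)))"
    by (rule continuous_on_compose2[OF cont]) (auto intro!: continuous_on_Pair continuous_on_const continuous_on_id)
  have cons: "(\<lambda>n. c x (xs n)) \<longlonglongrightarrow> 0 \<longleftrightarrow> xs \<longlonglongrightarrow> x" for x xs
    using c_consistent unfolding consistent_cost_def by blast
  \<comment> \<open>For a constant sequence, both sides of consistency become equalities.\<close>
  have zero: "c x y = 0 \<longleftrightarrow> x = y" for x y
    using cons[of x "\<lambda>_. y"] by (auto simp: LIMSEQ_const_iff)
  have comp: "compact {y. c x0 y \<le> r}" for r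
  proof -
    \<comment> \<open>Compactness is given for balls about some \<open>x1\<close>. The growth
      condition places the ball about \<open>x0\<close> in one of this radius about
      \<open>x1\<close>, of which it is a closed subset; the maximum keeps the radius
      nonnegative.\<close>
    let ?R = "max 0 (A + B * (c x1 x0 + r))"
    have "closed {y. c x0 y \<le> r}" using cont0 by (intro closed_Collect_le continuous_on_const) simp
    then have "compact ({y. c x1 y \<le> ?R} \<inter> {y. c x0 y \<le> r})" by (intro compact_Int_closed x1) simp
    moreover have "c x1 y \<le> ?R" if "c x0 y \<le> r" for y
    proof -
      have "c x1 y \<le> A + B * (c x1 x0 + c x0 y)" using growth by blast
      also have "\<dots> \<le> A + B * (c x1 x0 + r)" using that B by (intro add_mono mult_left_mono) auto
      finally show ?thesis by simp
    qed
    then have "{y. c x1 y \<le> ?R} \<inter> {y. c x0 y \<le> r} = {y. c x0 y \<le> r}" by auto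
    ultimately show ?thesis by simp
  qed
  interpret penalized_space c x0 A B G b
    by unfold_locales (use c_nonneg cont zero A B growth comp b G_lsc in auto)
  from P_bar obtain \<rho> where "\<rho> \<in> barycenters c G P" by blast
  from barycenters_stability[OF Pn_prob P_prob Pn_P this] show ?thesis .
qed

end
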